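(* Let $\mathcal{G}$ be a simplicial graph with vertex set $I$, let $\{E_i\}_{i\in I}$ be rank-one buildings, and let $\{G_i\}_{i\in I}$ be groups with $G_i$ acting transitively on $E_i$. Let $\overline{G}$ be the generalized graph product of the $G_i$ over $\mathcal{G}$, let $\widetilde{G}$ be the group of all lifts to $\widetilde{E}=\prod_{\mathcal{G}}E_i$ of the action of $\prod_{i\in I}G_i$ on $E=\prod_{i\in I}E_i$, and let $N=\prod_{i\in I}N_i$, where $N_i$ is the kernel of the action of $G_i$ on $E_i$. Then $\widetilde{G}\cong\overline{G}/N$.
   Context: A rank-one building is a set (of at least two chambers) with distance $\delta(C,C')=s$, the generator of $\mathbb{Z}_2$, whenever $C\ne C'$. Let $W$ be the right-angled Coxeter group with generating set $I$, where $i\neq j$ commute iff $\{i,j\}$ is an edge of $\mathcal{G}$, and $m(i,j)=\infty$ otherwise. Definition of $\widetilde{E}$. $E=\prod_iE_i$ is a building of type $\prod_i\mathbb{Z}_2$ with componentwise distance $\delta$. Let $K'$ be the Davis chamber of $(W,I)$: the geometric realization of the poset of spherical subsets of $I$ (subsets, including $\emptyset$, generating a finite subgroup of $W$), with mirrors $K'_i$ = realization of the subposet of spherical subsets containing $i$. Let $\mathcal{U}(E,K')=(E\times K')/\!\sim$, where $(C,x)\sim(D,y)$ iff $x=y$ and $\delta(C,D)$ lies in the subgroup generated by $\{i:x\in K'_i\}$. The graph product $\widetilde{E}=\prod_{\mathcal{G}}E_i$ is the set of copies of $K'$ in the universal cover of $\mathcal{U}(E,K')$, two distinct copies being $i$-adjacent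 if they share their $i$-mirror; it is a right-angled building of type $(W,I)$. The covering map induces $p:\widetilde{E}\to E$. Group of lifts. $\prod_iG_i$ acts on $E$ componentwise; $\widetilde{G}$ is the group of all automorphisms $\widetilde{g}$ of $\widetilde{E}$ (type preserving: preserving $i$-adjacency for every $i$) for which there is $g\in\prod_iG_i$ with $p\circ\widetilde{g}=g\circ p$. Generalized graph product. Fix $(C_i)_{i\in I}\in E$. Let $B_i$ be the stabilizer of $C_i$ in $G_i$ and $B=\prod_iB_i$. Let $H_i\subset\prod_kG_k$ be the product of the $B_k$ with the $i$-th factor replaced by $G_i$, and, for each edge $\{i,j\}$ of $\mathcal{G}$, let $H_{i,j}$ be the product of the $B_k$ with the $i$-th and $j$-th factors replaced by $G_i$ and $G_j$. The generalized graph product $\overline{G}$ is the direct limit (colimit in the category of groups) of $B$, the $H_i$ $(i\in I)$, and the $H_{i,j}$ ($\{i,j\}$ an edge) with the inclusion maps $B\hookrightarrow H_i$ and $H_i\hookrightarrow H_{i,j}$. One has $N\trianglelefteq B$, and $N$ is regarded as a subgroup of $\overline{G}$ through $B\to\overline{G}$. The index set $I$ is finite. *)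

theory Defs
  imports "HOL-Analysis.Analysis" "HOL-Algebra.Group_Action" "HOL-Algebra.Product_Groups"
    "HOL-Algebra.Generated_Groups"
begin

section \<open>Groups given by presentations and colimits of groups\<close>

text \<open>
  \<open>word_cong X R\<close> is the congruence on words over \<open>X\<close> generated by the relations \<open>u = v\<close>,
  \<open>(u, v) \<in> R\<close>. Words contain no formal inverses; in every use below the relations make
  each letter invertible, so that the quotient monoid is the group with that presentation.
\<close>

inductive word_cong :: "'a set \<Rightarrow> ('a list \<times> 'a list) set \<Rightarrow> 'a list \<Rightarrow> 'a list \<Rightarrow> bool"
  for X R where
  wc_refl: "w \<in> lists X \<Longrightarrow> word_cong X R w w"
| wc_sym: "word_cong X R u v \<Longrightarrow> word_cong X R v u"
| wc_trans: "word_cong X R u v \<Longrightarrow> word_cong X R v w \<Longrightarrow> word_cong X R u w"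
| wc_rel: "(u, v) \<in> R \<Longrightarrow> u \<in> lists X \<Longrightarrow> v \<in> lists X \<Longrightarrow> a \<in> lists X \<Longrightarrow> b \<in> lists X
    \<Longrightarrow> word_cong X R (a @ u @ b) (a @ v @ b)"

definition word_class :: "'a set \<Rightarrow> ('a list \<times> 'a list) set \<Rightarrow> 'a list \<Rightarrow> 'a list set" where
  "word_class X R w = {v. word_cong X R w v}"

definition presented :: "'a set \<Rightarrow> ('a list \<times> 'a list) set \<Rightarrow> 'a list set monoid" where
  "presented X R =
     \<lparr>carrier = word_class X R ` lists X,
      monoid.mult = (\<lambda>A B. \<Union>a\<in>A. \<Union>b\<in>B. word_class X R (a @ b)),
      one = word_class X R []\<rparr>"

lemma word_cong_lists: "word_cong X R u v \<Longrightarrow> u \<in> lists X \<and> v \<in> lists X"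
  by (induction rule: word_cong.induct) auto

lemma word_cong_ctx:
  "word_cong X R u v \<Longrightarrow> a \<in> lists X \<Longrightarrow> b \<in> lists X \<Longrightarrow> word_cong X R (a @ u @ b) (a @ v @ b)"
proof (induction rule: word_cong.induct)
  case (wc_rel u v c d)
  then show ?case using word_cong.wc_rel[of u v R X "a @ c" "d @ b"] by simp
next
  case (wc_refl w)
  then show ?case by (intro word_cong.wc_refl) simp
next
  case (wc_sym u v)
  then show ?case using word_cong.wc_sym by simp
next
  case (wc_trans u v w)
  then show ?case using word_cong.wc_trans by blast
qed

lemma word_cong_append:
  assumes "word_cong X R u u'" "word_cong X R v v'"
  shows "word_cong X R (u @ v) (u' @ v')"
proof -
  have "word_cong X R (u @ v) (u' @ v)"
    using word_cong_ctx[OF assms(1), of "[]" v] word_cong_lists[OF assms(2)] by simp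
  moreover have "word_cong X R (u' @ v) (u' @ v')"
    using word_cong_ctx[OF assms(2), of "u'" "[]"] word_cong_lists[OF assms(1)] by simp
  ultimately show ?thesis by (rule wc_trans)
qed

lemma word_class_eq_iff:
  assumes "u \<in> lists X"
  shows "word_class X R u = word_class X R v \<longleftrightarrow> word_cong X R u v"
proof
  assume "word_class X R u = word_class X R v"
  moreover have "u \<in> word_class X R u" using assms by (simp add: word_class_def wc_refl)
  ultimately show "word_cong X R u v" by (simp add: word_class_def wc_sym)
next
  assume "word_cong X R u v"
  then have "word_cong X R u w \<longleftrightarrow> word_cong X R v w" for w
    by (meson wc_sym wc_trans)
  then show "word_class X R u = word_class X R v" by (simp add: word_class_def)
qed

lemma presented_mult:
  assumes "u \<in> lists X" "v \<in> lists X"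
  shows "word_class X R u \<otimes>\<^bsub>presented X R\<^esub> word_class X R v = word_class X R (u @ v)"
proof -
  have "word_class X R (a @ b) = word_class X R (u @ v)"
    if "a \<in> word_class X R u" "b \<in> word_class X R v" for a b
  proof -
    have c: "word_cong X R (u @ v) (a @ b)"
      using that by (auto simp: word_class_def intro: word_cong_append)
    then show ?thesis using word_class_eq_iff[of "u @ v" X R "a @ b"] assms by simp
  qed
  moreover have "u \<in> word_class X R u" "v \<in> word_class X R v"
    using assms by (auto simp: word_class_def wc_refl)
  ultimately have "(\<Union>a\<in>word_class X R u. \<Union>b\<in>word_class X R v. word_class X R (a @ b)) =
      word_class X R (u @ v)"
    by blast
  then show ?thesis by (simp add: presented_def)
qed

lemma carrier_presented: "carrier (presented X R) = word_class X R ` lists X"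
  and one_presented: "\<one>\<^bsub>presented X R\<^esub> = word_class X R []"
  by (simp_all add: presented_def)

lemma group_presented:
  assumes "\<And>x. x \<in> X \<Longrightarrow> \<exists>y\<in>X. word_cong X R [y, x] []"
  shows "group (presented X R)"
proof (rule groupI)
  fix A B assume "A \<in> carrier (presented X R)" "B \<in> carrier (presented X R)"
  then obtain a b where "a \<in> lists X" "b \<in> lists X" "A = word_class X R a" "B = word_class X R b"
    by (auto simp: carrier_presented)
  then show "A \<otimes>\<^bsub>presented X R\<^esub> B \<in> carrier (presented X R)"
    by (simp add: carrier_presented presented_mult)
next
  show "\<one>\<^bsub>presented X R\<^esub> \<in> carrier (presented X R)"
    by (auto simp: carrier_presented one_presented)
next
  fix A B C assume "A \<in> carrier (presented X R)" "B \<in> carrier (presented X R)"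
    "C \<in> carrier (presented X R)"
  then obtain a b c where "a \<in> lists X" "b \<in> lists X" "c \<in> lists X" "A = word_class X R a"
    "B = word_class X R b" "C = word_class X R c" by (auto simp: carrier_presented)
  then show "A \<otimes>\<^bsub>presented X R\<^esub> B \<otimes>\<^bsub>presented X R\<^esub> C =
      A \<otimes>\<^bsub>presented X R\<^esub> (B \<otimes>\<^bsub>presented X R\<^esub> C)"
    by (simp add: presented_mult)
next
  fix A assume "A \<in> carrier (presented X R)"
  then obtain a where "a \<in> lists X" "A = word_class X R a" by (auto simp: carrier_presented)
  then show "\<one>\<^bsub>presented X R\<^esub> \<otimes>\<^bsub>presented X R\<^esub> A = A"
    by (simp add: one_presented presented_mult)
next
  fix A assume "A \<in> carrier (presented X R)"
  then obtain a where a: "a \<in> lists X" "A = word_class X R a" by (auto simp: carrier_presented)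
  have "\<exists>b\<in>lists X. word_cong X R (b @ a) []"
    using a(1)
  proof (induction a)
    case Nil
    then show ?case by (auto intro!: bexI[of _ "[]"] wc_refl)
  next
    case (Cons x a)
    then obtain b where b: "b \<in> lists X" "word_cong X R (b @ a) []" by auto
    obtain y where y: "y \<in> X" "word_cong X R [y, x] []" using assms Cons by blast
    have "word_cong X R (b @ [y, x] @ a) (b @ [] @ a)"
      using y b Cons by (intro word_cong_ctx) auto
    then have "word_cong X R ((b @ [y]) @ x # a) []" using b wc_trans by fastforce
    then show ?case using b y by (intro bexI[of _ "b @ [y]"]) auto
  qed
  then obtain b where b: "b \<in> lists X" "word_cong X R (b @ a) []" by auto
  then have "word_class X R b \<otimes>\<^bsub>presented X R\<^esub> A = \<one>\<^bsub>presented X R\<^esub>"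
    using a word_class_eq_iff[of "b @ a" X R "[]"] by (simp add: presented_mult one_presented)
  then show "\<exists>B\<in>carrier (presented X R). B \<otimes>\<^bsub>presented X R\<^esub> A = \<one>\<^bsub>presented X R\<^esub>"
    using b by (auto simp: carrier_presented)
qed

text \<open>
  The colimit of the groups \<open>H j\<close>, \<open>j \<in> J\<close>, along the homomorphisms \<open>f : H j \<rightarrow> H k\<close> with
  \<open>(j, k, f) \<in> A\<close>: the free product of the \<open>H j\<close> with \<open>h\<close> and \<open>f h\<close> identified.
\<close>

definition colimit_gens :: "'j set \<Rightarrow> ('j \<Rightarrow> 'h monoid) \<Rightarrow> ('j \<times> 'h) set" where
  "colimit_gens J H = (SIGMA j:J. carrier (H j))"

definition colimit_rels ::
  "'j set \<Rightarrow> ('j \<Rightarrow> 'h monoid) \<Rightarrow> ('j \<times> 'j \<times> ('h \<Rightarrow> 'h)) set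
    \<Rightarrow> (('j \<times> 'h) list \<times> ('j \<times> 'h) list) set" where
  "colimit_rels J H A =
     {([(j, \<one>\<^bsub>H j\<^esub>)], []) | j. j \<in> J} \<union>
     {([(j, x), (j, y)], [(j, x \<otimes>\<^bsub>H j\<^esub> y)]) | j x y. j \<in> J \<and> x \<in> carrier (H j) \<and> y \<in> carrier (H j)} \<union>
     {([(j, x)], [(k, f x)]) | j k f x. (j, k, f) \<in> A \<and> x \<in> carrier (H j)}"

definition group_colimit ::
  "'j set \<Rightarrow> ('j \<Rightarrow> 'h monoid) \<Rightarrow> ('j \<times> 'j \<times> ('h \<Rightarrow> 'h)) set \<Rightarrow> ('j \<times> 'h) list set monoid" where
  "group_colimit J H A = presented (colimit_gens J H) (colimit_rels J H A)"

definition colimit_in ::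
  "'j set \<Rightarrow> ('j \<Rightarrow> 'h monoid) \<Rightarrow> ('j \<times> 'j \<times> ('h \<Rightarrow> 'h)) set \<Rightarrow> 'j \<Rightarrow> 'h \<Rightarrow> ('j \<times> 'h) list set" where
  "colimit_in J H A j h = word_class (colimit_gens J H) (colimit_rels J H A) [(j, h)]"

lemma colimit_rel_cong:
  "(u, v) \<in> colimit_rels J H A \<Longrightarrow> u \<in> lists (colimit_gens J H) \<Longrightarrow> v \<in> lists (colimit_gens J H)
    \<Longrightarrow> word_cong (colimit_gens J H) (colimit_rels J H A) u v"
  using wc_rel[of u v _ _ "[]" "[]"] by simp

lemma group_group_colimit:
  assumes "\<And>j. j \<in> J \<Longrightarrow> group (H j)"
  shows "group (group_colimit J H A)"
  unfolding group_colimit_def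
proof (rule group_presented)
  fix x assume "x \<in> colimit_gens J H"
  then obtain j h where x: "x = (j, h)" and j: "j \<in> J" and h: "h \<in> carrier (H j)"
    by (auto simp: colimit_gens_def)
  interpret group "H j" using assms j .
  let ?R = "word_cong (colimit_gens J H) (colimit_rels J H A)"
  have "?R [(j, inv\<^bsub>H j\<^esub> h), (j, h)] [(j, inv\<^bsub>H j\<^esub> h \<otimes>\<^bsub>H j\<^esub> h)]"
    using j h by (intro colimit_rel_cong) (auto simp: colimit_rels_def colimit_gens_def)
  moreover have "?R [(j, \<one>\<^bsub>H j\<^esub>)] []"
    using j by (intro colimit_rel_cong) (auto simp: colimit_rels_def colimit_gens_def)
  ultimately have "?R [(j, inv\<^bsub>H j\<^esub> h), (j, h)] []"
    using h wc_trans by fastforce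
  then show "\<exists>y\<in>colimit_gens J H. ?R [y, x] []"
    using j h x by (intro bexI[of _ "(j, inv\<^bsub>H j\<^esub> h)"]) (auto simp: colimit_gens_def)
qed

lemma colimit_in_hom:
  assumes "j \<in> J" "group (H j)"
  shows "colimit_in J H A j \<in> hom (H j) (group_colimit J H A)"
proof -
  interpret group "H j" by fact
  let ?X = "colimit_gens J H" and ?R = "colimit_rels J H A"
  have "word_class ?X ?R [(j, x \<otimes>\<^bsub>H j\<^esub> y)] = word_class ?X ?R ([(j, x)] @ [(j, y)])"
    if "x \<in> carrier (H j)" "y \<in> carrier (H j)" for x y
  proof -
    have "word_cong ?X ?R [(j, x), (j, y)] [(j, x \<otimes>\<^bsub>H j\<^esub> y)]"
      using that assms by (intro colimit_rel_cong) (auto simp: colimit_rels_def colimit_gens_def)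
    then show ?thesis
      using that assms word_class_eq_iff[of "[(j, x), (j, y)]" ?X ?R]
      by (auto simp: colimit_gens_def)
  qed
  then show ?thesis
    using assms
    by (auto simp: hom_def colimit_in_def group_colimit_def carrier_presented presented_mult colimit_gens_def)
qed

lemma colimit_in_compatible:
  assumes "(j, k, f) \<in> A" "j \<in> J" "k \<in> J" "x \<in> carrier (H j)" "f x \<in> carrier (H k)"
  shows "colimit_in J H A k (f x) = colimit_in J H A j x"
proof -
  have "word_cong (colimit_gens J H) (colimit_rels J H A) [(j, x)] [(k, f x)]"
    using assms by (intro colimit_rel_cong) (auto simp: colimit_rels_def colimit_gens_def)
  moreover have "[(j, x)] \<in> lists (colimit_gens J H)"
    using assms by (simp add: colimit_gens_def)
  ultimately have "word_class (colimit_gens J H) (colimit_rels J H A) [(j, x)] =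
      word_class (colimit_gens J H) (colimit_rels J H A) [(k, f x)]"
    by (simp only: word_class_eq_iff)
  then show ?thesis by (simp only: colimit_in_def)
qed

lemma group_colimit_universal:
  assumes H: "\<And>j. j \<in> J \<Longrightarrow> group (H j)"
    and A: "\<And>j k f. (j, k, f) \<in> A \<Longrightarrow> j \<in> J \<and> k \<in> J \<and> f \<in> hom (H j) (H k)"
    and L: "group L"
    and \<psi>: "\<And>j. j \<in> J \<Longrightarrow> \<psi> j \<in> hom (H j) L"
    and compat: "\<And>j k f x. (j, k, f) \<in> A \<Longrightarrow> x \<in> carrier (H j) \<Longrightarrow> \<psi> k (f x) = \<psi> j x"
  shows "\<exists>!\<Psi>. \<Psi> \<in> hom (group_colimit J H A) L \<inter> extensional (carrier (group_colimit J H A)) \<and>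
           (\<forall>j\<in>J. \<forall>x\<in>carrier (H j). \<Psi> (colimit_in J H A j x) = \<psi> j x)"
proof -
  interpret L: group L by fact
  let ?X = "colimit_gens J H" and ?R = "colimit_rels J H A" and ?K = "group_colimit J H A"
  define ev where "ev w = foldr (\<lambda>(j, x) l. \<psi> j x \<otimes>\<^bsub>L\<^esub> l) w \<one>\<^bsub>L\<^esub>" for w
  have gen: "\<psi> j x \<in> carrier L" if "(j, x) \<in> ?X" for j x
    using that \<psi> by (auto simp: colimit_gens_def hom_def)
  have ev_closed: "ev w \<in> carrier L" if "w \<in> lists ?X" for w
    using that by (induction w) (auto simp: ev_def gen)
  have ev_Cons: "ev ((j, x) # w) = \<psi> j x \<otimes>\<^bsub>L\<^esub> ev w" and ev_Nil: "ev [] = \<one>\<^bsub>L\<^esub>" for j x w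
    by (auto simp: ev_def)
  have ev_app: "ev (u @ v) = ev u \<otimes>\<^bsub>L\<^esub> ev v" if "u \<in> lists ?X" "v \<in> lists ?X" for u v
    using that
  proof (induction u)
    case (Cons a u)
    then show ?case by (cases a) (auto simp: ev_Cons L.m_assoc gen ev_closed)
  qed (auto simp: ev_Nil ev_closed)
  have ev_rel: "ev u = ev v" if "(u, v) \<in> ?R" for u v
  proof -
    have "\<psi> j \<one>\<^bsub>H j\<^esub> = \<one>\<^bsub>L\<^esub>" if "j \<in> J" for j
      using that H L \<psi> by (meson group_hom.hom_one group_hom.intro group_hom_axioms.intro)
    moreover have "\<psi> j x \<in> carrier L" if "j \<in> J" "x \<in> carrier (H j)" for j x
      using that \<psi> by (auto simp: hom_def)
    moreover have "\<psi> j (x \<otimes>\<^bsub>H j\<^esub> y) = \<psi> j x \<otimes>\<^bsub>L\<^esub> \<psi> j y"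
      if "j \<in> J" "x \<in> carrier (H j)" "y \<in> carrier (H j)" for j x y
      using that \<psi> by (auto simp: hom_def)
    ultimately show ?thesis
      using that compat A by (auto simp: colimit_rels_def ev_Cons ev_Nil L.m_assoc[symmetric])
  qed
  have ev_cong: "ev u = ev v" if "word_cong ?X ?R u v" for u v
    using that
  proof (induction rule: word_cong.induct)
    case (wc_rel u v a b)
    then show ?case by (simp add: ev_app ev_rel)
  qed auto
  define \<Psi> where "\<Psi> = (\<lambda>B\<in>carrier ?K. ev (SOME w. w \<in> B))"
  have \<Psi>: "\<Psi> (word_class ?X ?R w) = ev w" if "w \<in> lists ?X" for w
  proof -
    have "w \<in> word_class ?X ?R w" using that by (simp add: word_class_def wc_refl)
    then have "(SOME v. v \<in> word_class ?X ?R w) \<in> word_class ?X ?R w" by (rule someI)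
    then have "ev w = ev (SOME v. v \<in> word_class ?X ?R w)"
      by (intro ev_cong) (simp add: word_class_def)
    then show ?thesis using that by (simp add: \<Psi>_def group_colimit_def carrier_presented)
  qed
  have hom: "\<Psi> \<in> hom ?K L"
  proof (rule homI)
    fix B assume "B \<in> carrier ?K"
    then obtain b where b: "b \<in> lists ?X" "B = word_class ?X ?R b"
      unfolding group_colimit_def carrier_presented by blast
    then show "\<Psi> B \<in> carrier L" by (simp only: \<Psi> ev_closed)
    fix D assume "D \<in> carrier ?K"
    then obtain d where "d \<in> lists ?X" "D = word_class ?X ?R d"
      unfolding group_colimit_def carrier_presented by blast
    with b show "\<Psi> (B \<otimes>\<^bsub>?K\<^esub> D) = \<Psi> B \<otimes>\<^bsub>L\<^esub> \<Psi> D"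
      by (simp only: group_colimit_def presented_mult \<Psi> append_in_lists_conv ev_app)
  qed
  have val: "\<Psi> (colimit_in J H A j x) = \<psi> j x" if "j \<in> J" "x \<in> carrier (H j)" for j x
  proof -
    have "(j, x) \<in> ?X" using that by (simp add: colimit_gens_def)
    then show ?thesis by (simp add: colimit_in_def \<Psi> ev_Cons ev_Nil gen)
  qed
  show ?thesis
  proof (rule ex1I[of _ \<Psi>])
    show "\<Psi> \<in> hom ?K L \<inter> extensional (carrier ?K) \<and>
        (\<forall>j\<in>J. \<forall>x\<in>carrier (H j). \<Psi> (colimit_in J H A j x) = \<psi> j x)"
      using hom val by (auto simp: \<Psi>_def)
  next
    fix \<Phi> assume *: "\<Phi> \<in> hom ?K L \<inter> extensional (carrier ?K) \<and>
        (\<forall>j\<in>J. \<forall>x\<in>carrier (H j). \<Phi> (colimit_in J H A j x) = \<psi> j x)"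
    interpret h: group_hom ?K L \<Phi>
      using * L group_group_colimit[OF H] by (auto simp: group_hom_def group_hom_axioms_def)
    have "\<Phi> (word_class ?X ?R w) = ev w" if "w \<in> lists ?X" for w
      using that
    proof (induction w)
      case Nil
      then show ?case using h.hom_one by (simp add: group_colimit_def one_presented ev_Nil)
    next
      case (Cons a w)
      obtain j x where a: "a = (j, x)" by (cases a)
      have c: "word_class ?X ?R [a] \<in> carrier ?K" "word_class ?X ?R w \<in> carrier ?K"
        using Cons by (auto simp: group_colimit_def carrier_presented)
      have "word_class ?X ?R (a # w) = word_class ?X ?R [a] \<otimes>\<^bsub>?K\<^esub> word_class ?X ?R w"
        using Cons presented_mult[of "[a]" ?X w ?R] by (auto simp: group_colimit_def)
      then have "\<Phi> (word_class ?X ?R (a # w)) = \<Phi> (word_class ?X ?R [a]) \<otimes>\<^bsub>L\<^esub> ev w"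
        using Cons c by simp
      moreover have "\<Phi> (word_class ?X ?R [a]) = \<psi> j x"
        using * Cons a by (auto simp: colimit_in_def colimit_gens_def)
      ultimately show ?case by (simp add: a ev_Cons)
    qed
    then have "\<Phi> B = \<Psi> B" if "B \<in> carrier ?K" for B
      using that \<Psi> unfolding group_colimit_def carrier_presented by fastforce
    moreover have "\<Psi> \<in> extensional (carrier ?K)" by (simp add: \<Psi>_def)
    ultimately show "\<Phi> = \<Psi>" using * by (intro extensionalityI[of _ "carrier ?K"]) auto
  qed
qed

section \<open>Right-angled Coxeter groups and the Davis chamber\<close>

text \<open>A graph is given by its vertex set \<open>I\<close> and its set \<open>Ed\<close> of edges \<open>{i, j}\<close>.\<close>

definition simplicial_graph :: "'i set \<Rightarrow> 'i set set \<Rightarrow> bool" where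
  "simplicial_graph I Ed \<longleftrightarrow> (\<forall>e\<in>Ed. e \<subseteq> I \<and> card e = 2)"

definition racg_rels :: "'i set \<Rightarrow> 'i set set \<Rightarrow> ('i list \<times> 'i list) set" where
  "racg_rels I Ed = {([i, i], []) | i. i \<in> I} \<union> {([i, j, i, j], []) | i j. {i, j} \<in> Ed}"

definition racg :: "'i set \<Rightarrow> 'i set set \<Rightarrow> 'i list set monoid" where
  "racg I Ed = presented I (racg_rels I Ed)"

lemma group_racg: "group (racg I Ed)"
  unfolding racg_def
proof (rule group_presented)
  fix i assume "i \<in> I"
  then show "\<exists>j\<in>I. word_cong I (racg_rels I Ed) [j, i] []"
    using wc_rel[of "[i, i]" "[]" "racg_rels I Ed" I "[]" "[]"]
    by (intro bexI[of _ i]) (auto simp: racg_rels_def)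
qed

definition spherical_subsets :: "'i set \<Rightarrow> 'i set set \<Rightarrow> 'i set set" where
  "spherical_subsets I Ed =
     {T. T \<subseteq> I \<and> finite (generate (racg I Ed) ((\<lambda>i. word_class I (racg_rels I Ed) [i]) ` T))}"

text \<open>
  Geometric realization of a finite poset \<open>P\<close> of sets ordered by inclusion: barycentric
  coordinates supported on a chain of \<open>P\<close>. Functions are \<open>0\<close> (not \<open>undefined\<close>) outside \<open>P\<close>, so
  that the realization of a subposet is a subset of the realization of \<open>P\<close>. For finite
  \<open>P\<close> the product topology used below is the usual topology of the simplicial complex.
\<close>

definition realization :: "'a set set \<Rightarrow> ('a set \<Rightarrow> real) set" where
  "realization P =
     {x. (\<forall>S. 0 \<le> x S) \<and> (\<forall>S. S \<notin> P \<longrightarrow> x S = 0) \<and> (\<Sum>S\<in>P. x S) = 1 \<and>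
         (\<forall>S T. x S \<noteq> 0 \<and> x T \<noteq> 0 \<longrightarrow> S \<subseteq> T \<or> T \<subseteq> S)}"

definition davis_chamber :: "'i set \<Rightarrow> 'i set set \<Rightarrow> ('i set \<Rightarrow> real) set" where
  "davis_chamber I Ed = realization (spherical_subsets I Ed)"

definition mirror :: "'i set \<Rightarrow> 'i set set \<Rightarrow> 'i \<Rightarrow> ('i set \<Rightarrow> real) set" where
  "mirror I Ed i = realization {T \<in> spherical_subsets I Ed. i \<in> T}"

section \<open>The product building and its realization\<close>

definition rank_one_building :: "'c set \<Rightarrow> bool" where
  "rank_one_building X \<longleftrightarrow> (\<exists>C\<in>X. \<exists>D\<in>X. C \<noteq> D)"

definition rank_one_dist :: "'c \<Rightarrow> 'c \<Rightarrow> int" where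
  "rank_one_dist C D = (if C = D then \<one>\<^bsub>integer_mod_group 2\<^esub> else 1)"

definition product_building :: "'i set \<Rightarrow> ('i \<Rightarrow> 'c set) \<Rightarrow> ('i \<Rightarrow> 'c) set" where
  "product_building I E = (\<Pi>\<^sub>E i\<in>I. E i)"

definition prod_Z2 :: "'i set \<Rightarrow> ('i \<Rightarrow> int) monoid" where
  "prod_Z2 I = product_group I (\<lambda>i. integer_mod_group 2)"

definition prod_Z2_gen :: "'i set \<Rightarrow> 'i \<Rightarrow> 'i \<Rightarrow> int" where
  "prod_Z2_gen I i = (\<lambda>j\<in>I. if j = i then 1 else \<one>\<^bsub>integer_mod_group 2\<^esub>)"

definition chamber_dist :: "'i set \<Rightarrow> ('i \<Rightarrow> 'c) \<Rightarrow> ('i \<Rightarrow> 'c) \<Rightarrow> 'i \<Rightarrow> int" where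
  "chamber_dist I C D = (\<lambda>i\<in>I. rank_one_dist (C i) (D i))"

definition glue_rel ::
  "'i set \<Rightarrow> 'i set set \<Rightarrow> ('i \<Rightarrow> 'c set)
    \<Rightarrow> ((('i \<Rightarrow> 'c) \<times> ('i set \<Rightarrow> real)) \<times> (('i \<Rightarrow> 'c) \<times> ('i set \<Rightarrow> real))) set" where
  "glue_rel I Ed E =
     {((C, x), (D, y)). C \<in> product_building I E \<and> D \<in> product_building I E \<and>
        x \<in> davis_chamber I Ed \<and> y \<in> davis_chamber I Ed \<and> x = y \<and>
        chamber_dist I C D \<in> generate (prod_Z2 I) (prod_Z2_gen I ` {i\<in>I. x \<in> mirror I Ed i})}"

definition U_point ::
  "'i set \<Rightarrow> 'i set set \<Rightarrow> ('i \<Rightarrow> 'c set) \<Rightarrow> ('i \<Rightarrow> 'c) \<Rightarrow> ('i set \<Rightarrow> real)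
    \<Rightarrow> (('i \<Rightarrow> 'c) \<times> ('i set \<Rightarrow> real)) set" where
  "U_point I Ed E C x = glue_rel I Ed E `` {(C, x)}"

definition quotient_topology :: "'a topology \<Rightarrow> ('a \<Rightarrow> 'b) \<Rightarrow> 'b topology" where
  "quotient_topology X f =
     topology (\<lambda>U. U \<subseteq> f ` topspace X \<and> openin X {x \<in> topspace X. f x \<in> U})"

lemma quotient_map_quotient_topology: "quotient_map X (quotient_topology X f) f"
proof -
  let ?P = "\<lambda>U. U \<subseteq> f ` topspace X \<and> openin X {x \<in> topspace X. f x \<in> U}"
  have "istopology ?P"
    unfolding istopology_def
  proof (rule conjI; intro allI impI)
    fix S T assume "?P S" "?P T"
    moreover have "{x \<in> topspace X. f x \<in> S \<inter> T} =
        {x \<in> topspace X. f x \<in> S} \<inter> {x \<in> topspace X. f x \<in> T}" by auto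
    ultimately show "?P (S \<inter> T)" by auto
  next
    fix \<K> assume "\<forall>K\<in>\<K>. ?P K"
    moreover have "{x \<in> topspace X. f x \<in> \<Union>\<K>} = (\<Union>K\<in>\<K>. {x \<in> topspace X. f x \<in> K})" by auto
    ultimately show "?P (\<Union>\<K>)" by (auto intro!: openin_Union)
  qed
  then have op: "openin (quotient_topology X f) = ?P"
    by (simp add: quotient_topology_def)
  have "{x \<in> topspace X. f x \<in> f ` topspace X} = topspace X" by auto
  then have "openin (quotient_topology X f) (f ` topspace X)" by (simp add: op)
  then have "topspace (quotient_topology X f) = f ` topspace X"
    unfolding topspace_def[of "quotient_topology X f"] by (auto simp: op)
  then show ?thesis by (auto simp: quotient_map_def op)
qed

text \<open>The points of \<open>U_space I Ed E\<close> are the equivalence classes of \<open>glue_rel I Ed E\<close>.\<close>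

definition U_space ::
  "'i set \<Rightarrow> 'i set set \<Rightarrow> ('i \<Rightarrow> 'c set) \<Rightarrow> (('i \<Rightarrow> 'c) \<times> ('i set \<Rightarrow> real)) set topology" where
  "U_space I Ed E =
     quotient_topology
       (prod_topology (discrete_topology (product_building I E)) (top_of_set (davis_chamber I Ed)))
       (\<lambda>(C, x). U_point I Ed E C x)"

section \<open>Universal covers\<close>

definition covering_map :: "'a topology \<Rightarrow> 'b topology \<Rightarrow> ('a \<Rightarrow> 'b) \<Rightarrow> bool" where
  "covering_map X Y q \<longleftrightarrow>
     continuous_map X Y q \<and> q ` topspace X = topspace Y \<and>
     (\<forall>y\<in>topspace Y. \<exists>V. openin Y V \<and> y \<in> V \<and>
        (\<exists>\<V>. \<Union>\<V> = {x \<in> topspace X. q x \<in> V} \<and> (\<forall>U\<in>\<V>. openin X U) \<and> pairwise disjnt \<V> \<and>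
              (\<forall>U\<in>\<V>. homeomorphic_map (subtopology X U) (subtopology Y V) q)))"

definition simply_connected_space :: "'a topology \<Rightarrow> bool" where
  "simply_connected_space X \<longleftrightarrow>
     path_connected_space X \<and>
     (\<forall>g. pathin X g \<and> g 1 = g 0 \<longrightarrow>
        homotopic_with (\<lambda>h. h 0 = g 0 \<and> h 1 = g 0) (top_of_set {0..1}) X g (\<lambda>t. g 0))"

definition universal_cover :: "'a topology \<Rightarrow> 'b topology \<Rightarrow> ('a \<Rightarrow> 'b) \<Rightarrow> bool" where
  "universal_cover X Y q \<longleftrightarrow> covering_map X Y q \<and> simply_connected_space X"

section \<open>The graph product of rank-one buildings\<close>

text \<open>
  In this section \<open>q\<close> is a universal covering map from \<open>X\<close> to \<open>U_space I Ed E\<close>.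
  \<open>chamber_lift I Ed E X q C f\<close>: \<open>f\<close> lifts the inclusion of the copy of the Davis chamber
  in \<open>U_space I Ed E\<close> indexed by \<open>C\<close>. The copies of the Davis chamber in \<open>X\<close>
  are the images of these lifts.
\<close>

definition chamber_lift ::
  "'i set \<Rightarrow> 'i set set \<Rightarrow> ('i \<Rightarrow> 'c set) \<Rightarrow> 'x topology \<Rightarrow> ('x \<Rightarrow> (('i \<Rightarrow> 'c) \<times> ('i set \<Rightarrow> real)) set)
    \<Rightarrow> ('i \<Rightarrow> 'c) \<Rightarrow> (('i set \<Rightarrow> real) \<Rightarrow> 'x) \<Rightarrow> bool" where
  "chamber_lift I Ed E X q C f \<longleftrightarrow>
     C \<in> product_building I E \<and>
     continuous_map (top_of_set (davis_chamber I Ed)) X f \<and>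
     (\<forall>x\<in>davis_chamber I Ed. q (f x) = U_point I Ed E C x)"

definition graph_product_building ::
  "'i set \<Rightarrow> 'i set set \<Rightarrow> ('i \<Rightarrow> 'c set) \<Rightarrow> 'x topology \<Rightarrow> ('x \<Rightarrow> (('i \<Rightarrow> 'c) \<times> ('i set \<Rightarrow> real)) set)
    \<Rightarrow> 'x set set" where
  "graph_product_building I Ed E X q =
     {f ` davis_chamber I Ed | f C. chamber_lift I Ed E X q C f}"

definition adjacent ::
  "'i set \<Rightarrow> 'i set set \<Rightarrow> ('i \<Rightarrow> 'c set) \<Rightarrow> 'x topology \<Rightarrow> ('x \<Rightarrow> (('i \<Rightarrow> 'c) \<times> ('i set \<Rightarrow> real)) set)
    \<Rightarrow> 'i \<Rightarrow> 'x set \<Rightarrow> 'x set \<Rightarrow> bool" where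
  "adjacent I Ed E X q i K L \<longleftrightarrow>
     K \<noteq> L \<and>
     (\<exists>f g C D. chamber_lift I Ed E X q C f \<and> chamber_lift I Ed E X q D g \<and>
        K = f ` davis_chamber I Ed \<and> L = g ` davis_chamber I Ed \<and>
        f ` mirror I Ed i = g ` mirror I Ed i)"

text \<open>The map \<open>p\<close> on chambers that is induced by the covering map.\<close>

definition building_proj ::
  "'i set \<Rightarrow> 'i set set \<Rightarrow> ('i \<Rightarrow> 'c set) \<Rightarrow> 'x topology \<Rightarrow> ('x \<Rightarrow> (('i \<Rightarrow> 'c) \<times> ('i set \<Rightarrow> real)) set)
    \<Rightarrow> 'x set \<Rightarrow> 'i \<Rightarrow> 'c" where
  "building_proj I Ed E X q K =
     (THE C. C \<in> product_building I E \<and> q ` K = U_point I Ed E C ` davis_chamber I Ed)"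

definition building_aut ::
  "'i set \<Rightarrow> 'i set set \<Rightarrow> ('i \<Rightarrow> 'c set) \<Rightarrow> 'x topology \<Rightarrow> ('x \<Rightarrow> (('i \<Rightarrow> 'c) \<times> ('i set \<Rightarrow> real)) set)
    \<Rightarrow> ('x set \<Rightarrow> 'x set) set" where
  "building_aut I Ed E X q =
     {a \<in> Bij (graph_product_building I Ed E X q).
        \<forall>i\<in>I. \<forall>K\<in>graph_product_building I Ed E X q. \<forall>L\<in>graph_product_building I Ed E X q.
          adjacent I Ed E X q i (a K) (a L) \<longleftrightarrow> adjacent I Ed E X q i K L}"

definition product_action ::
  "'i set \<Rightarrow> ('i \<Rightarrow> 'g \<Rightarrow> 'c \<Rightarrow> 'c) \<Rightarrow> ('i \<Rightarrow> 'g) \<Rightarrow> ('i \<Rightarrow> 'c) \<Rightarrow> 'i \<Rightarrow> 'c" where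
  "product_action I \<phi> g C = (\<lambda>i\<in>I. \<phi> i (g i) (C i))"

definition lift_group ::
  "'i set \<Rightarrow> 'i set set \<Rightarrow> ('i \<Rightarrow> 'c set) \<Rightarrow> ('i \<Rightarrow> 'g monoid) \<Rightarrow> ('i \<Rightarrow> 'g \<Rightarrow> 'c \<Rightarrow> 'c)
    \<Rightarrow> 'x topology \<Rightarrow> ('x \<Rightarrow> (('i \<Rightarrow> 'c) \<times> ('i set \<Rightarrow> real)) set) \<Rightarrow> ('x set \<Rightarrow> 'x set) monoid" where
  "lift_group I Ed E G \<phi> X q =
     (BijGroup (graph_product_building I Ed E X q))
       \<lparr>carrier := {a \<in> building_aut I Ed E X q.
          \<exists>g \<in> carrier (product_group I G). \<forall>K\<in>graph_product_building I Ed E X q.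
            building_proj I Ed E X q (a K) = product_action I \<phi> g (building_proj I Ed E X q K)}\<rparr>"

section \<open>The generalized graph product\<close>

text \<open>
  \<open>partial_product I G \<phi> C T\<close> is the product of the \<open>G i\<close>, \<open>i \<in> T\<close>, and of the stabilizers
  of \<open>C k\<close> in \<open>G k\<close>, \<open>k \<in> I - T\<close>. It is \<open>B\<close> for \<open>T = {}\<close>, \<open>H\<^sub>i\<close> for \<open>T = {i}\<close> and \<open>H\<^sub>i\<^sub>,\<^sub>j\<close> for
  \<open>T = {i, j}\<close>; these three kinds of sets index the diagram.
\<close>

definition partial_product ::
  "'i set \<Rightarrow> ('i \<Rightarrow> 'g monoid) \<Rightarrow> ('i \<Rightarrow> 'g \<Rightarrow> 'c \<Rightarrow> 'c) \<Rightarrow> ('i \<Rightarrow> 'c) \<Rightarrow> 'i set \<Rightarrow> ('i \<Rightarrow> 'g) monoid" where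
  "partial_product I G \<phi> C T =
     product_group I
       (\<lambda>k. if k \<in> T then G k else (G k)\<lparr>carrier := stabilizer (G k) (\<phi> k) (C k)\<rparr>)"

definition ggp_index :: "'i set \<Rightarrow> 'i set set \<Rightarrow> 'i set set" where
  "ggp_index I Ed = {{}} \<union> {{i} | i. i \<in> I} \<union> Ed"

definition ggp_arrows :: "'i set \<Rightarrow> 'i set set \<Rightarrow> ('i set \<times> 'i set \<times> (('i \<Rightarrow> 'g) \<Rightarrow> 'i \<Rightarrow> 'g)) set" where
  "ggp_arrows I Ed =
     {({}, {i}, \<lambda>h. h) | i. i \<in> I} \<union> {({i}, e, \<lambda>h. h) | i e. i \<in> e \<and> e \<in> Ed}"

definition gen_graph_product ::
  "'i set \<Rightarrow> 'i set set \<Rightarrow> ('i \<Rightarrow> 'g monoid) \<Rightarrow> ('i \<Rightarrow> 'g \<Rightarrow> 'c \<Rightarrow> 'c) \<Rightarrow> ('i \<Rightarrow> 'c)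
    \<Rightarrow> ('i set \<times> ('i \<Rightarrow> 'g)) list set monoid" where
  "gen_graph_product I Ed G \<phi> C =
     group_colimit (ggp_index I Ed) (partial_product I G \<phi> C) (ggp_arrows I Ed)"

definition action_kernel :: "'g monoid \<Rightarrow> 'c set \<Rightarrow> ('g \<Rightarrow> 'c \<Rightarrow> 'c) \<Rightarrow> 'g set" where
  "action_kernel G X \<phi> = kernel G (BijGroup X) \<phi>"

text \<open>The product of the kernels, as a subgroup of the generalized graph product.\<close>

definition ggp_kernel ::
  "'i set \<Rightarrow> 'i set set \<Rightarrow> ('i \<Rightarrow> 'c set) \<Rightarrow> ('i \<Rightarrow> 'g monoid) \<Rightarrow> ('i \<Rightarrow> 'g \<Rightarrow> 'c \<Rightarrow> 'c) \<Rightarrow> ('i \<Rightarrow> 'c)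
    \<Rightarrow> ('i set \<times> ('i \<Rightarrow> 'g)) list set set" where
  "ggp_kernel I Ed E G \<phi> C =
     colimit_in (ggp_index I Ed) (partial_product I G \<phi> C) (ggp_arrows I Ed) {} `
       (\<Pi>\<^sub>E i\<in>I. action_kernel (G i) (E i) (\<phi> i))"

lemma group_partial_product:
  assumes "\<And>i. i \<in> I \<Longrightarrow> group_action (G i) (E i) (\<phi> i)" "C \<in> product_building I E"
  shows "group (partial_product I G \<phi> C T)"
  unfolding partial_product_def
proof (rule product_group)
  fix k assume k: "k \<in> I"
  interpret group_action "G k" "E k" "\<phi> k" using assms k by simp
  have "C k \<in> E k" using assms k by (auto simp: product_building_def)
  then have "subgroup (stabilizer (G k) (\<phi> k) (C k)) (G k)" by (rule stabilizer_subgroup)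
  then show "group (if k \<in> T then G k else (G k)\<lparr>carrier := stabilizer (G k) (\<phi> k) (C k)\<rparr>)"
    using group_hom by (simp add: group_hom_def subgroup.subgroup_is_group)
qed

lemma carrier_partial_product_mono:
  "S \<subseteq> T \<Longrightarrow> carrier (partial_product I G \<phi> C S) \<subseteq> carrier (partial_product I G \<phi> C T)"
  unfolding partial_product_def carrier_product_group
  by (rule PiE_mono) (auto simp: stabilizer_def)

lemma ggp_kernel_normal:
  assumes graph: "simplicial_graph I Ed"
    and act: "\<And>i. i \<in> I \<Longrightarrow> group_action (G i) (E i) (\<phi> i)"
    and C: "C \<in> product_building I E"
  shows "ggp_kernel I Ed E G \<phi> C \<lhd> gen_graph_product I Ed G \<phi> C"
proof -
  let ?J = "ggp_index I Ed" and ?H = "partial_product I G \<phi> C" and ?A = "ggp_arrows I Ed"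
  let ?K = "gen_graph_product I Ed G \<phi> C"
  let ?c = "colimit_in ?J ?H ?A"
  let ?N = "\<Pi>\<^sub>E i\<in>I. action_kernel (G i) (E i) (\<phi> i)"
  have grH: "group (?H T)" for T using act C by (rule group_partial_product)
  then have grK: "group ?K" unfolding gen_graph_product_def by (intro group_group_colimit)
  interpret K: group ?K by fact
  have grG: "group (G i)" if "i \<in> I" for i
    using act[OF that] by (simp add: group_action_def group_hom_def)
  have nG: "action_kernel (G i) (E i) (\<phi> i) \<lhd> G i" if "i \<in> I" for i
    unfolding action_kernel_def
    using act[OF that] by (simp add: group_action_def group_hom.normal_kernel)
  have stab: "action_kernel (G i) (E i) (\<phi> i) \<subseteq> stabilizer (G i) (\<phi> i) (C i)" if "i \<in> I" for i
    using that C by (auto simp: action_kernel_def kernel_def stabilizer_def BijGroup_def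
        product_building_def PiE_iff)
  have NH: "?N \<subseteq> carrier (?H T)" for T
    using stab by (fastforce simp: partial_product_def PiE_iff action_kernel_def kernel_def)
  have multH: "(\<otimes>\<^bsub>?H T\<^esub>) = (\<lambda>x y. \<lambda>i\<in>I. x i \<otimes>\<^bsub>G i\<^esub> y i)" for T
    by (auto simp: partial_product_def fun_eq_iff)
  have oneH: "\<one>\<^bsub>?H T\<^esub> = (\<lambda>i\<in>I. \<one>\<^bsub>G i\<^esub>)" for T
    by (auto simp: partial_product_def fun_eq_iff)
  have HG: "x i \<in> carrier (G i)" if "x \<in> carrier (?H T)" "i \<in> I" for x i T
    using that by (auto simp: partial_product_def PiE_iff stabilizer_def split: if_splits)
  have invH: "(inv\<^bsub>?H T\<^esub> x) i = inv\<^bsub>G i\<^esub> (x i)" if x: "x \<in> carrier (?H T)" and i: "i \<in> I" for x i T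
  proof -
    interpret H: group "?H T" by (rule grH)
    have "inv\<^bsub>?H T\<^esub> x \<otimes>\<^bsub>?H T\<^esub> x = \<one>\<^bsub>?H T\<^esub>" using x by simp
    then have "(inv\<^bsub>?H T\<^esub> x) i \<otimes>\<^bsub>G i\<^esub> x i = \<one>\<^bsub>G i\<^esub>"
      unfolding multH oneH using i by (metis (no_types, lifting) restrict_apply')
    then show ?thesis
      using group.inv_equality[OF grG[OF i]] HG[OF x i] HG[of "inv\<^bsub>?H T\<^esub> x" T i] x i by simp
  qed
  have sN: "subgroup ?N (?H {})"
  proof (rule group.subgroupI[OF grH])
    show "?N \<noteq> {}"
      using normal_imp_subgroup[OF nG] by (auto simp: PiE_eq_empty_iff dest: subgroup.one_closed)
    fix a assume a: "a \<in> ?N"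
    then have a': "a \<in> carrier (?H {})" using NH by auto
    have "inv\<^bsub>?H {}\<^esub> a \<in> carrier (?H {})" using grH a' by (simp add: group.inv_closed)
    then have "inv\<^bsub>?H {}\<^esub> a \<in> extensional I" by (auto simp: partial_product_def PiE_iff)
    then show "inv\<^bsub>?H {}\<^esub> a \<in> ?N"
      using a normal_imp_subgroup[OF nG]
      by (auto simp: PiE_iff invH[OF a'] subgroup.m_inv_closed)
    fix b assume "b \<in> ?N"
    then show "a \<otimes>\<^bsub>?H {}\<^esub> b \<in> ?N"
      using a normal_imp_subgroup[OF nG] by (auto simp: multH PiE_iff subgroup.m_closed)
  qed (rule NH)
  have cT: "?c T x = ?c {} x" if T: "T \<in> ?J" and x: "x \<in> carrier (?H {})" for T x
  proof -
    have x': "x \<in> carrier (?H S)" for S using x carrier_partial_product_mono[of "{}" S] by blast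
    have one: "?c {i} x = ?c {} x" if "i \<in> I" for i
      using that x' colimit_in_compatible[of "{}" "{i}" "\<lambda>h. h" ?A ?J x ?H]
      by (auto simp: ggp_arrows_def ggp_index_def)
    consider "T = {}" | i where "i \<in> I" "T = {i}" | "T \<in> Ed" using T by (auto simp: ggp_index_def)
    then show ?thesis
    proof cases
      case 3
      then have "T \<subseteq> I" "T \<noteq> {}" using graph by (auto simp: simplicial_graph_def)
      then obtain i where i: "i \<in> T" "i \<in> I" by auto
      then have "?c T x = ?c {i} x"
        using 3 x' colimit_in_compatible[of "{i}" T "\<lambda>h. h" ?A ?J x ?H]
        by (auto simp: ggp_arrows_def ggp_index_def)
      then show ?thesis using one i by simp
    qed (use one in auto)
  qed
  have hc: "?c T \<in> hom (?H T) ?K" if "T \<in> ?J" for T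
    unfolding gen_graph_product_def using that grH by (rule colimit_in_hom)
  have e: "{} \<in> ?J" by (simp add: ggp_index_def)
  interpret h0: group_hom "?H {}" ?K "?c {}"
    using hc[OF e] grH grK by (simp add: group_hom_def group_hom_axioms_def)
  have sK: "subgroup (?c {} ` ?N) ?K" by (rule h0.subgroup_img_is_subgroup[OF sN])
  have letter: "?c T x \<otimes>\<^bsub>?K\<^esub> n \<otimes>\<^bsub>?K\<^esub> inv\<^bsub>?K\<^esub> (?c T x) \<in> ?c {} ` ?N"
    if T: "T \<in> ?J" and x: "x \<in> carrier (?H T)" and n: "n \<in> ?c {} ` ?N" for T x n
  proof -
    obtain m where m: "m \<in> ?N" "n = ?c {} m" using n by auto
    interpret h: group_hom "?H T" ?K "?c T"
      using hc[OF T] grH grK by (simp add: group_hom_def group_hom_axioms_def)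
    have mT: "m \<in> carrier (?H T)" "m \<in> carrier (?H {})" using m NH by blast+
    let ?m = "x \<otimes>\<^bsub>?H T\<^esub> m \<otimes>\<^bsub>?H T\<^esub> inv\<^bsub>?H T\<^esub> x"
    have "?m i \<in> action_kernel (G i) (E i) (\<phi> i)" if "i \<in> I" for i
      using that m normal.inv_op_closed2[OF nG[OF that] HG[OF x that]]
      by (auto simp: multH invH[OF x that] PiE_iff)
    moreover have "?m \<in> extensional I" by (simp add: multH)
    ultimately have mN: "?m \<in> ?N" by (auto simp: PiE_iff)
    then have "?c T ?m = ?c {} ?m" using cT T NH by blast
    moreover have "?c T ?m = ?c T x \<otimes>\<^bsub>?K\<^esub> n \<otimes>\<^bsub>?K\<^esub> inv\<^bsub>?K\<^esub> (?c T x)"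
      using x mT m cT[OF T mT(2)] by simp
    ultimately show ?thesis using mN by auto
  qed
  let ?X = "colimit_gens ?J ?H" and ?R = "colimit_rels ?J ?H ?A"
  have word: "\<forall>n\<in>?c {} ` ?N. word_class ?X ?R w \<otimes>\<^bsub>?K\<^esub> n \<otimes>\<^bsub>?K\<^esub> inv\<^bsub>?K\<^esub> (word_class ?X ?R w) \<in> ?c {} ` ?N"
    if "w \<in> lists ?X" for w
    using that
  proof (induction w)
    case Nil
    have "word_class ?X ?R [] = \<one>\<^bsub>?K\<^esub>"
      by (simp add: gen_graph_product_def group_colimit_def one_presented)
    show ?case
    proof
      fix n assume n: "n \<in> ?c {} ` ?N"
      then have "n \<in> carrier ?K" using subgroup.subset[OF sK] by blast
      then show "word_class ?X ?R [] \<otimes>\<^bsub>?K\<^esub> n \<otimes>\<^bsub>?K\<^esub> inv\<^bsub>?K\<^esub> (word_class ?X ?R []) \<in> ?c {} ` ?N"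
        using n by (simp only: \<open>word_class ?X ?R [] = \<one>\<^bsub>?K\<^esub>\<close> K.l_one K.r_one K.inv_one)
    qed
  next
    case (Cons a w)
    obtain T x where a: "a = (T, x)" by (cases a)
    let ?a = "?c T x" and ?w = "word_class ?X ?R w"
    have Tx: "T \<in> ?J" "x \<in> carrier (?H T)" using Cons a by (auto simp: colimit_gens_def)
    have c: "?a \<in> carrier ?K" "?w \<in> carrier ?K"
      using Cons a by (auto simp: colimit_in_def gen_graph_product_def group_colimit_def carrier_presented)
    have eq: "word_class ?X ?R (a # w) = ?a \<otimes>\<^bsub>?K\<^esub> ?w"
      using Cons a presented_mult[of "[a]" ?X w ?R]
      by (auto simp: colimit_in_def gen_graph_product_def group_colimit_def)
    show ?case
    proof
      fix n assume n: "n \<in> ?c {} ` ?N"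
      then have nc: "n \<in> carrier ?K" using subgroup.subset[OF sK] by auto
      have "?w \<otimes>\<^bsub>?K\<^esub> n \<otimes>\<^bsub>?K\<^esub> inv\<^bsub>?K\<^esub> ?w \<in> ?c {} ` ?N" using Cons n by blast
      from letter[OF Tx this]
      show "word_class ?X ?R (a # w) \<otimes>\<^bsub>?K\<^esub> n \<otimes>\<^bsub>?K\<^esub> inv\<^bsub>?K\<^esub> (word_class ?X ?R (a # w)) \<in> ?c {} ` ?N"
        using c nc by (simp add: eq K.inv_mult_group K.m_assoc)
    qed
  qed
  have "carrier ?K = word_class ?X ?R ` lists ?X"
    by (simp add: gen_graph_product_def group_colimit_def carrier_presented)
  then have "\<forall>B\<in>carrier ?K. \<forall>n\<in>?c {} ` ?N. B \<otimes>\<^bsub>?K\<^esub> n \<otimes>\<^bsub>?K\<^esub> inv\<^bsub>?K\<^esub> B \<in> ?c {} ` ?N"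
    using word by (simp only: ball_simps(9)) blast
  then show ?thesis
    using sK by (simp only: ggp_kernel_def K.normal_inv_iff simp_thms)
qed

end

theory Submission
  imports Defs
begin

text \<open>
  The generalized graph product acts on the chambers of the universal cover because that chamber
  system is universal among combinatorial coverings of \<open>E\<close>.

  A combinatorial covering of \<open>E\<close> (\<open>chamber_cover\<close>) is a set of chambers with a projection to \<open>E\<close> in
  which every chamber has, for each \<open>i\<close> and each \<open>c \<in> E i\<close>, a distinguished chamber of its \<open>i\<close>-residue
  over \<open>c\<close>, and in which squares of adjacent types close up. Spherical subsets are cliques, so
  spherical residues map bijectively to residues of \<open>E\<close>. Hence a combinatorial covering, glued from Davis
  chambers, is a covering space of \<open>\<U>(E, K')\<close> (\<open>covering_cover_proj\<close>): open stars of faces are evenly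
  covered. The copies of \<open>K'\<close> in the universal cover \<open>X\<close> form such a covering (\<open>chambers_cover\<close>), as
  \<open>K'\<close> is a cone and therefore lifts through any point. Since \<open>X\<close> is simply connected, paths between
  chambers of \<open>X\<close> lift to any other combinatorial covering with an end that depends only on the
  chamber. So there is a morphism from the chambers of \<open>X\<close> to every combinatorial covering
  (\<open>chambers_universal\<close>); path lifting also shows that galleries connect all chambers
  (\<open>chambers_connected\<close>), which makes morphisms unique.

  The rest is group theory. Applied to twists of the chamber system by elements of \<open>\<Prod> G i\<close>,
  universality gives a unique lift of \<open>g\<close> that sends a chamber \<open>c\<close> to a given chamber over the
  \<open>g\<close>-translate of the projection of \<open>c\<close>. Fix \<open>c0\<close> over \<open>C\<close>. An element \<open>h\<close> of \<open>B\<close>, \<open>H i\<close> or \<open>H i j\<close>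
  has exactly one lift that keeps \<open>c0\<close> in its residue of type \<open>{}\<close>, \<open>{i}\<close> or \<open>{i, j}\<close>. These lifts are compatible homomorphisms, so they
  define \<open>Psi\<close> from the colimit to the group of lifts. It is onto: the images of the \<open>H i\<close> move \<open>c0\<close> to
  all its neighbours, hence everywhere, and the stabilizer of \<open>c0\<close> is the image of \<open>B\<close>. For the kernel,
  transversals of the \<open>B i\<close> in the \<open>G i\<close> make the colimit itself a combinatorial covering
  (\<open>graph_product_cover\<close>). The morphism to it with \<open>c0 \<mapsto> 1\<close> sends \<open>Psi x c0\<close> into the coset \<open>x B\<close>; so an \<open>x\<close>
  acting trivially is the image of some \<open>b\<close> in \<open>B\<close>, and \<open>b\<close> fixes all of \<open>E\<close>, that is, \<open>b\<close> lies in \<open>N\<close>.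
\<close>

section \<open>Lifting along covering maps\<close>

text \<open>
  What lifting uses of an evenly covered set \<open>V\<close>: through every point above \<open>V\<close> passes a continuous
  section over the whole of \<open>V\<close>, which is inverse to \<open>p\<close> on an open set.
\<close>

definition sheeted :: "'z topology \<Rightarrow> 'y topology \<Rightarrow> ('z \<Rightarrow> 'y) \<Rightarrow> 'y set \<Rightarrow> bool" where
  "sheeted Z Y p V \<longleftrightarrow> openin Y V \<and> (\<forall>z\<in>topspace Z. p z \<in> V \<longrightarrow>
     (\<exists>U s. openin Z U \<and> z \<in> U \<and> continuous_map (subtopology Y V) Z s \<and>
        (\<forall>u\<in>U. p u \<in> V \<and> s (p u) = u) \<and> (\<forall>v\<in>V. p (s v) = v)))"

lemma sheetedE:
  assumes "sheeted Z Y p V" "z \<in> topspace Z" "p z \<in> V"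
  obtains U s where "openin Z U" "z \<in> U" "continuous_map (subtopology Y V) Z s"
    "\<And>u. u \<in> U \<Longrightarrow> p u \<in> V \<and> s (p u) = u" "\<And>v. v \<in> V \<Longrightarrow> p (s v) = v"
proof -
  have "\<exists>U s. openin Z U \<and> z \<in> U \<and> continuous_map (subtopology Y V) Z s \<and>
        (\<forall>u\<in>U. p u \<in> V \<and> s (p u) = u) \<and> (\<forall>v\<in>V. p (s v) = v)"
    using assms unfolding sheeted_def by (elim conjE) (drule bspec, assumption, drule mp)
  then show thesis using that by (elim exE conjE) (rule that, auto)
qed

lemma covering_map_sheeted:
  assumes "covering_map Z Y p" "y \<in> topspace Y"
  shows "\<exists>V. y \<in> V \<and> sheeted Z Y p V"
proof -
  obtain V \<V> where V: "openin Y V" "y \<in> V" and U: "\<Union>\<V> = {x \<in> topspace Z. p x \<in> V}"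
      "\<And>U. U \<in> \<V> \<Longrightarrow> openin Z U"
      "\<And>U. U \<in> \<V> \<Longrightarrow> homeomorphic_map (subtopology Z U) (subtopology Y V) p"
    using assms unfolding covering_map_def by meson
  have "sheeted Z Y p V"
    unfolding sheeted_def
  proof (intro conjI ballI impI V(1))
    fix z assume "z \<in> topspace Z" "p z \<in> V"
    then obtain S where S: "S \<in> \<V>" "z \<in> S" using U(1) by blast
    then obtain s where s: "homeomorphic_maps (subtopology Z S) (subtopology Y V) p s"
      using U(3) homeomorphic_map_maps by blast
    have ts: "topspace (subtopology Z S) = S" "topspace (subtopology Y V) = V"
      using openin_subset[OF U(2)[OF S(1)]] openin_subset[OF V(1)] by auto
    have "\<forall>u\<in>S. p u \<in> V" using U(1) S(1) by blast
    moreover have "continuous_map (subtopology Y V) Z s" "\<forall>u\<in>S. s (p u) = u" "\<forall>v\<in>V. p (s v) = v"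
      using s unfolding homeomorphic_maps_def ts by (simp_all add: continuous_map_in_subtopology)
    ultimately show "\<exists>U s. openin Z U \<and> z \<in> U \<and> continuous_map (subtopology Y V) Z s \<and>
        (\<forall>u\<in>U. p u \<in> V \<and> s (p u) = u) \<and> (\<forall>v\<in>V. p (s v) = v)"
      using S(2) U(2)[OF S(1)] by blast
  qed
  then show ?thesis using V(2) by blast
qed

text \<open>Two points of one fibre lie in different sheets, so they have disjoint neighbourhoods.\<close>

lemma covering_map_separate_fibre:
  assumes "covering_map Z Y p" "z \<in> topspace Z" "z' \<in> topspace Z" "p z = p z'" "z \<noteq> z'"
  obtains U U' where "openin Z U" "openin Z U'" "z \<in> U" "z' \<in> U'" "disjnt U U'"
proof -
  have "p z \<in> topspace Y" using assms by (auto simp: covering_map_def)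
  then obtain V \<V> where V: "openin Y V" "p z \<in> V" and U: "\<Union>\<V> = {x \<in> topspace Z. p x \<in> V}"
      "\<And>U. U \<in> \<V> \<Longrightarrow> openin Z U" "pairwise disjnt \<V>"
      "\<And>U. U \<in> \<V> \<Longrightarrow> homeomorphic_map (subtopology Z U) (subtopology Y V) p"
    using assms(1) unfolding covering_map_def by meson
  have "z \<in> \<Union>\<V>" using U(1) V(2) assms(2) by simp
  then obtain S where S: "S \<in> \<V>" "z \<in> S" by blast
  have "z' \<in> \<Union>\<V>" using U(1) V(2) assms(3,4) by simp
  then obtain S' where S': "S' \<in> \<V>" "z' \<in> S'" by blast
  have "inj_on p (topspace (subtopology Z S))"
    using homeomorphic_imp_injective_map[OF U(4)[OF S(1)]] .
  then have "inj_on p S" using openin_subset[OF U(2)[OF S(1)]] by (simp add: Int_absorb1)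
  then have "S \<noteq> S'" using assms(4,5) S S' by (auto dest: inj_onD)
  then have "disjnt S S'" using U(3) S S' by (simp add: pairwise_def)
  then show thesis by (rule that[OF U(2)[OF S(1)] U(2)[OF S'(1)] S(2) S'(2)])
qed

text \<open>
  The lifts agree on an open set, by injectivity of \<open>p\<close> on sheets, and disagree on an open set, by
  separation of fibres.
\<close>

lemma covering_lift_unique:
  assumes cov: "covering_map Z Y p" and T: "connected_space T"
    and f: "continuous_map T Z f" and g: "continuous_map T Z g"
    and fg: "\<And>t. t \<in> topspace T \<Longrightarrow> p (f t) = p (g t)"
    and a: "a \<in> topspace T" "f a = g a" and t: "t \<in> topspace T"
  shows "f t = g t"
proof -
  have fZ: "f t \<in> topspace Z" and gZ: "g t \<in> topspace Z" if "t \<in> topspace T" for t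
    using f g that by (auto simp: continuous_map_def)
  let ?A = "{t \<in> topspace T. f t = g t}" and ?B = "{t \<in> topspace T. f t \<noteq> g t}"
  have pre: "openin T {t \<in> topspace T. f t \<in> U \<and> g t \<in> U'}" if "openin Z U" "openin Z U'" for U U'
  proof -
    have "{t \<in> topspace T. f t \<in> U \<and> g t \<in> U'} = {t \<in> topspace T. f t \<in> U} \<inter> {t \<in> topspace T. g t \<in> U'}"
      by auto
    then show ?thesis using f g that by (auto simp: continuous_map_def intro!: openin_Int)
  qed
  have "openin T ?A"
  proof (subst openin_subopen, clarify)
    fix x assume x: "x \<in> topspace T" "f x = g x"
    have "p (f x) \<in> topspace Y" using cov fZ[OF x(1)] by (auto simp: covering_map_def)
    with covering_map_sheeted[OF cov] obtain V where V: "p (f x) \<in> V" "sheeted Z Y p V" by blast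
    obtain U s where U: "openin Z U" "f x \<in> U" "\<And>u. u \<in> U \<Longrightarrow> p u \<in> V \<and> s (p u) = u"
      by (rule sheetedE[OF V(2) fZ[OF x(1)] V(1)]) (rule that)
    have "f t = g t" if "t \<in> topspace T" "f t \<in> U" "g t \<in> U" for t
      using U(3) fg[OF that(1)] that(2,3) by metis
    then have "{t \<in> topspace T. f t \<in> U \<and> g t \<in> U} \<subseteq> ?A" by blast
    then show "\<exists>S. openin T S \<and> x \<in> S \<and> S \<subseteq> ?A"
      using pre[OF U(1) U(1)] U x by (intro exI[of _ "{t \<in> topspace T. f t \<in> U \<and> g t \<in> U}"]) auto
  qed
  moreover have "openin T ?B"
  proof (subst openin_subopen, clarify)
    fix x assume x: "x \<in> topspace T" "f x \<noteq> g x"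
    obtain U U' where U: "openin Z U" "openin Z U'" "f x \<in> U" "g x \<in> U'" "disjnt U U'"
      using covering_map_separate_fibre[OF cov fZ[OF x(1)] gZ[OF x(1)] fg[OF x(1)] x(2)] .
    have "{t \<in> topspace T. f t \<in> U \<and> g t \<in> U'} \<subseteq> ?B"
      using U(5) by (auto simp: disjnt_iff)
    then show "\<exists>S. openin T S \<and> x \<in> S \<and> S \<subseteq> ?B"
      using pre[OF U(1,2)] U x by (intro exI[of _ "{t \<in> topspace T. f t \<in> U \<and> g t \<in> U'}"]) auto
  qed
  moreover have "topspace T \<subseteq> ?A \<union> ?B" "?A \<inter> ?B = {}" by auto
  ultimately have "?A = {} \<or> ?B = {}"
    using T unfolding connected_space_def by meson
  then show ?thesis using a t by blast
qed

lemma subtopology_cylinder: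
  assumes "A \<subseteq> N" "B \<subseteq> S"
  shows "subtopology (prod_topology (subtopology T N) (top_of_set S)) (A \<times> B) =
    prod_topology (subtopology T A) (top_of_set B)"
  using assms by (simp add: subtopology_Times subtopology_subtopology Int_absorb1)

text \<open>
  The homotopy lifting property near one parameter. The interval is treated by bisection: the
  property that every initial lift over a neighbourhood of \<open>t0\<close> extends from time \<open>a\<close> to
  time \<open>b\<close>, over a smaller neighbourhood, is transitive in \<open>a, b\<close>, and it holds for short intervals
  because there the homotopy stays in an evenly covered set.
\<close>

lemma covering_homotopy_lifting_local:
  fixes h :: "'t \<times> real \<Rightarrow> 'y"
  assumes cov: "covering_map Z Y p"
    and h: "continuous_map (prod_topology T (top_of_set {0..1})) Y h"
    and f: "continuous_map T Z f" and fh: "\<And>t. t \<in> topspace T \<Longrightarrow> p (f t) = h (t, 0)"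
    and t0: "t0 \<in> topspace T"
  shows "\<exists>N g. openin T N \<and> t0 \<in> N \<and>
      continuous_map (prod_topology (subtopology T N) (top_of_set {0..1})) Z g \<and>
      (\<forall>t\<in>N. g (t, 0) = f t) \<and> (\<forall>t\<in>N. \<forall>s\<in>{0..1}. p (g (t, s)) = h (t, s))"
proof -
  \<comment> \<open>\<open>f\<close> is the initial lift at time \<open>a\<close>; \<open>t0\<close> stays in all neighbourhoods.\<close>
  define extends where "extends a b N f \<longleftrightarrow> (\<exists>N' g. openin T N' \<and> t0 \<in> N' \<and> N' \<subseteq> N \<and>
      continuous_map (prod_topology (subtopology T N') (top_of_set {a..b})) Z g \<and>
      (\<forall>t\<in>N'. g (t, a) = f t) \<and> (\<forall>t\<in>N'. \<forall>s\<in>{a..b}. p (g (t, s)) = h (t, s)))" for a b N f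
  define Q where "Q a b \<longleftrightarrow> (0 \<le> a \<longrightarrow> b \<le> 1 \<longrightarrow> (\<forall>N f. openin T N \<and> t0 \<in> N \<and>
      continuous_map (subtopology T N) Z f \<and> (\<forall>t\<in>N. p (f t) = h (t, a)) \<longrightarrow> extends a b N f))" for a b
  have "Q 0 1"
  proof (rule Bolzano)
    show "(0::real) \<le> 1" by simp
  next
    fix a b c assume Q: "Q a b" "Q b c" and abc: "a \<le> b" "b \<le> c"
    show "Q a c"
      unfolding Q_def
    proof (intro impI allI, elim conjE)
      fix N f assume ac: "0 \<le> a" "c \<le> 1"
        and N: "openin T N" "t0 \<in> N" "continuous_map (subtopology T N) Z f" "\<forall>t\<in>N. p (f t) = h (t, a)"
      have "extends a b N f" using Q(1) ac abc N unfolding Q_def by simp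
      then obtain N1 g1 where N1: "openin T N1" "t0 \<in> N1" "N1 \<subseteq> N"
          "continuous_map (prod_topology (subtopology T N1) (top_of_set {a..b})) Z g1"
          "\<forall>t\<in>N1. g1 (t, a) = f t" "\<forall>t\<in>N1. \<forall>s\<in>{a..b}. p (g1 (t, s)) = h (t, s)"
        unfolding extends_def by (elim exE conjE)
      have "continuous_map (subtopology T N1) (prod_topology (subtopology T N1) (top_of_set {a..b})) (\<lambda>t. (t, b))"
        using abc by (auto simp: continuous_map_pairwise o_def)
      from continuous_map_compose[OF this N1(4)]
      have "continuous_map (subtopology T N1) Z (\<lambda>t. g1 (t, b))" by (simp add: o_def)
      moreover have "\<forall>t\<in>N1. p (g1 (t, b)) = h (t, b)" using N1(6) abc by auto
      ultimately have "extends b c N1 (\<lambda>t. g1 (t, b))" using Q(2) ac abc N1(1,2) unfolding Q_def by simp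
      then obtain N2 g2 where N2: "openin T N2" "t0 \<in> N2" "N2 \<subseteq> N1"
          "continuous_map (prod_topology (subtopology T N2) (top_of_set {b..c})) Z g2"
          "\<forall>t\<in>N2. g2 (t, b) = g1 (t, b)" "\<forall>t\<in>N2. \<forall>s\<in>{b..c}. p (g2 (t, s)) = h (t, s)"
        unfolding extends_def by (elim exE conjE)
      let ?P = "prod_topology (subtopology T N2) (top_of_set {a..c})"
      let ?g = "\<lambda>x. if snd x \<le> b then g1 x else g2 x"
      have tP: "topspace ?P = N2 \<times> {a..c}" using openin_subset[OF N2(1)] by auto
      have "{x. x \<in> topspace ?P \<and> snd x \<le> b} = N2 \<times> {a..b}"
           "{x. x \<in> topspace ?P \<and> b \<le> snd x} = N2 \<times> {b..c}"
        using abc unfolding tP by auto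
      moreover have "subtopology ?P (N2 \<times> {a..b}) =
            subtopology (prod_topology (subtopology T N1) (top_of_set {a..b})) (N2 \<times> {a..b})"
           "subtopology ?P (N2 \<times> {b..c}) = prod_topology (subtopology T N2) (top_of_set {b..c})"
        using abc N2(3) by (simp_all add: subtopology_cylinder)
      ultimately have sub: "subtopology ?P {x. x \<in> topspace ?P \<and> snd x \<le> b} =
            subtopology (prod_topology (subtopology T N1) (top_of_set {a..b})) (N2 \<times> {a..b})"
           "subtopology ?P {x. x \<in> topspace ?P \<and> b \<le> snd x} =
            prod_topology (subtopology T N2) (top_of_set {b..c})"
        by simp_all
      have "continuous_map ?P Z ?g"
      proof (rule continuous_map_cases_le)
        show "continuous_map ?P euclideanreal snd"
          using continuous_map_snd[of "subtopology T N2" "top_of_set {a..c}"]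
          by (simp add: continuous_map_in_subtopology)
        show "continuous_map (subtopology ?P {x. x \<in> topspace ?P \<and> snd x \<le> b}) Z g1"
          unfolding sub by (rule continuous_map_from_subtopology[OF N1(4)])
        show "continuous_map (subtopology ?P {x. x \<in> topspace ?P \<and> b \<le> snd x}) Z g2"
          unfolding sub by (rule N2(4))
      next
        fix x assume "x \<in> topspace ?P" "snd x = b"
        then show "g1 x = g2 x" unfolding tP using N2(5) by auto
      qed auto
      moreover have "\<forall>t\<in>N2. ?g (t, a) = f t" using N1(5) N2(3) abc by auto
      moreover have "\<forall>t\<in>N2. \<forall>s\<in>{a..c}. p (?g (t, s)) = h (t, s)" using N1(6) N2(3,6) abc by auto
      ultimately show "extends a c N f"
        unfolding extends_def
        using N2(1,2,3) N1(3) by (intro exI[of _ N2] exI[of _ ?g]) blast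
    qed
  next
    fix x :: real assume x: "0 \<le> x" "x \<le> 1"
    have "h (t0, x) \<in> topspace Y" using h x t0 by (auto simp: continuous_map_def)
    with covering_map_sheeted[OF cov] obtain V where V: "h (t0, x) \<in> V" "sheeted Z Y p V"
      by blast
    have oV: "openin Y V" using V(2) by (simp add: sheeted_def)
    let ?W = "{w \<in> topspace T \<times> {0..1}. h w \<in> V}"
    have "openin (prod_topology T (top_of_set {0..1})) ?W"
      using h oV by (auto simp: continuous_map_def)
    moreover have "(t0, x) \<in> ?W" using V t0 x by auto
    ultimately obtain N0 J where NJ: "openin T N0" "openin (top_of_set {0..1}) J" "t0 \<in> N0" "x \<in> J" "N0 \<times> J \<subseteq> ?W"
      unfolding openin_prod_topology_alt by meson
    obtain d where d: "d > 0" "\<And>s. s \<in> {0..1} \<Longrightarrow> \<bar>s - x\<bar> < d \<Longrightarrow> s \<in> J"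
      using NJ(2,4) unfolding openin_euclidean_subtopology_iff by (auto simp: dist_real_def)
    show "\<exists>d>0. \<forall>a b. a \<le> x \<and> x \<le> b \<and> b - a < d \<longrightarrow> Q a b"
    proof (intro exI[of _ d] conjI allI impI, rule d(1), elim conjE)
      fix a b assume ab: "a \<le> x" "x \<le> b" "b - a < d"
      show "Q a b"
        unfolding Q_def
      proof (intro impI allI, elim conjE)
        fix N f assume ab': "0 \<le> a" "b \<le> 1"
          and N: "openin T N" "t0 \<in> N" "continuous_map (subtopology T N) Z f" "\<forall>t\<in>N. p (f t) = h (t, a)"
        have J: "s \<in> J" if "s \<in> {a..b}" for s using that ab ab' d(2) by auto
        have hV: "h (t, s) \<in> V" if "t \<in> N0" "s \<in> {a..b}" for t s using that J NJ(5) by blast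
        have "f t0 \<in> topspace Z" using N t0 by (auto simp: continuous_map_def)
        moreover have "p (f t0) \<in> V" using N(2,4) hV NJ(3) ab by auto
        ultimately obtain U s where U: "openin Z U" "f t0 \<in> U" "continuous_map (subtopology Y V) Z s"
            "\<And>u. u \<in> U \<Longrightarrow> p u \<in> V \<and> s (p u) = u" "\<And>v. v \<in> V \<Longrightarrow> p (s v) = v"
          by (rule sheetedE[OF V(2)]) (rule that)
        let ?N = "{t \<in> topspace (subtopology T N). f t \<in> U} \<inter> N0"
        have NT: "N \<subseteq> topspace T" using openin_subset[OF N(1)] .
        have "openin (subtopology T N) {t \<in> topspace (subtopology T N). f t \<in> U}"
          using N(3) U(1) unfolding continuous_map_def by blast
        then have oN: "openin T ?N" using N(1) NJ(1) openin_trans_full by blast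
        have "continuous_map (prod_topology (subtopology T ?N) (top_of_set {a..b})) Z (s \<circ> h)"
        proof (rule continuous_map_compose[OF _ U(3)])
          have "prod_topology (subtopology T ?N) (top_of_set {a..b}) =
              subtopology (prod_topology T (top_of_set {0..1})) (?N \<times> {a..b})"
            using ab' openin_subset[OF oN] subtopology_cylinder[of ?N "topspace T" "{a..b}" "{0..1}" T]
            by (simp only: subtopology_topspace atLeastatMost_subset_iff) simp
          then have "continuous_map (prod_topology (subtopology T ?N) (top_of_set {a..b})) Y h"
            using continuous_map_from_subtopology[OF h] by (simp only:)
          moreover have "h \<in> topspace (prod_topology (subtopology T ?N) (top_of_set {a..b})) \<rightarrow> V"
            using hV by auto
          ultimately show "continuous_map (prod_topology (subtopology T ?N) (top_of_set {a..b})) (subtopology Y V) h"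
            by (simp only: continuous_map_in_subtopology)
        qed
        moreover have "(s \<circ> h) (t, a) = f t" if "t \<in> ?N" for t
          using that U(4) N(4) by (metis (no_types, lifting) IntD1 IntD2 comp_apply mem_Collect_eq topspace_subtopology)
        moreover have "p ((s \<circ> h) (t, r)) = h (t, r)" if "t \<in> ?N" "r \<in> {a..b}" for t r
          using that U(5) hV by auto
        ultimately show "extends a b N f"
          unfolding extends_def using oN U(2) N(2) NJ(3) t0 by (intro exI[of _ ?N] exI[of _ "s \<circ> h"]) auto
      qed
    qed
  qed
  moreover have "openin T (topspace T) \<and> t0 \<in> topspace T \<and>
      continuous_map (subtopology T (topspace T)) Z f \<and> (\<forall>t\<in>topspace T. p (f t) = h (t, 0))"
    using f fh t0 by simp
  ultimately have "extends 0 1 (topspace T) f" unfolding Q_def by simp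
  then show ?thesis unfolding extends_def by (elim exE conjE) (intro exI conjI)
qed

lemma connected_space_interval: "connected_space (top_of_set {a..b::real})"
  using connectedin_absolute connected_Icc by (simp add: connectedin_def[symmetric])

text \<open>
  The local lifts agree where they overlap, by uniqueness of lifts along \<open>{t} \<times> [0,1]\<close>.
\<close>

lemma covering_homotopy_lifting:
  fixes h :: "'t \<times> real \<Rightarrow> 'y"
  assumes cov: "covering_map Z Y p"
    and h: "continuous_map (prod_topology T (top_of_set {0..1})) Y h"
    and f: "continuous_map T Z f" and fh: "\<And>t. t \<in> topspace T \<Longrightarrow> p (f t) = h (t, 0)"
  shows "\<exists>g. continuous_map (prod_topology T (top_of_set {0..1})) Z g \<and>
    (\<forall>t\<in>topspace T. g (t, 0) = f t) \<and> (\<forall>t\<in>topspace T. \<forall>s\<in>{0..1}. p (g (t, s)) = h (t, s))"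
proof -
  have "\<forall>t0\<in>topspace T. \<exists>N g. openin T N \<and> t0 \<in> N \<and>
      continuous_map (prod_topology (subtopology T N) (top_of_set {0..1})) Z g \<and>
      (\<forall>t\<in>N. g (t, 0) = f t) \<and> (\<forall>t\<in>N. \<forall>s\<in>{0..1}. p (g (t, s)) = h (t, s))"
    using covering_homotopy_lifting_local[OF cov h f fh] by blast
  then obtain N g where "\<forall>t0\<in>topspace T. openin T (N t0) \<and> t0 \<in> N t0 \<and>
      continuous_map (prod_topology (subtopology T (N t0)) (top_of_set {0..1})) Z (g t0) \<and>
      (\<forall>t\<in>N t0. g t0 (t, 0) = f t) \<and> (\<forall>t\<in>N t0. \<forall>s\<in>{0..1}. p (g t0 (t, s)) = h (t, s))"
    by metis
  then have N: "\<And>r. r \<in> topspace T \<Longrightarrow> openin T (N r)" "\<And>r. r \<in> topspace T \<Longrightarrow> r \<in> N r"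
      "\<And>r. r \<in> topspace T \<Longrightarrow> continuous_map (prod_topology (subtopology T (N r)) (top_of_set {0..1})) Z (g r)"
      "\<And>r t. r \<in> topspace T \<Longrightarrow> t \<in> N r \<Longrightarrow> g r (t, 0) = f t"
      "\<And>r t s. r \<in> topspace T \<Longrightarrow> t \<in> N r \<Longrightarrow> s \<in> {0..1} \<Longrightarrow> p (g r (t, s)) = h (t, s)"
    by blast+
  have slice: "continuous_map (top_of_set {0..1}) Z (\<lambda>s. g r (t, s))" if "r \<in> topspace T" "t \<in> N r" for r t
  proof -
    have "t \<in> topspace T" using that openin_subset[OF N(1)] by blast
    then have "continuous_map (top_of_set {0..1}) (prod_topology (subtopology T (N r)) (top_of_set {0..1})) (\<lambda>s. (t, s))"
      using that by (auto simp: continuous_map_pairwise o_def)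
    from continuous_map_compose[OF this N(3)[OF that(1)]] show ?thesis by (simp add: o_def)
  qed
  have agree: "g r (t, s) = g r' (t, s)"
    if "r \<in> topspace T" "r' \<in> topspace T" "t \<in> N r" "t \<in> N r'" "s \<in> {0..1}" for r r' t s
    using covering_lift_unique[OF cov connected_space_interval slice slice, of r t r' t 0 s] that N(4,5)
    by auto
  define G where "G = (\<lambda>(t, s). g t (t, s))"
  have "continuous_map (prod_topology T (top_of_set {0..1})) Z G"
  proof (rule pasting_lemma[where I = "topspace T" and T = "\<lambda>r. N r \<times> {0..1}" and f = g])
    fix r assume r: "r \<in> topspace T"
    show "openin (prod_topology T (top_of_set {0..1})) (N r \<times> {0..1})"
      using N(1)[OF r] by (simp add: openin_prod_Times_iff)
    show "continuous_map (subtopology (prod_topology T (top_of_set {0..1})) (N r \<times> {0..1})) Z (g r)"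
      using N(3)[OF r] by (simp add: subtopology_Times subtopology_subtopology)
  next
    fix i j x assume ij: "i \<in> topspace T" "j \<in> topspace T"
      and x: "x \<in> topspace (prod_topology T (top_of_set {0..1::real})) \<inter> N i \<times> {0..1} \<inter> N j \<times> {0..1}"
    have "fst x \<in> N i" "fst x \<in> N j" "snd x \<in> {0..1}" using x by (simp_all add: mem_Times_iff)
    from agree[OF ij this] show "g i x = g j x" by simp
  next
    fix x assume "x \<in> topspace (prod_topology T (top_of_set {0..1::real}))"
    then have "fst x \<in> topspace T" "snd x \<in> {0..1}" by (simp_all add: mem_Times_iff)
    then show "\<exists>j. j \<in> topspace T \<and> x \<in> N j \<times> {0..1} \<and> G x = g j x"
      using N(2) by (intro exI[of _ "fst x"]) (simp add: G_def mem_Times_iff split_beta)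
  qed
  then show ?thesis
  proof (intro exI[of _ G] conjI ballI)
    fix t assume t: "t \<in> topspace T"
    show "G (t, 0) = f t" using N(4)[OF t N(2)[OF t]] by (simp add: G_def)
    fix s :: real assume "s \<in> {0..1}"
    then show "p (G (t, s)) = h (t, s)" using N(5)[OF t N(2)[OF t]] by (simp add: G_def)
  qed
qed

lemma covering_path_lifting:
  assumes cov: "covering_map Z Y p" and \<gamma>: "pathin Y \<gamma>" and z: "z \<in> topspace Z" "p z = \<gamma> 0"
  shows "\<exists>\<Gamma>. pathin Z \<Gamma> \<and> \<Gamma> 0 = z \<and> (\<forall>t\<in>{0..1}. p (\<Gamma> t) = \<gamma> t)"
proof -
  let ?T = "discrete_topology {()}"
  have "continuous_map (prod_topology ?T (top_of_set {0..1})) Y (\<gamma> \<circ> snd)"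
    using \<gamma> unfolding pathin_def by (rule continuous_map_compose[OF continuous_map_snd])
  moreover have "continuous_map ?T Z (\<lambda>_. z)" using z by simp
  ultimately have "\<exists>g. continuous_map (prod_topology ?T (top_of_set {0..1})) Z g \<and> g ((), 0) = z \<and>
      (\<forall>s\<in>{0..1}. p (g ((), s)) = \<gamma> s)"
    using covering_homotopy_lifting[OF cov, of ?T "\<gamma> \<circ> snd" "\<lambda>_. z"] z(2) by simp
  then obtain g where g: "continuous_map (prod_topology ?T (top_of_set {0..1})) Z g" "g ((), 0) = z"
      "\<And>s. s \<in> {0..1} \<Longrightarrow> p (g ((), s)) = \<gamma> s"
    by blast
  have "continuous_map (top_of_set {0..1}) (prod_topology ?T (top_of_set {0..1})) (\<lambda>s. ((), s))"
    by (auto simp: continuous_map_pairwise o_def)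
  from continuous_map_compose[OF this g(1)] have "pathin Z (\<lambda>s. g ((), s))" by (simp add: o_def pathin_def)
  then show ?thesis using g by (intro exI[of _ "\<lambda>s. g ((), s)"]) simp
qed

lemma path_lift_unique:
  assumes "covering_map Z Y p" "pathin Z \<alpha>" "pathin Z \<beta>" "\<And>t. t \<in> {0..1} \<Longrightarrow> p (\<alpha> t) = p (\<beta> t)"
    "c \<in> {0..1}" "\<alpha> c = \<beta> c" "t \<in> {0..1}"
  shows "\<alpha> t = \<beta> t"
  using covering_lift_unique[OF assms(1) connected_space_interval, of 0 1 \<alpha> \<beta> c t] assms
  by (auto simp: pathin_def)

lemma pathin_slice:
  assumes "continuous_map (prod_topology (top_of_set {0..1}) (top_of_set {0..1::real})) Z g" "c \<in> {0..1::real}"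
  shows "pathin Z (\<lambda>s. g (c, s))" "pathin Z (\<lambda>s. g (s, c))"
proof -
  let ?I = "top_of_set {0..1::real}"
  have "continuous_map ?I (prod_topology ?I ?I) (\<lambda>s. (c, s))" "continuous_map ?I (prod_topology ?I ?I) (\<lambda>s. (s, c))"
    using assms(2) by (simp_all only: continuous_map_pairwise) (auto simp: o_def)
  from this[THEN continuous_map_compose, OF assms(1)]
  show "pathin Z (\<lambda>s. g (c, s))" "pathin Z (\<lambda>s. g (s, c))"
    by (simp_all add: pathin_def o_def)
qed

lemma pathin_reparametrize:
  assumes "pathin X \<gamma>" "continuous_on {0..1} \<phi>" "\<And>t. t \<in> {0..1} \<Longrightarrow> \<phi> t \<in> {0..1::real}"
  shows "pathin X (\<lambda>t. \<gamma> (\<phi> t))"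
proof -
  have "continuous_map (top_of_set {0..1}) (top_of_set {0..1}) \<phi>"
    using assms(2,3) by (auto simp: continuous_map_in_subtopology)
  from continuous_map_compose[OF this assms(1)[unfolded pathin_def]]
  show ?thesis by (simp add: pathin_def o_def)
qed

definition join_path :: "(real \<Rightarrow> 'a) \<Rightarrow> (real \<Rightarrow> 'a) \<Rightarrow> real \<Rightarrow> 'a" where
  "join_path \<alpha> \<beta> t = (if t \<le> 1/2 then \<alpha> (2 * t) else \<beta> (2 * t - 1))"

lemma pathin_join:
  assumes "pathin X \<alpha>" "pathin X \<beta>" "\<alpha> 1 = \<beta> 0"
  shows "pathin X (join_path \<alpha> \<beta>)"
proof -
  let ?I = "top_of_set {0..1::real}"
  have A: "{x. x \<in> topspace ?I \<and> x \<le> 1/2} = {0..1/2}" and B: "{x. x \<in> topspace ?I \<and> 1/2 \<le> x} = {1/2..1}"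
    by auto
  have "continuous_map ?I X (\<lambda>t. if t \<le> 1/2 then (\<alpha> \<circ> (\<lambda>t. 2 * t)) t else (\<beta> \<circ> (\<lambda>t. 2 * t - 1)) t)"
  proof (rule continuous_map_cases_le)
    show "continuous_map (subtopology ?I {x. x \<in> topspace ?I \<and> x \<le> 1/2}) X (\<alpha> \<circ> (\<lambda>t. 2 * t))"
      unfolding A using assms(1)
      by (intro continuous_map_compose[of _ ?I])
        (auto simp: pathin_def subtopology_subtopology continuous_map_in_subtopology intro!: continuous_intros)
    show "continuous_map (subtopology ?I {x. x \<in> topspace ?I \<and> 1/2 \<le> x}) X (\<beta> \<circ> (\<lambda>t. 2 * t - 1))"
      unfolding B using assms(2)
      by (intro continuous_map_compose[of _ ?I])
        (auto simp: pathin_def subtopology_subtopology continuous_map_in_subtopology intro!: continuous_intros)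
    fix x :: real assume "x = 1/2"
    then show "(\<alpha> \<circ> (\<lambda>t. 2 * t)) x = (\<beta> \<circ> (\<lambda>t. 2 * t - 1)) x"
      using assms(3) by (simp only: o_apply) simp
  qed auto
  then show ?thesis unfolding pathin_def by (rule continuous_map_eq) (simp add: join_path_def)
qed

lemma lift_join:
  assumes "\<And>t. t \<in> {0..1} \<Longrightarrow> p (\<alpha> t) = q (\<alpha>' t)" "\<And>t. t \<in> {0..1} \<Longrightarrow> p (\<beta> t) = q (\<beta>' t)" "t \<in> {0..1}"
  shows "p (join_path \<alpha> \<beta> t) = q (join_path \<alpha>' \<beta>' t)"
  using assms by (auto simp: join_path_def)

text \<open>
  A nullhomotopy of a loop in \<open>X\<close> projects to \<open>Y\<close> and lifts to \<open>Z\<close>. The lift is constant on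
  the three sides of the square that the nullhomotopy sends to the base point.
\<close>

lemma simply_connected_loop_lift:
  assumes X: "simply_connected_space X" and q: "continuous_map X Y q" and cov: "covering_map Z Y p"
    and \<gamma>: "pathin X \<gamma>" "\<gamma> 1 = \<gamma> 0"
    and \<Gamma>: "pathin Z \<Gamma>" "\<And>t. t \<in> {0..1} \<Longrightarrow> p (\<Gamma> t) = q (\<gamma> t)"
  shows "\<Gamma> 1 = \<Gamma> 0"
proof -
  let ?I = "top_of_set {0..1::real}"
  have "homotopic_with (\<lambda>h. h 0 = \<gamma> 0 \<and> h 1 = \<gamma> 0) ?I X \<gamma> (\<lambda>t. \<gamma> 0)"
    using X \<gamma> by (simp add: simply_connected_space_def)
  then obtain H where H: "continuous_map (prod_topology ?I ?I) X H" "\<And>x. H (0, x) = \<gamma> x" "\<And>x. H (1, x) = \<gamma> 0"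
      "\<And>s. s \<in> {0..1} \<Longrightarrow> H (s, 0) = \<gamma> 0" "\<And>s. s \<in> {0..1} \<Longrightarrow> H (s, 1) = \<gamma> 0"
    unfolding homotopic_with_def by auto
  have "continuous_map (prod_topology ?I ?I) Y (q \<circ> H)" using H(1) q by (rule continuous_map_compose)
  moreover have \<Gamma>0: "\<Gamma> 0 \<in> topspace Z" using \<Gamma>(1) by (rule path_start_in_topspace)
  then have "continuous_map ?I Z (\<lambda>_. \<Gamma> 0)" by simp
  moreover have "p (\<Gamma> 0) = (q \<circ> H) (s, 0)" if "s \<in> topspace ?I" for s
    using \<Gamma>(2)[of 0] H(4) that by simp
  ultimately have "\<exists>g. continuous_map (prod_topology ?I ?I) Z g \<and> (\<forall>s\<in>topspace ?I. g (s, 0) = \<Gamma> 0) \<and>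
      (\<forall>s\<in>topspace ?I. \<forall>t\<in>{0..1}. p (g (s, t)) = (q \<circ> H) (s, t))"
    by (intro covering_homotopy_lifting[OF cov])
  then obtain g where g: "continuous_map (prod_topology ?I ?I) Z g"
      "\<forall>s\<in>topspace ?I. g (s, 0) = \<Gamma> 0"
      "\<forall>s\<in>topspace ?I. \<forall>t\<in>{0..1}. p (g (s, t)) = (q \<circ> H) (s, t)"
    by (elim exE conjE)
  note slice = pathin_slice[OF g(1)]
  have "g (0, 1) = \<Gamma> 1"
    by (rule path_lift_unique[OF cov slice(1) \<Gamma>(1), where c = 0]) (use g(2,3) \<Gamma>(2) H(2) in auto)
  moreover have "g (1, 1) = \<Gamma> 0"
    by (rule path_lift_unique[OF cov slice(1), where c = 0 and \<beta> = "\<lambda>_. \<Gamma> 0"])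
      (use g(2,3) \<Gamma>(2)[of 0] H(3) \<Gamma>0 in auto)
  moreover have "g (0, 1) = g (1, 1)"
    by (rule path_lift_unique[OF cov slice(2), where c = 1 and \<beta> = "\<lambda>_. g (1, 1)"])
      (use g(3) H(5) slice(1)[THEN path_finish_in_topspace] in auto)
  ultimately show ?thesis by simp
qed

text \<open>
  A simply connected space lifts to any covering: the lift of a point is the end of the lift of any
  path from the base point, and two such paths form a loop, whose lift closes. Continuity of the lift
  is recorded through its effect on paths.
\<close>

lemma simply_connected_lift:
  assumes X: "simply_connected_space X" and q: "continuous_map X Y q" and cov: "covering_map Z Y p"
    and x0: "x0 \<in> topspace X" and z0: "z0 \<in> topspace Z" "p z0 = q x0"
  shows "\<exists>\<Theta>. \<Theta> x0 = z0 \<and> (\<forall>x\<in>topspace X. \<Theta> x \<in> topspace Z \<and> p (\<Theta> x) = q x) \<and>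
    (\<forall>\<gamma> \<Gamma>. pathin X \<gamma> \<longrightarrow> pathin Z \<Gamma> \<longrightarrow> (\<forall>t\<in>{0..1}. p (\<Gamma> t) = q (\<gamma> t)) \<longrightarrow>
       \<Gamma> 0 = \<Theta> (\<gamma> 0) \<longrightarrow> \<Gamma> 1 = \<Theta> (\<gamma> 1))"
proof -
  define R where "R x z \<longleftrightarrow> (\<exists>\<gamma> \<Gamma>. pathin X \<gamma> \<and> \<gamma> 0 = x0 \<and> \<gamma> 1 = x \<and> pathin Z \<Gamma> \<and> \<Gamma> 0 = z0 \<and> \<Gamma> 1 = z \<and>
      (\<forall>t\<in>{0..1}. p (\<Gamma> t) = q (\<gamma> t)))" for x z
  have RI: "R x z" if "pathin X \<gamma>" "\<gamma> 0 = x0" "\<gamma> 1 = x" "pathin Z \<Gamma>" "\<Gamma> 0 = z0" "\<Gamma> 1 = z"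
      "\<And>t. t \<in> {0..1} \<Longrightarrow> p (\<Gamma> t) = q (\<gamma> t)" for x z \<gamma> \<Gamma>
    unfolding R_def using that by (intro exI[of _ \<gamma>] exI[of _ \<Gamma>]) auto
  have lift: "\<exists>\<Gamma>. pathin Z \<Gamma> \<and> \<Gamma> 0 = z0 \<and> (\<forall>t\<in>{0..1}. p (\<Gamma> t) = q (\<gamma> t))"
    if "pathin X \<gamma>" "\<gamma> 0 = x0" for \<gamma>
  proof -
    have "pathin Y (\<lambda>t. q (\<gamma> t))" using pathin_compose[OF that(1) q] by (simp add: o_def)
    from covering_path_lifting[OF cov this z0(1)] show ?thesis using z0(2) that(2) by simp
  qed
  have ex: "\<exists>z. R x z" if "x \<in> topspace X" for x
  proof -
    have "path_connected_space X" using X by (simp add: simply_connected_space_def)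
    then have "\<exists>\<gamma>. pathin X \<gamma> \<and> \<gamma> 0 = x0 \<and> \<gamma> 1 = x"
      using x0 that by (simp add: path_connected_space_def)
    then obtain \<gamma> where \<gamma>: "pathin X \<gamma>" "\<gamma> 0 = x0" "\<gamma> 1 = x"
      by (elim exE conjE)
    from lift[OF \<gamma>(1,2)]
    obtain \<Gamma> where "pathin Z \<Gamma>" "\<Gamma> 0 = z0" "\<forall>t\<in>{0..1}. p (\<Gamma> t) = q (\<gamma> t)"
      by (elim exE conjE)
    then have "R x (\<Gamma> 1)" using RI \<gamma> by simp
    then show ?thesis by auto
  qed
  have unique: "z = z'" if "R x z" "R x z'" for x z z'
  proof -
    obtain \<gamma> \<Gamma> where 1: "pathin X \<gamma>" "\<gamma> 0 = x0" "\<gamma> 1 = x" "pathin Z \<Gamma>" "\<Gamma> 0 = z0" "\<Gamma> 1 = z"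
        "\<And>t. t \<in> {0..1} \<Longrightarrow> p (\<Gamma> t) = q (\<gamma> t)"
      using \<open>R x z\<close> unfolding R_def by (elim exE conjE) simp
    obtain \<gamma>' \<Gamma>' where 2: "pathin X \<gamma>'" "\<gamma>' 0 = x0" "\<gamma>' 1 = x" "pathin Z \<Gamma>'" "\<Gamma>' 0 = z0" "\<Gamma>' 1 = z'"
        "\<And>t. t \<in> {0..1} \<Longrightarrow> p (\<Gamma>' t) = q (\<gamma>' t)"
      using \<open>R x z'\<close> unfolding R_def by (elim exE conjE) simp
    have "pathin X (\<lambda>t. \<gamma>' (1 - t))"
      by (rule pathin_reparametrize[OF 2(1)]) (auto intro!: continuous_intros)
    then have loop: "pathin X (join_path \<gamma> (\<lambda>t. \<gamma>' (1 - t)))" (is "pathin X ?\<beta>")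
      using 1 2 by (intro pathin_join) simp_all
    have "?\<beta> 0 = x0" "?\<beta> 1 = ?\<beta> 0" using 1 2 by (simp_all add: join_path_def)
    from lift[OF loop this(1)] obtain \<Lambda> where \<Lambda>: "pathin Z \<Lambda>" "\<Lambda> 0 = z0"
        "\<forall>t\<in>{0..1}. p (\<Lambda> t) = q (?\<beta> t)"
      by (elim exE conjE)
    have closes: "\<Lambda> 1 = z0"
      using simply_connected_loop_lift[OF X q cov loop \<open>?\<beta> 1 = ?\<beta> 0\<close> \<Lambda>(1)] \<Lambda>(2,3) by simp
    \<comment> \<open>The first half of \<open>\<Lambda>\<close> and the reversed second half are the two given lifts.\<close>
    have h1: "pathin Z (\<lambda>t. \<Lambda> (t / 2))" and h2: "pathin Z (\<lambda>t. \<Lambda> (1 - t / 2))"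
      by (rule pathin_reparametrize[OF \<Lambda>(1)]; auto intro!: continuous_intros)+
    have "\<Lambda> (1 / 2) = \<Gamma> 1"
      by (rule path_lift_unique[OF cov h1 1(4), where c = 0])
        (use 1 \<Lambda> in \<open>auto simp: join_path_def\<close>)
    moreover have "p (\<Lambda> (1 - t / 2)) = p (\<Gamma>' t)" if t: "t \<in> {0..1}" for t
    proof (cases "t = 1")
      case True
      then show ?thesis using 1(3) 2(3) bspec[OF \<Lambda>(3), of "1/2"] 2(7)[of 1] by (simp add: join_path_def)
    next
      case False
      then show ?thesis using t bspec[OF \<Lambda>(3), of "1 - t/2"] 2(7)[of t] by (auto simp: join_path_def)
    qed
    then have "\<Lambda> (1 / 2) = \<Gamma>' 1"
      using path_lift_unique[OF cov h2 2(4), of 0 1] closes 2(5) by simp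
    ultimately show ?thesis using 1(6) 2(6) by simp
  qed
  define \<Theta> where "\<Theta> x = (THE z. R x z)" for x
  have \<Theta>R: "R x z \<Longrightarrow> \<Theta> x = z" for x z unfolding \<Theta>_def by (rule the_equality) (auto intro: unique)
  show ?thesis
  proof (intro exI[of _ \<Theta>] conjI allI impI ballI)
    show "\<Theta> x0 = z0"
      using x0 z0 by (intro \<Theta>R RI[of "\<lambda>_. x0" _ "\<lambda>_. z0"]) auto
  next
    fix x assume "x \<in> topspace X"
    then obtain z where z: "R x z" using ex by auto
    then have "z \<in> topspace Z" "p z = q x"
      unfolding R_def by (auto dest: path_finish_in_topspace)
    then show "\<Theta> x \<in> topspace Z" "p (\<Theta> x) = q x" using \<Theta>R[OF z] by simp_all
  next
    fix \<gamma> \<Gamma> assume \<gamma>: "pathin X \<gamma>"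
      and \<Gamma>: "pathin Z \<Gamma>" "\<forall>t\<in>{0..1}. p (\<Gamma> t) = q (\<gamma> t)" "\<Gamma> 0 = \<Theta> (\<gamma> 0)"
    obtain z where z: "R (\<gamma> 0) z" using ex path_start_in_topspace[OF \<gamma>] by auto
    then obtain \<alpha> A where 1: "pathin X \<alpha>" "\<alpha> 0 = x0" "\<alpha> 1 = \<gamma> 0" "pathin Z A" "A 0 = z0" "A 1 = z"
        "\<And>t. t \<in> {0..1} \<Longrightarrow> p (A t) = q (\<alpha> t)"
      unfolding R_def by (elim exE conjE) simp
    have "A 1 = \<Gamma> 0" using \<Theta>R[OF z] \<Gamma>(3) 1(6) by simp
    then have "pathin X (join_path \<alpha> \<gamma>)" "pathin Z (join_path A \<Gamma>)"
      using 1 \<gamma> \<Gamma> by (simp_all add: pathin_join)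
    moreover have "p (join_path A \<Gamma> t) = q (join_path \<alpha> \<gamma> t)" if "t \<in> {0..1}" for t
      using lift_join[of p A q \<alpha> \<Gamma> \<gamma> t] that 1(7) \<Gamma>(2) by simp
    ultimately have "R (\<gamma> 1) (\<Gamma> 1)"
      using 1(2,5) by (intro RI[of "join_path \<alpha> \<gamma>" _ "join_path A \<Gamma>"]) (simp_all add: join_path_def)
    then show "\<Gamma> 1 = \<Theta> (\<gamma> 1)" using \<Theta>R by simp
  qed
qed

section \<open>Spherical subsets are cliques\<close>

lemma finite_generate_commuting_involutions:
  assumes "group G" "s \<in> carrier G" "t \<in> carrier G"
    "s \<otimes>\<^bsub>G\<^esub> s = \<one>\<^bsub>G\<^esub>" "t \<otimes>\<^bsub>G\<^esub> t = \<one>\<^bsub>G\<^esub>" "s \<otimes>\<^bsub>G\<^esub> t = t \<otimes>\<^bsub>G\<^esub> s"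
  shows "finite (generate G {s, t})"
proof -
  interpret group G by fact
  let ?H = "{\<one>\<^bsub>G\<^esub>, s, t, s \<otimes>\<^bsub>G\<^esub> t}"
  have ss: "s \<otimes>\<^bsub>G\<^esub> (s \<otimes>\<^bsub>G\<^esub> x) = x" and tt: "t \<otimes>\<^bsub>G\<^esub> (t \<otimes>\<^bsub>G\<^esub> x) = x"
    and ts: "t \<otimes>\<^bsub>G\<^esub> (s \<otimes>\<^bsub>G\<^esub> x) = s \<otimes>\<^bsub>G\<^esub> (t \<otimes>\<^bsub>G\<^esub> x)" if "x \<in> carrier G" for x
    using that assms(2-) by (simp_all add: m_assoc[symmetric])
  note rules = m_assoc ss tt ts assms(2-5) assms(6)[symmetric]
  have "subgroup ?H G"
  proof (rule subgroupI)
    show "?H \<subseteq> carrier G" using assms by auto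
    show "inv\<^bsub>G\<^esub> a \<in> ?H" if "a \<in> ?H" for a
    proof -
      have "a \<otimes>\<^bsub>G\<^esub> a = \<one>\<^bsub>G\<^esub>" "a \<in> carrier G" using that by (auto simp: rules)
      then have "inv\<^bsub>G\<^esub> a = a" by (simp add: inv_equality)
      then show ?thesis using that by simp
    qed
    show "a \<otimes>\<^bsub>G\<^esub> b \<in> ?H" if "a \<in> ?H" "b \<in> ?H" for a b
      using that by (auto simp: rules)
  qed auto
  then have "generate G {s, t} \<subseteq> ?H" by (rule generate_subgroup_incl[rotated]) auto
  then show ?thesis by (rule finite_subset) simp
qed

context
  fixes I :: "'i set" and Ed :: "'i set set"
  assumes graph: "simplicial_graph I Ed"
begin

lemma racg_gen_relations:
  assumes "i \<in> I"
  shows "word_class I (racg_rels I Ed) [i] \<in> carrier (racg I Ed)"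
    "word_class I (racg_rels I Ed) [i] \<otimes>\<^bsub>racg I Ed\<^esub> word_class I (racg_rels I Ed) [i] = \<one>\<^bsub>racg I Ed\<^esub>"
proof -
  show "word_class I (racg_rels I Ed) [i] \<in> carrier (racg I Ed)"
    using assms by (auto simp: racg_def carrier_presented)
  have "word_cong I (racg_rels I Ed) [i, i] []"
    using assms wc_rel[of "[i, i]" "[]" "racg_rels I Ed" I "[]" "[]"] by (auto simp: racg_rels_def)
  then show "word_class I (racg_rels I Ed) [i] \<otimes>\<^bsub>racg I Ed\<^esub> word_class I (racg_rels I Ed) [i] = \<one>\<^bsub>racg I Ed\<^esub>"
    using assms word_class_eq_iff[of "[i, i]" I "racg_rels I Ed" "[]"]
    by (simp add: racg_def presented_mult one_presented)
qed

lemma racg_gens_commute: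
  assumes ij: "{i, j} \<in> Ed"
  shows "word_class I (racg_rels I Ed) [i] \<otimes>\<^bsub>racg I Ed\<^esub> word_class I (racg_rels I Ed) [j] =
    word_class I (racg_rels I Ed) [j] \<otimes>\<^bsub>racg I Ed\<^esub> word_class I (racg_rels I Ed) [i]" (is "?s \<otimes>\<^bsub>_\<^esub> ?t = _")
proof -
  interpret group "racg I Ed" by (rule group_racg)
  have I: "i \<in> I" "j \<in> I" using ij graph by (auto simp: simplicial_graph_def)
  note rel = racg_gen_relations[OF I(1)] racg_gen_relations[OF I(2)]
  have "word_cong I (racg_rels I Ed) [i, j, i, j] []"
    using I ij wc_rel[of "[i, j, i, j]" "[]" "racg_rels I Ed" I "[]" "[]"] by (auto simp: racg_rels_def)
  then have *: "?s \<otimes>\<^bsub>racg I Ed\<^esub> (?t \<otimes>\<^bsub>racg I Ed\<^esub> (?s \<otimes>\<^bsub>racg I Ed\<^esub> ?t)) = \<one>\<^bsub>racg I Ed\<^esub>"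
    using I word_class_eq_iff[of "[i, j, i, j]" I "racg_rels I Ed" "[]"]
    by (simp add: racg_def presented_mult one_presented)
  have "inv\<^bsub>racg I Ed\<^esub> ?s = ?s" "inv\<^bsub>racg I Ed\<^esub> ?t = ?t"
    using rel by (simp_all add: inv_equality)
  moreover have "inv\<^bsub>racg I Ed\<^esub> (?s \<otimes>\<^bsub>racg I Ed\<^esub> ?t) = ?s \<otimes>\<^bsub>racg I Ed\<^esub> ?t"
    using * rel by (intro inv_equality) (simp_all add: m_assoc)
  ultimately show ?thesis using rel inv_mult_group[of ?s ?t] by simp
qed

lemma spherical_small:
  shows "{} \<in> spherical_subsets I Ed" "i \<in> I \<Longrightarrow> {i} \<in> spherical_subsets I Ed"
    "{i, j} \<in> Ed \<Longrightarrow> {i, j} \<in> spherical_subsets I Ed"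
proof -
  show "{} \<in> spherical_subsets I Ed"
    by (simp add: spherical_subsets_def group.generate_empty[OF group_racg])
  show "{i} \<in> spherical_subsets I Ed" if "i \<in> I"
    using finite_generate_commuting_involutions[OF group_racg racg_gen_relations(1)[OF that] racg_gen_relations(1)[OF that]]
      racg_gen_relations(2)[OF that] that
    by (auto simp: spherical_subsets_def)
  show "{i, j} \<in> spherical_subsets I Ed" if ij: "{i, j} \<in> Ed"
  proof -
    have I: "i \<in> I" "j \<in> I" using ij graph by (auto simp: simplicial_graph_def)
    show ?thesis
      using finite_generate_commuting_involutions[OF group_racg racg_gen_relations(1)[OF I(1)] racg_gen_relations(1)[OF I(2)]]
        racg_gen_relations(2)[OF I(1)] racg_gen_relations(2)[OF I(2)] racg_gens_commute[OF ij] I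
      by (auto simp: spherical_subsets_def)
  qed
qed

text \<open>
  If \<open>i\<close> and \<open>j\<close> are not joined, then \<open>W\<close> acts on the integers with \<open>i\<close> acting by
  \<open>x \<mapsto> -x\<close>, \<open>j\<close> by \<open>x \<mapsto> 1 - x\<close> and all other generators trivially. The product \<open>ji\<close> acts as a
  translation, so it has infinite order.
\<close>

lemma spherical_clique:
  assumes T: "T \<in> spherical_subsets I Ed" and ij: "i \<in> T" "j \<in> T" "i \<noteq> j"
  shows "{i, j} \<in> Ed"
proof (rule ccontr)
  assume nE: "{i, j} \<notin> Ed"
  have I: "i \<in> I" "j \<in> I" using T ij by (auto simp: spherical_subsets_def)
  define act :: "'i \<Rightarrow> int \<Rightarrow> int" where
    "act k x = (if k = i then - x else if k = j then 1 - x else x)" for k x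
  define ev where "ev w = foldr (\<lambda>k f. act k \<circ> f) w id" for w
  have app: "ev (u @ v) = ev u \<circ> ev v" for u v by (induction u) (auto simp: ev_def)
  have rel: "ev u = ev v" if uv: "(u, v) \<in> racg_rels I Ed" for u v
  proof -
    consider k where "u = [k, k]" "v = []" | k l where "{k, l} \<in> Ed" "u = [k, l, k, l]" "v = []"
      using uv by (auto simp: racg_rels_def)
    then show ?thesis
    proof cases
      case 2
      have "{k, l} \<noteq> {i, j}" using 2 nE by auto
      then have "\<not> (k = i \<and> l = j)" "\<not> (k = j \<and> l = i)" by auto
      then show ?thesis using 2 by (auto simp: ev_def act_def fun_eq_iff)
    qed (auto simp: ev_def act_def fun_eq_iff)
  qed
  have cong: "ev u = ev v" if "word_cong I (racg_rels I Ed) u v" for u v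
    using that by (induction rule: word_cong.induct) (auto simp: app rel)
  define w where "w n = concat (replicate n [j, i])" for n
  have wI: "w n \<in> lists I" for n using I by (induction n) (auto simp: w_def)
  have ev_w: "ev (w n) x = x + int n" for n x
  proof (induction n)
    case (Suc n)
    have "w (Suc n) = [j] @ [i] @ w n" by (simp add: w_def)
    then have "ev (w (Suc n)) x = act j (act i (ev (w n) x))" by (simp only: app) (simp add: ev_def)
    then show ?case using ij Suc by (simp add: act_def)
  qed (simp add: w_def ev_def)
  let ?c = "word_class I (racg_rels I Ed)" and ?W = "generate (racg I Ed) ((\<lambda>i. word_class I (racg_rels I Ed) [i]) ` T)"
  have "inj (\<lambda>n. ?c (w n))"
  proof (rule injI)
    fix m n assume "?c (w m) = ?c (w n)"
    then have "ev (w m) 0 = ev (w n) 0" using cong wI by (simp add: word_class_eq_iff)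
    then show "m = n" by (simp add: ev_w)
  qed
  then have "infinite (range (\<lambda>n. ?c (w n)))" by (rule range_inj_infinite)
  moreover have "?c (w n) \<in> ?W" for n
  proof (induction n)
    case 0
    then show ?case using generate.one[of "racg I Ed"] by (simp add: w_def racg_def one_presented)
  next
    case (Suc n)
    have "?c (w (Suc n)) = ?c [j] \<otimes>\<^bsub>racg I Ed\<^esub> (?c [i] \<otimes>\<^bsub>racg I Ed\<^esub> ?c (w n))"
      using I wI by (simp add: racg_def presented_mult w_def)
    moreover have "?c [j] \<in> ?W" "?c [i] \<in> ?W" using ij by (auto intro: generate.incl)
    ultimately show ?case using Suc by (auto intro: generate.eng)
  qed
  then have "range (\<lambda>n. ?c (w n)) \<subseteq> ?W" by blast
  moreover have "finite ?W" using T by (simp add: spherical_subsets_def)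
  ultimately show False using finite_subset by blast
qed

end

section \<open>The Davis chamber\<close>

definition vertex :: "'a set \<Rightarrow> 'a set \<Rightarrow> real" where
  "vertex S = (\<lambda>T. if T = S then 1 else 0)"

definition segment :: "('a set \<Rightarrow> real) \<Rightarrow> ('a set \<Rightarrow> real) \<Rightarrow> real \<Rightarrow> 'a set \<Rightarrow> real" where
  "segment x y t = (\<lambda>S. (1 - t) * x S + t * y S)"

lemma segment_ends [simp]: "segment x y 0 = x" "segment x y 1 = y"
  by (simp_all add: segment_def)

lemma realizationD:
  assumes "x \<in> realization P"
  shows "0 \<le> x S" "S \<notin> P \<Longrightarrow> x S = 0" "(\<Sum>S\<in>P. x S) = 1"
    "x S \<noteq> 0 \<Longrightarrow> x T \<noteq> 0 \<Longrightarrow> S \<subseteq> T \<or> T \<subseteq> S"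
proof -
  note a = assms[unfolded realization_def mem_Collect_eq]
  note x = conjunct1[OF a] conjunct1[OF conjunct2[OF a]]
    conjunct1[OF conjunct2[OF conjunct2[OF a]]] conjunct2[OF conjunct2[OF conjunct2[OF a]]]
  show "0 \<le> x S" by (rule spec[OF x(1)])
  show "S \<notin> P \<Longrightarrow> x S = 0" by (rule mp[OF spec[OF x(2)]])
  show "(\<Sum>S\<in>P. x S) = 1" by (rule x(3))
  show "x S \<noteq> 0 \<Longrightarrow> x T \<noteq> 0 \<Longrightarrow> S \<subseteq> T \<or> T \<subseteq> S"
    by (rule mp[OF spec[OF spec[OF x(4)]]], rule conjI)
qed

lemma vertex_in_realization: "finite P \<Longrightarrow> S \<in> P \<Longrightarrow> vertex S \<in> realization P"
  unfolding realization_def mem_Collect_eq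
proof (intro conjI allI impI)
  assume P: "finite P" "S \<in> P"
  then show "(\<Sum>T\<in>P. vertex S T) = 1" by (simp add: vertex_def)
  show "vertex S T = 0" if "T \<notin> P" for T using P that by (auto simp: vertex_def)
  show "A \<subseteq> B \<or> B \<subseteq> A" if "vertex S A \<noteq> 0 \<and> vertex S B \<noteq> 0" for A B
    using that by (auto simp: vertex_def split: if_splits)
qed (simp add: vertex_def)

lemma segment_in_realization:
  assumes P: "finite P" "S \<in> P" "\<And>T. T \<in> P \<Longrightarrow> S \<subseteq> T" and x: "x \<in> realization P" and t: "t \<in> {0..1}"
  shows "segment (vertex S) x t \<in> realization P"
proof -
  let ?y = "segment (vertex S) x t"
  note x' = realizationD(1-3)[OF x] and chain = realizationD(4)[OF x]
  have "(\<Sum>T\<in>P. ?y T) = (1 - t) * (\<Sum>T\<in>P. vertex S T) + t * (\<Sum>T\<in>P. x T)"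
    by (simp add: segment_def sum.distrib sum_distrib_left)
  also have "(\<Sum>T\<in>P. vertex S T) = 1" using P by (simp add: vertex_def)
  finally have "(\<Sum>T\<in>P. ?y T) = 1" using x'(3) by simp
  moreover have "A \<subseteq> B \<or> B \<subseteq> A" if "?y A \<noteq> 0" "?y B \<noteq> 0" for A B
  proof -
    have "C = S \<or> x C \<noteq> 0" if "?y C \<noteq> 0" for C
      using that by (auto simp: segment_def vertex_def split: if_splits)
    moreover have "S \<subseteq> C" if "x C \<noteq> 0" for C using that x'(2) P(3) by blast
    ultimately show ?thesis using chain that by (metis order_refl)
  qed
  moreover have "0 \<le> ?y T" "T \<notin> P \<Longrightarrow> ?y T = 0" for T
    using x' t P(2) by (auto simp: segment_def vertex_def)
  ultimately show ?thesis by (simp add: realization_def)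
qed

lemma realization_mono_iff:
  assumes "finite P" "Q \<subseteq> P"
  shows "x \<in> realization Q \<longleftrightarrow> x \<in> realization P \<and> (\<forall>S. x S \<noteq> 0 \<longrightarrow> S \<in> Q)"
proof -
  have "(\<Sum>S\<in>Q. x S) = (\<Sum>S\<in>P. x S)" if "\<forall>S. x S \<noteq> 0 \<longrightarrow> S \<in> Q"
    using that assms by (intro sum.mono_neutral_left) auto
  then have *: "x \<in> realization Q \<longleftrightarrow> x \<in> realization P" if "\<forall>S. x S \<noteq> 0 \<longrightarrow> S \<in> Q"
  proof -
    have "(\<forall>S. S \<notin> Q \<longrightarrow> x S = 0) \<and> (\<forall>S. S \<notin> P \<longrightarrow> x S = 0)" using that assms(2) by auto
    then show ?thesis
      using that \<open>_ \<Longrightarrow> sum x Q = sum x P\<close> unfolding realization_def mem_Collect_eq by presburger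
  qed
  have "\<forall>S. x S \<noteq> 0 \<longrightarrow> S \<in> Q" if "x \<in> realization Q"
    using realizationD(2)[OF that] by blast
  then show ?thesis using * by (cases "\<forall>S. x S \<noteq> 0 \<longrightarrow> S \<in> Q") auto
qed

context
  fixes I :: "'i set" and Ed :: "'i set set"
  assumes fin: "finite I" and graph: "simplicial_graph I Ed"
begin

lemma finite_spherical: "finite (spherical_subsets I Ed)"
  by (rule finite_subset[of _ "Pow I"]) (auto simp: spherical_subsets_def fin)

lemma spherical_subset: "T \<in> spherical_subsets I Ed \<Longrightarrow> T \<subseteq> I"
  by (simp add: spherical_subsets_def)

lemma vertex_in_chamber: "T \<in> spherical_subsets I Ed \<Longrightarrow> vertex T \<in> davis_chamber I Ed"
  unfolding davis_chamber_def by (rule vertex_in_realization[OF finite_spherical])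

lemma mirror_iff: "x \<in> mirror I Ed i \<longleftrightarrow> x \<in> davis_chamber I Ed \<and> (\<forall>S. x S \<noteq> 0 \<longrightarrow> i \<in> S)"
proof -
  have "x \<in> davis_chamber I Ed \<Longrightarrow> x S \<noteq> 0 \<Longrightarrow> S \<in> spherical_subsets I Ed" for S
    unfolding davis_chamber_def using realizationD(2)[of x _ S] by auto
  moreover have "x \<in> mirror I Ed i \<longleftrightarrow> x \<in> davis_chamber I Ed \<and>
      (\<forall>S. x S \<noteq> 0 \<longrightarrow> S \<in> {T \<in> spherical_subsets I Ed. i \<in> T})"
    unfolding mirror_def davis_chamber_def
    by (rule realization_mono_iff[OF finite_spherical]) simp
  ultimately show ?thesis by (metis (no_types, lifting) mem_Collect_eq)
qed

lemma segment_in_chamber: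
  "x \<in> davis_chamber I Ed \<Longrightarrow> t \<in> {0..1} \<Longrightarrow> segment (vertex {}) x t \<in> davis_chamber I Ed"
  unfolding davis_chamber_def
  by (rule segment_in_realization[OF finite_spherical spherical_small(1)[OF graph]]) auto

lemma segment_in_mirror:
  "i \<in> I \<Longrightarrow> x \<in> mirror I Ed i \<Longrightarrow> t \<in> {0..1} \<Longrightarrow> segment (vertex {i}) x t \<in> mirror I Ed i"
  unfolding mirror_def
  by (rule segment_in_realization) (simp_all add: finite_spherical spherical_small(2)[OF graph])

text \<open>
  The mirrors through \<open>x\<close> are indexed by the smallest element of the chain supporting \<open>x\<close>.
\<close>

definition mirrors :: "('i set \<Rightarrow> real) \<Rightarrow> 'i set" where
  "mirrors x = {i \<in> I. x \<in> mirror I Ed i}"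

lemma mirrors_le_support: "x S \<noteq> 0 \<Longrightarrow> mirrors x \<subseteq> S"
  unfolding mirrors_def mirror_iff by blast

lemma mirrors_in_support:
  assumes x: "x \<in> davis_chamber I Ed"
  shows "mirrors x \<in> spherical_subsets I Ed" "x (mirrors x) > 0"
proof -
  let ?S = "{S. x S \<noteq> 0}"
  note x' = realizationD[OF x[unfolded davis_chamber_def]]
  note sum = x'(3) and pos = x'(1)
  have sub: "?S \<subseteq> spherical_subsets I Ed"
  proof
    fix S assume "S \<in> ?S"
    then show "S \<in> spherical_subsets I Ed" using x'(2)[of S] by auto
  qed
  have "finite ?S" by (rule finite_subset[OF sub finite_spherical])
  moreover have "?S \<noteq> {}"
  proof
    assume "?S = {}"
    then have "x S = 0" for S by blast
    then show False using sum by simp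
  qed
  ultimately obtain S where S: "S \<in> ?S" "\<And>T. T \<in> ?S \<Longrightarrow> T \<subseteq> S \<Longrightarrow> T = S"
    using finite_has_minimal[of ?S] by (metis (no_types, lifting))
  have "S \<subseteq> T" if "T \<in> ?S" for T
  proof -
    have "S \<subseteq> T \<or> T \<subseteq> S"
      using x'(4)[of S T] S(1) that by simp
    then show ?thesis using S(2)[OF that] by auto
  qed
  then have "mirrors x = S"
    using S(1) sub x spherical_subset by (auto simp: mirrors_def mirror_iff)
  then show "mirrors x \<in> spherical_subsets I Ed" "x (mirrors x) > 0"
    using S(1) sub pos[of S] by auto
qed

lemma mirrors_vertex: "T \<in> spherical_subsets I Ed \<Longrightarrow> mirrors (vertex T) = T"
  using mirrors_in_support(2)[OF vertex_in_chamber, of T] mirrors_le_support[of "vertex T" T]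
  by (auto simp: vertex_def split: if_splits)

lemma vertex_in_mirror: "T \<in> spherical_subsets I Ed \<Longrightarrow> i \<in> T \<Longrightarrow> vertex T \<in> mirror I Ed i"
  using mirrors_vertex by (auto simp: mirrors_def)

end

section \<open>Combinatorial coverings of the product building\<close>

inductive_set residue :: "('i \<Rightarrow> 'c set) \<Rightarrow> ('i \<Rightarrow> 'c \<Rightarrow> 'm \<Rightarrow> 'm) \<Rightarrow> 'i set \<Rightarrow> 'm \<Rightarrow> 'm set"
  for E mv T m where
  residue_base: "m \<in> residue E mv T m"
| residue_step: "n \<in> residue E mv T m \<Longrightarrow> i \<in> T \<Longrightarrow> c \<in> E i \<Longrightarrow> mv i c n \<in> residue E mv T m"

text \<open>
  The point \<open>[m, x]\<close> of the realization, as the set of pairs \<open>(n, x)\<close> with \<open>n\<close> in the residue of \<open>m\<close> whose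
  type consists of the mirrors through \<open>x\<close>. For the product building this is \<open>U_point\<close>.
\<close>

definition cell :: "'i set \<Rightarrow> 'i set set \<Rightarrow> ('i \<Rightarrow> 'c set) \<Rightarrow> ('i \<Rightarrow> 'c \<Rightarrow> 'm \<Rightarrow> 'm) \<Rightarrow> 'm \<Rightarrow> ('i set \<Rightarrow> real)
    \<Rightarrow> ('m \<times> ('i set \<Rightarrow> real)) set" where
  "cell I Ed E mv m x = (\<lambda>n. (n, x)) ` residue E mv (mirrors I Ed x) m"

definition cover_space :: "'i set \<Rightarrow> 'i set set \<Rightarrow> ('i \<Rightarrow> 'c set) \<Rightarrow> 'm set \<Rightarrow> ('i \<Rightarrow> 'c \<Rightarrow> 'm \<Rightarrow> 'm)
    \<Rightarrow> ('m \<times> ('i set \<Rightarrow> real)) set topology" where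
  "cover_space I Ed E M mv =
     quotient_topology (prod_topology (discrete_topology M) (top_of_set (davis_chamber I Ed)))
       (\<lambda>(m, x). cell I Ed E mv m x)"

definition cover_proj :: "('m \<Rightarrow> 'i \<Rightarrow> 'c) \<Rightarrow> ('m \<times> 'a) set \<Rightarrow> (('i \<Rightarrow> 'c) \<times> 'a) set" where
  "cover_proj p S = (\<lambda>(n, x). (p n, x)) ` S"

text \<open>
  \<open>mv i c m\<close> is the unique chamber over \<open>(p m)(i := c)\<close> that is equal or \<open>i\<close>-adjacent to \<open>m\<close>. The laws
  \<open>mv_mv\<close> and \<open>mv_self\<close> say that equality or \<open>i\<close>-adjacency is an equivalence relation whose classes
  project bijectively to \<open>E i\<close>; \<open>mv_commute\<close> says that squares of adjacent types close up.
\<close>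

locale chamber_cover =
  fixes I :: "'i set" and Ed :: "'i set set" and E :: "'i \<Rightarrow> 'c set"
    and M :: "'m set" and p :: "'m \<Rightarrow> 'i \<Rightarrow> 'c" and mv :: "'i \<Rightarrow> 'c \<Rightarrow> 'm \<Rightarrow> 'm"
  assumes finite_I: "finite I" and graph: "simplicial_graph I Ed"
    and proj_in: "m \<in> M \<Longrightarrow> p m \<in> product_building I E"
    and mv_in: "m \<in> M \<Longrightarrow> i \<in> I \<Longrightarrow> c \<in> E i \<Longrightarrow> mv i c m \<in> M"
    and proj_mv: "m \<in> M \<Longrightarrow> i \<in> I \<Longrightarrow> c \<in> E i \<Longrightarrow> p (mv i c m) = (p m)(i := c)"
    and mv_mv: "m \<in> M \<Longrightarrow> i \<in> I \<Longrightarrow> c \<in> E i \<Longrightarrow> d \<in> E i \<Longrightarrow> mv i c (mv i d m) = mv i c m"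
    and mv_self: "m \<in> M \<Longrightarrow> i \<in> I \<Longrightarrow> mv i (p m i) m = m"
    and mv_commute: "m \<in> M \<Longrightarrow> {i, j} \<in> Ed \<Longrightarrow> c \<in> E i \<Longrightarrow> d \<in> E j \<Longrightarrow>
      mv i c (mv j d m) = mv j d (mv i c m)"
begin

abbreviation "res \<equiv> residue E mv"

lemma proj_coord: "m \<in> M \<Longrightarrow> i \<in> I \<Longrightarrow> p m i \<in> E i"
  using proj_in by (fastforce simp: product_building_def PiE_iff)

lemma residue_in:
  assumes "n \<in> res T m" "m \<in> M" "T \<subseteq> I"
  shows "n \<in> M"
  using assms by (induction rule: residue.induct) (auto intro: mv_in)

lemma residue_proj_off:
  assumes "n \<in> res T m" "m \<in> M" "T \<subseteq> I" "j \<notin> T"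
  shows "p n j = p m j"
  using assms
proof (induction rule: residue.induct)
  case (residue_step n i c)
  then have "n \<in> M" "i \<in> I" "j \<noteq> i" using residue_in by auto
  then show ?case using residue_step proj_mv[of n i c] by simp
qed simp

lemma residue_trans: "k \<in> res T n \<Longrightarrow> n \<in> res T m \<Longrightarrow> k \<in> res T m"
  by (induction rule: residue.induct) (auto intro: residue.intros)

lemma residue_mono: "n \<in> res S m \<Longrightarrow> S \<subseteq> T \<Longrightarrow> n \<in> res T m"
  by (induction rule: residue.induct) (auto intro: residue.intros)

lemma residue_sym:
  assumes "n \<in> res T m" "m \<in> M" "T \<subseteq> I"
  shows "m \<in> res T n"
  using assms
proof (induction rule: residue.induct)
  case (residue_step n i c)
  have n: "n \<in> M" "i \<in> I" using residue_step residue_in by blast+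
  then have "p n i \<in> E i" by (rule proj_coord)
  note n = n this
  have "mv i (p n i) (mv i c n) = n" using n residue_step(3) mv_mv mv_self by simp
  moreover have "mv i (p n i) (mv i c n) \<in> res T (mv i c n)"
    using n residue_step(2) by (intro residue.intros)
  ultimately show ?case using residue_step residue_trans by metis
qed (rule residue.intros)

lemma residue_eq:
  assumes "n \<in> res T m" "m \<in> M" "T \<subseteq> I"
  shows "res T n = res T m"
  using assms residue_trans residue_sym by blast

definition moves :: "('i \<Rightarrow> 'c) \<Rightarrow> 'i list \<Rightarrow> 'm \<Rightarrow> 'm" where
  "moves D l m = foldr (\<lambda>i. mv i (D i)) l m"

lemma moves_simps [simp]: "moves D [] m = m" "moves D (i # l) m = mv i (D i) (moves D l m)"
  by (simp_all add: moves_def)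

lemma moves_in_residue:
  assumes "set l \<subseteq> T" "\<And>i. i \<in> T \<Longrightarrow> D i \<in> E i"
  shows "moves D l m \<in> res T m"
  using assms by (induction l) (auto intro: residue.intros)

lemma proj_moves:
  assumes "set l \<subseteq> I" "\<And>i. i \<in> set l \<Longrightarrow> D i \<in> E i" "m \<in> M"
  shows "p (moves D l m) = (\<lambda>j. if j \<in> set l then D j else p m j)"
  using assms
proof (induction l)
  case (Cons i l)
  have "moves D l m \<in> M" using Cons moves_in_residue[of l "set l" D m] residue_in[of _ "set l" m] by auto
  then show ?case using Cons by (auto simp: proj_mv fun_eq_iff)
qed simp

definition clique :: "'i set \<Rightarrow> bool" where
  "clique T \<longleftrightarrow> T \<subseteq> I \<and> (\<forall>i\<in>T. \<forall>j\<in>T. i \<noteq> j \<longrightarrow> {i, j} \<in> Ed)"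

lemma spherical_is_clique: "T \<in> spherical_subsets I Ed \<Longrightarrow> clique T"
  using spherical_clique[OF graph] by (simp add: clique_def spherical_subsets_def)

text \<open>
  Over a clique the moves of different types commute, so a move is absorbed by any later list
  of moves that contains its type.
\<close>

lemma moves_absorb:
  assumes T: "clique T" and l: "set l \<subseteq> T" "\<And>i. i \<in> T \<Longrightarrow> D i \<in> E i"
    and i: "i \<in> T" "c \<in> E i" and n: "n \<in> M"
  shows "if i \<in> set l then moves D l (mv i c n) = moves D l n else moves D l (mv i c n) = mv i c (moves D l n)"
  using l(1)
proof (induction l)
  case (Cons k l)
  have TI: "T \<subseteq> I" using T by (simp add: clique_def)
  have l': "moves D l n \<in> M" using moves_in_residue[of l T D n] residue_in[OF _ n TI] l(2) Cons by auto
  have k: "k \<in> T" "k \<in> I" "i \<in> I" "D k \<in> E k" using Cons TI i l(2) by auto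
  show ?case
  proof (cases "i \<in> set l")
    case True
    then show ?thesis using Cons by simp
  next
    case False
    then have *: "moves D l (mv i c n) = mv i c (moves D l n)" using Cons by simp
    show ?thesis
    proof (cases "i = k")
      case True
      then show ?thesis using * mv_mv[OF l'] k i by simp
    next
      case False
      then have "{k, i} \<in> Ed" using T k i by (auto simp: clique_def)
      then show ?thesis using * False \<open>i \<notin> set l\<close> mv_commute[OF l'] k i by simp
    qed
  qed
qed simp

lemma moves_self:
  assumes "set l \<subseteq> I" "n \<in> M"
  shows "moves (p n) l n = n"
  using assms by (induction l) (auto simp: mv_self)

text \<open>
  If \<open>n\<close> lies in the residue of \<open>m\<close>, then moving all coordinates in \<open>T\<close> to those of a given \<open>D\<close> has
  the same result from \<open>n\<close> as from \<open>m\<close>, because the steps from \<open>m\<close> to \<open>n\<close> are absorbed. For \<open>D = p n\<close>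
  the result from \<open>n\<close> is \<open>n\<close>.
\<close>

lemma clique_residue_inj:
  assumes T: "clique T" and m: "m \<in> M" and n: "n \<in> res T m" "n' \<in> res T m" and eq: "p n = p n'"
  shows "n = n'"
proof -
  have TI: "T \<subseteq> I" using T by (simp add: clique_def)
  then have "finite T" using finite_I finite_subset by blast
  then obtain l where l: "set l = T" using finite_list by blast
  have inv: "moves D l k = moves D l m" if k: "k \<in> res T m" and D: "\<And>i. i \<in> T \<Longrightarrow> D i \<in> E i" for k D
    using k
  proof (induction rule: residue.induct)
    case (residue_step k i c)
    then have "k \<in> M" using residue_in m TI by blast
    then show ?case using moves_absorb[OF T, of l D i c k] l D residue_step by simp
  qed simp
  have M: "n \<in> M" "n' \<in> M" using n residue_in m TI by blast+
  have pE: "p n i \<in> E i" if "i \<in> T" for i using M(1) that TI proj_coord by blast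
  have "n = moves (p n) l n" using moves_self M(1) l TI by simp
  also have "\<dots> = moves (p n) l n'" using inv[OF n(1), of "p n"] inv[OF n(2), of "p n"] pE by simp
  also have "\<dots> = n'" using moves_self M(2) l TI eq by simp
  finally show ?thesis .
qed

lemma residue_lift:
  assumes TI: "T \<subseteq> I" and m: "m \<in> M" and D: "D \<in> product_building I E" "\<And>j. j \<notin> T \<Longrightarrow> D j = p m j"
  shows "\<exists>n\<in>res T m. p n = D"
proof -
  have "finite T" using TI finite_I finite_subset by blast
  then obtain l where l: "set l = T" using finite_list by blast
  have DE: "D i \<in> E i" if "i \<in> T" for i using D(1) TI that by (fastforce simp: product_building_def PiE_iff)
  have "moves D l m \<in> res T m" using l DE by (intro moves_in_residue) auto
  moreover have "p (moves D l m) = D" using proj_moves[of l D m] l TI DE m D(2) by (auto simp: fun_eq_iff)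
  ultimately show ?thesis by blast
qed

lemma proj_surj:
  assumes "m \<in> M" "D \<in> product_building I E"
  shows "\<exists>n\<in>M. p n = D"
proof -
  have "D j = p m j" if "j \<notin> I" for j
    using that assms(2) proj_in[OF assms(1)] by (simp add: product_building_def PiE_iff extensional_def)
  then show ?thesis using residue_lift[of I m D] assms residue_in[of _ I m] by auto
qed

lemma proj_residue:
  assumes TI: "T \<subseteq> I" and m: "m \<in> M"
  shows "p ` res T m = {D \<in> product_building I E. \<forall>j. j \<notin> T \<longrightarrow> D j = p m j}"
  using residue_lift[OF TI m] residue_proj_off[OF _ m TI] proj_in residue_in[OF _ m TI]
  by (auto simp: image_iff)

end

lemma product_building_cover:
  assumes "finite I" "simplicial_graph I Ed"
  shows "chamber_cover I Ed E (product_building I E) (\<lambda>C. C) (\<lambda>i c C. C(i := c))"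
proof (unfold_locales)
  fix m :: "'a \<Rightarrow> 'b" and i j c d assume "{i, j} \<in> Ed"
  then have "j \<noteq> i" using assms(2) by (auto simp: simplicial_graph_def)
  then show "m(j := d, i := c) = m(i := c, j := d)" by (rule fun_upd_twist)
qed (use assms in \<open>auto simp: product_building_def PiE_iff extensional_def\<close>)

section \<open>The realization of a combinatorial covering\<close>

text \<open>
  A product with a discrete space is a disjoint union of slices.
\<close>

lemma openin_prod_discrete:
  "openin (prod_topology (discrete_topology M) T) A \<longleftrightarrow>
     A \<subseteq> M \<times> topspace T \<and> (\<forall>m\<in>M. openin T {x \<in> topspace T. (m, x) \<in> A})"
proof
  assume A: "openin (prod_topology (discrete_topology M) T) A"
  have "openin T {x \<in> topspace T. (m, x) \<in> A}" if "m \<in> M" for m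
  proof -
    have "continuous_map T (prod_topology (discrete_topology M) T) (\<lambda>x. (m, x))"
      using that by (simp add: continuous_map_pairwise o_def)
    then show ?thesis using A unfolding continuous_map_def by blast
  qed
  moreover have "A \<subseteq> M \<times> topspace T" using openin_subset[OF A] by simp
  ultimately show "A \<subseteq> M \<times> topspace T \<and> (\<forall>m\<in>M. openin T {x \<in> topspace T. (m, x) \<in> A})" by simp
next
  assume A: "A \<subseteq> M \<times> topspace T \<and> (\<forall>m\<in>M. openin T {x \<in> topspace T. (m, x) \<in> A})"
  have "A = (\<Union>m\<in>M. {m} \<times> {x \<in> topspace T. (m, x) \<in> A})" using A by auto
  moreover have "openin (prod_topology (discrete_topology M) T) ({m} \<times> {x \<in> topspace T. (m, x) \<in> A})"
    if "m \<in> M" for m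
    using A that by (simp add: openin_prod_Times_iff)
  then have "openin (prod_topology (discrete_topology M) T) (\<Union>m\<in>M. {m} \<times> {x \<in> topspace T. (m, x) \<in> A})"
    by (intro openin_Union) auto
  ultimately show "openin (prod_topology (discrete_topology M) T) A" by simp
qed

lemma openin_quotient_topology:
  "openin (quotient_topology X f) U \<longleftrightarrow> U \<subseteq> f ` topspace X \<and> openin X {x \<in> topspace X. f x \<in> U}"
proof -
  note q = quotient_map_quotient_topology[of X f]
  have "f ` topspace X = topspace (quotient_topology X f)" using q by (simp add: quotient_map_def)
  then show ?thesis using q openin_subset[of "quotient_topology X f" U] unfolding quotient_map_def by metis
qed

lemma topspace_quotient_topology: "topspace (quotient_topology X f) = f ` topspace X"
  using quotient_map_quotient_topology[of X f] by (simp add: quotient_map_def)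

lemma quotient_topology_cong:
  assumes "\<And>x. x \<in> topspace X \<Longrightarrow> f x = g x"
  shows "quotient_topology X f = quotient_topology X g"
proof -
  have "f ` topspace X = g ` topspace X" using assms by simp
  moreover have "{x \<in> topspace X. f x \<in> U} = {x \<in> topspace X. g x \<in> U}" for U using assms by auto
  ultimately show ?thesis by (simp add: topology_eq openin_quotient_topology)
qed

lemma (in chamber_cover) spherical_I: "S \<in> spherical_subsets I Ed \<Longrightarrow> S \<subseteq> I"
  by (simp add: spherical_subsets_def)

lemma (in chamber_cover) mirrors_I: "mirrors I Ed x \<subseteq> I"
  by (auto simp: mirrors_def[OF finite_I graph])

context chamber_cover
begin

abbreviation "K \<equiv> davis_chamber I Ed"
abbreviation "Z \<equiv> cover_space I Ed E M mv"
abbreviation "cl \<equiv> cell I Ed E mv"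

lemma topspace_cover: "topspace Z = {cl m x | m x. m \<in> M \<and> x \<in> K}"
  by (auto simp: cover_space_def topspace_quotient_topology)

lemma openin_cover:
  "openin Z W \<longleftrightarrow> W \<subseteq> topspace Z \<and> (\<forall>m\<in>M. openin (top_of_set K) {x \<in> K. cl m x \<in> W})"
proof -
  have "{x \<in> K. (m, x) \<in> {(m, x). m \<in> M \<and> x \<in> K \<and> cl m x \<in> W}} = {x \<in> K. cl m x \<in> W}" if "m \<in> M" for m
    using that by auto
  moreover have "{x \<in> M \<times> K. (case x of (m, x) \<Rightarrow> cl m x) \<in> W} = {(m, x). m \<in> M \<and> x \<in> K \<and> cl m x \<in> W}"
    by auto
  ultimately show ?thesis
    unfolding cover_space_def openin_quotient_topology openin_prod_discrete topspace_quotient_topology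
    by auto
qed

lemma cell_eq_iff:
  assumes "m \<in> M"
  shows "cl m x = cl n y \<longleftrightarrow> x = y \<and> n \<in> res (mirrors I Ed x) m"
proof
  assume eq: "cl m x = cl n y"
  moreover have "(n, y) \<in> cl n y" by (auto simp: cell_def intro: residue.intros)
  ultimately show "x = y \<and> n \<in> res (mirrors I Ed x) m" by (auto simp: cell_def)
next
  assume "x = y \<and> n \<in> res (mirrors I Ed x) m"
  then have "x = y" "res (mirrors I Ed y) n = res (mirrors I Ed y) m"
    using residue_eq[OF _ assms mirrors_I] by blast+
  then show "cl m x = cl n y" by (simp add: cell_def)
qed

lemma continuous_cell: "m \<in> M \<Longrightarrow> continuous_map (top_of_set K) Z (cl m)"
  by (auto simp: continuous_map_def openin_cover topspace_cover)

text \<open>The open star of the vertex of the residue of type \<open>S\<close> through \<open>m\<close>.\<close>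

definition star :: "'i set \<Rightarrow> 'm \<Rightarrow> ('m \<times> ('i set \<Rightarrow> real)) set set" where
  "star S m = {cl n x | n x. n \<in> res S m \<and> x \<in> K \<and> x S > 0}"

text \<open>
  Membership in a star does not depend on the chamber that represents the point: where \<open>x S > 0\<close>,
  every mirror through \<open>x\<close> has its index in \<open>S\<close>.
\<close>

lemma cell_in_star_iff:
  assumes S: "S \<subseteq> I" and m: "m \<in> M" and n: "n \<in> M"
  shows "cl n x \<in> star S m \<longleftrightarrow> n \<in> res S m \<and> x \<in> K \<and> x S > 0"
proof
  assume "cl n x \<in> star S m"
  then obtain k where k: "k \<in> res S m" "x \<in> K" "x S > 0" "k \<in> res (mirrors I Ed x) n"
    by (auto simp: star_def cell_eq_iff[OF n])
  have "mirrors I Ed x \<subseteq> S" using k mirrors_le_support[OF finite_I graph, of x S] by simp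
  then have "k \<in> res S n" using k(4) residue_mono by blast
  then have "n \<in> res S k" using residue_sym n S by blast
  then show "n \<in> res S m \<and> x \<in> K \<and> x S > 0" using k residue_trans by blast
qed (auto simp: star_def)

lemma open_support: "openin (top_of_set K) {x \<in> K. x S > 0}"
proof -
  have "open {x::'i set \<Rightarrow> real. 0 < x S}"
    by (rule open_Collect_less) auto
  moreover have "{x \<in> K. x S > 0} = K \<inter> {x. 0 < x S}" by auto
  ultimately show ?thesis by (simp add: openin_open_Int)
qed

lemma openin_star:
  assumes S: "S \<subseteq> I" and m: "m \<in> M"
  shows "openin Z (star S m)"
  unfolding openin_cover
proof
  show "star S m \<subseteq> topspace Z" using residue_in[OF _ m S] by (auto simp: star_def topspace_cover)
  show "\<forall>n\<in>M. openin (top_of_set K) {x \<in> K. cl n x \<in> star S m}"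
  proof
    fix n assume n: "n \<in> M"
    show "openin (top_of_set K) {x \<in> K. cl n x \<in> star S m}"
    proof (cases "n \<in> res S m")
      case True
      then have "{x \<in> K. cl n x \<in> star S m} = {x \<in> K. x S > 0}" using cell_in_star_iff[OF S m n] by auto
      then show ?thesis using open_support by simp
    next
      case False
      then have "{x \<in> K. cl n x \<in> star S m} = {}" using cell_in_star_iff[OF S m n] by auto
      then show ?thesis by (simp only: openin_empty)
    qed
  qed
qed

lemma star_eq:
  assumes "S \<subseteq> I" "m \<in> M" "n \<in> res S m"
  shows "star S n = star S m"
  using residue_eq[OF assms(3,2,1)] by (simp add: star_def)

lemma stars_disjoint:
  assumes S: "S \<subseteq> I" and m: "m \<in> M" "m' \<in> M" and ne: "star S m \<noteq> star S m'"
  shows "disjnt (star S m) (star S m')"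
proof (rule ccontr)
  assume "\<not> disjnt (star S m) (star S m')"
  then obtain n x where n: "n \<in> res S m" "cl n x \<in> star S m'" by (auto simp: disjnt_def star_def)
  have nM: "n \<in> M" using residue_in[OF n(1) m(1) S] .
  then have "n \<in> res S m'" using cell_in_star_iff[OF S m(2) nM] n(2) by simp
  then show False using n(1) star_eq S m ne by metis
qed

end

text \<open>
  The generators indexed by \<open>T\<close> generate the elements of \<open>prod_Z2 I\<close> with support in \<open>T\<close>.
\<close>

lemma chamber_dist_generate:
  assumes fin: "finite I" and T: "T \<subseteq> I"
  shows "chamber_dist I C D \<in> generate (prod_Z2 I) (prod_Z2_gen I ` T) \<longleftrightarrow> (\<forall>j\<in>I - T. D j = C j)"
proof
  assume "chamber_dist I C D \<in> generate (prod_Z2 I) (prod_Z2_gen I ` T)"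
  then have "\<forall>j\<in>I - T. chamber_dist I C D j = 0"
  proof (induction rule: generate.induct)
    case (inv h)
    then obtain i where i: "i \<in> T" "h = prod_Z2_gen I i" by auto
    have "h \<in> carrier (prod_Z2 I)" using i by (auto simp: prod_Z2_def prod_Z2_gen_def carrier_integer_mod_group)
    then have "inv\<^bsub>prod_Z2 I\<^esub> h = (\<lambda>i\<in>I. inv\<^bsub>integer_mod_group 2\<^esub> (h i))"
      unfolding prod_Z2_def by (intro inv_product_group) auto
    then show ?case using i monoid.inv_one[OF group.is_monoid[OF group_integer_mod_group], of 2] by (auto simp: prod_Z2_gen_def)
  qed (auto simp: prod_Z2_def prod_Z2_gen_def mult_integer_mod_group)
  then show "\<forall>j\<in>I - T. D j = C j" by (auto simp: chamber_dist_def rank_one_dist_def split: if_splits)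
next
  assume eq: "\<forall>j\<in>I - T. D j = C j"
  have "finite S \<Longrightarrow> S \<subseteq> T \<Longrightarrow>
      (\<lambda>i\<in>I. if i \<in> S then 1 else 0) \<in> generate (prod_Z2 I) (prod_Z2_gen I ` T)" for S
  proof (induction rule: finite_induct)
    case empty
    have "\<one>\<^bsub>prod_Z2 I\<^esub> = (\<lambda>i\<in>I. if i \<in> {} then 1 else 0)" by (simp add: prod_Z2_def fun_eq_iff)
    then show ?case using generate.one[of "prod_Z2 I"] by metis
  next
    case (insert i S)
    have "(\<lambda>k\<in>I. if k \<in> insert i S then 1 else 0) =
        prod_Z2_gen I i \<otimes>\<^bsub>prod_Z2 I\<^esub> (\<lambda>i\<in>I. if i \<in> S then 1 else 0)"
      using insert by (auto simp: prod_Z2_def prod_Z2_gen_def mult_integer_mod_group fun_eq_iff)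
    moreover have "prod_Z2_gen I i \<in> generate (prod_Z2 I) (prod_Z2_gen I ` T)"
      using insert.prems by (intro generate.incl) simp
    moreover have "(\<lambda>i\<in>I. if i \<in> S then 1 else 0) \<in> generate (prod_Z2 I) (prod_Z2_gen I ` T)"
      using insert by blast
    ultimately show ?case using generate.eng by metis
  qed
  from this[of "{i \<in> T. C i \<noteq> D i}"] have
    "(\<lambda>i\<in>I. if i \<in> {i \<in> T. C i \<noteq> D i} then 1 else 0) \<in> generate (prod_Z2 I) (prod_Z2_gen I ` T)"
    using finite_subset[of "{i \<in> T. C i \<noteq> D i}" I] fin T by blast
  moreover have "(\<lambda>i\<in>I. if i \<in> {i \<in> T. C i \<noteq> D i} then 1 else 0) = chamber_dist I C D"
    using eq by (auto simp: chamber_dist_def rank_one_dist_def fun_eq_iff)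
  ultimately show "chamber_dist I C D \<in> generate (prod_Z2 I) (prod_Z2_gen I ` T)" by simp
qed

lemma base_cell:
  assumes fin: "finite I" and graph: "simplicial_graph I Ed" and C: "C \<in> product_building I E" and x: "x \<in> davis_chamber I Ed"
  shows "cell I Ed E (\<lambda>i c C. C(i := c)) C x = U_point I Ed E C x"
proof -
  interpret base: chamber_cover I Ed E "product_building I E" "\<lambda>C. C" "\<lambda>i c C. C(i := c)"
    by (rule product_building_cover[OF fin graph])
  let ?T = "mirrors I Ed x"
  have T: "?T \<subseteq> I" "{i \<in> I. x \<in> mirror I Ed i} = ?T"
    by (auto simp: mirrors_def[OF fin graph])
  have res: "residue E (\<lambda>i c C. C(i := c)) ?T C = {D \<in> product_building I E. \<forall>j. j \<notin> ?T \<longrightarrow> D j = C j}"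
    using base.proj_residue[OF T(1) C] by simp
  have "chamber_dist I C D \<in> generate (prod_Z2 I) (prod_Z2_gen I ` ?T) \<longleftrightarrow> (\<forall>j. j \<notin> ?T \<longrightarrow> D j = C j)"
    if D: "D \<in> product_building I E" for D
  proof -
    have "D j = C j" if "j \<notin> I" for j
      using that C D by (simp add: product_building_def PiE_iff extensional_def)
    then show ?thesis using chamber_dist_generate[OF fin T(1), of C D] by blast
  qed
  then have "U_point I Ed E C x = {(D, x) | D. D \<in> product_building I E \<and> (\<forall>j. j \<notin> ?T \<longrightarrow> D j = C j)}"
    using C x by (simp add: U_point_def glue_rel_def T(2) Image_singleton) blast
  then show ?thesis by (auto simp: cell_def res)
qed

lemma U_space_eq:
  assumes fin: "finite I" and graph: "simplicial_graph I Ed"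
  shows "U_space I Ed E = cover_space I Ed E (product_building I E) (\<lambda>i c C. C(i := c))"
  unfolding U_space_def cover_space_def
  by (rule quotient_topology_cong) (auto simp: base_cell[OF fin graph])

context chamber_cover
begin

abbreviation "\<pi> \<equiv> cover_proj p"

interpretation base: chamber_cover I Ed E "product_building I E" "\<lambda>C. C" "\<lambda>i c C. C(i := c)"
  by (rule product_building_cover[OF finite_I graph])

lemma residue_base: "T \<subseteq> I \<Longrightarrow> m \<in> M \<Longrightarrow> base.res T (p m) = p ` res T m"
  using proj_residue base.proj_residue proj_in by simp

lemma cover_proj_cell:
  assumes m: "m \<in> M" and x: "x \<in> K"
  shows "\<pi> (cl m x) = U_point I Ed E (p m) x"
proof -
  have "\<pi> (cl m x) = (\<lambda>n. (n, x)) ` p ` res (mirrors I Ed x) m"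
    by (simp add: cover_proj_def cell_def image_image)
  also have "p ` res (mirrors I Ed x) m = base.res (mirrors I Ed x) (p m)"
    using proj_residue[OF mirrors_I m] base.proj_residue[OF mirrors_I proj_in[OF m]] by simp
  finally show ?thesis using base_cell[OF finite_I graph proj_in[OF m] x] by (simp add: cell_def)
qed

lemma cover_proj_base_cell: "m \<in> M \<Longrightarrow> x \<in> K \<Longrightarrow> \<pi> (cl m x) = base.cl (p m) x"
  using cover_proj_cell base_cell[OF finite_I graph proj_in] by simp

lemma continuous_cover_proj: "continuous_map Z base.Z \<pi>"
  unfolding continuous_map_def
proof (intro conjI allI impI)
  show "\<pi> \<in> topspace Z \<rightarrow> topspace base.Z"
    using proj_in by (fastforce simp: topspace_cover base.topspace_cover cover_proj_base_cell)
  fix V assume V: "openin base.Z V"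
  have "openin (top_of_set K) {x \<in> K. cl m x \<in> {z \<in> topspace Z. \<pi> z \<in> V}}" if m: "m \<in> M" for m
  proof -
    have "{x \<in> K. cl m x \<in> {z \<in> topspace Z. \<pi> z \<in> V}} = {x \<in> K. base.cl (p m) x \<in> V}"
      using m by (auto simp: topspace_cover cover_proj_base_cell)
    then show ?thesis using V proj_in[OF m] by (simp add: base.openin_cover)
  qed
  then show "openin Z {z \<in> topspace Z. \<pi> z \<in> V}" unfolding openin_cover by blast
qed

text \<open>
  A clique residue maps bijectively to the residue below it, so its star does; the map is open since a subset
  of the star has, in each chamber of \<open>E\<close>, the same trace as in the one chamber above it.
\<close>

lemma star_homeomorphic:
  assumes S: "S \<in> spherical_subsets I Ed" and m: "m \<in> M"
  shows "homeomorphic_map (subtopology Z (star S m)) (subtopology base.Z (base.star S (p m))) \<pi>"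
proof -
  have SI: "S \<subseteq> I" using S by (rule spherical_I)
  have cS: "clique S" using S by (rule spherical_is_clique)
  note pm = proj_in[OF m]
  have res: "n \<in> M" "p n \<in> base.res S (p m)" if "n \<in> res S m" for n
    using residue_in[OF that m SI] that proj_residue[OF SI m] base.proj_residue[OF SI pm] by auto
  have lift: "\<exists>n\<in>res S m. p n = D" if "D \<in> base.res S (p m)" for D
    using that unfolding residue_base[OF SI m] by blast
  have oZ: "openin Z (star S m)" and oB: "openin base.Z (base.star S (p m))"
    using openin_star[OF SI m] base.openin_star[OF SI pm] .
  have ts: "topspace (subtopology Z (star S m)) = star S m"
      "topspace (subtopology base.Z (base.star S (p m))) = base.star S (p m)"
    using openin_subset[OF oZ] openin_subset[OF oB] by auto
  have img: "\<pi> ` star S m = base.star S (p m)"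
  proof
    show "\<pi> ` star S m \<subseteq> base.star S (p m)"
    proof
      fix w assume "w \<in> \<pi> ` star S m"
      then obtain n x where n: "n \<in> res S m" "x \<in> K" "x S > 0" "w = \<pi> (cl n x)"
        by (auto simp: star_def)
      then have "w = base.cl (p n) x" using res by (simp add: cover_proj_base_cell)
      then show "w \<in> base.star S (p m)" using n res unfolding base.star_def by blast
    qed
    show "base.star S (p m) \<subseteq> \<pi> ` star S m"
    proof
      fix w assume "w \<in> base.star S (p m)"
      then obtain D x where w: "w = base.cl D x" "D \<in> base.res S (p m)" "x \<in> K" "x S > 0"
        by (auto simp: base.star_def)
      obtain n where n: "n \<in> res S m" "p n = D" using lift w(2) by blast
      then have "w = \<pi> (cl n x)" "cl n x \<in> star S m"
        using w res(1)[OF n(1)] by (auto simp: cover_proj_base_cell star_def)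
      then show "w \<in> \<pi> ` star S m" by blast
    qed
  qed
  have inj: "inj_on \<pi> (star S m)"
  proof (rule inj_onI)
    fix w w' assume "w \<in> star S m" "w' \<in> star S m" and eq: "\<pi> w = \<pi> w'"
    then obtain n x n' x' where w: "w = cl n x" "n \<in> res S m" "x \<in> K" "x S > 0"
      and w': "w' = cl n' x'" "n' \<in> res S m" "x' \<in> K" by (auto simp: star_def)
    have M: "n \<in> M" "n' \<in> M" using res w w' by auto
    have "x = x'" and r: "p n' \<in> base.res (mirrors I Ed x) (p n)"
      using eq w w' M by (auto simp: cover_proj_base_cell base.cell_eq_iff[OF proj_in])
    obtain k where k: "k \<in> res (mirrors I Ed x) n" "p k = p n'"
      using r unfolding residue_base[OF mirrors_I M(1)] by fastforce
    have "mirrors I Ed x \<subseteq> S" using w(4) mirrors_le_support[OF finite_I graph, of x S] by simp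
    then have "k \<in> res S m" using residue_trans[OF residue_mono[OF k(1)]] w(2) by blast
    then have "k = n'" using clique_residue_inj[OF cS m _ w'(2) k(2)] by blast
    then show "w = w'" using w w' k \<open>x = x'\<close> by (simp add: cell_eq_iff[OF M(1)])
  qed
  have "open_map Z' base.Z \<pi>" if "Z' = subtopology Z (star S m)" for Z'
    unfolding open_map_def
  proof (intro allI impI)
    fix W assume "openin Z' W"
    then have W: "openin Z W" "W \<subseteq> star S m"
      using openin_open_subtopology[OF oZ] that by auto
    have "openin (top_of_set K) {x \<in> K. base.cl D x \<in> \<pi> ` W}" if D: "D \<in> product_building I E" for D
    proof (cases "D \<in> base.res S (p m)")
      case True
      then obtain n where n: "n \<in> res S m" "p n = D" using lift by blast
      have nM: "n \<in> M" using res n by blast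
      have "base.cl D x \<in> \<pi> ` W \<longleftrightarrow> cl n x \<in> W" if x: "x \<in> K" for x
      proof
        assume "cl n x \<in> W"
        then show "base.cl D x \<in> \<pi> ` W" using cover_proj_base_cell[OF nM x] n by (metis imageI)
      next
        assume "base.cl D x \<in> \<pi> ` W"
        then obtain w where w: "w \<in> W" "base.cl D x = \<pi> w" by blast
        then have "base.cl D x \<in> base.star S (p m)" using img W(2) by blast
        then have "x S > 0" using base.cell_in_star_iff[OF SI pm D] by blast
        then have "cl n x \<in> star S m" using n x by (auto simp: star_def)
        moreover have "\<pi> (cl n x) = \<pi> w" using cover_proj_base_cell[OF nM x] n w by simp
        ultimately have "cl n x = w" using inj W(2) w(1) by (auto dest: inj_onD)
        then show "cl n x \<in> W" using w by simp
      qed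
      then have "{x \<in> K. base.cl D x \<in> \<pi> ` W} = {x \<in> K. cl n x \<in> W}" by auto
      then show ?thesis using W(1) nM by (simp add: openin_cover)
    next
      case False
      have "base.cl D x \<notin> \<pi> ` W" for x
        using False base.cell_in_star_iff[OF SI pm D] img W(2) by blast
      then show ?thesis by simp
    qed
    moreover have "\<pi> ` W \<subseteq> topspace base.Z" using img W(2) openin_subset[OF oB] by blast
    ultimately show "openin base.Z (\<pi> ` W)" by (simp add: base.openin_cover)
  qed
  then have "open_map (subtopology Z (star S m)) (subtopology base.Z (base.star S (p m))) \<pi>"
    using img by (intro open_map_into_subtopology) (auto simp: ts)
  moreover have "continuous_map (subtopology Z (star S m)) (subtopology base.Z (base.star S (p m))) \<pi>"
    using img by (auto simp: continuous_map_in_subtopology intro: continuous_map_from_subtopology continuous_cover_proj)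
  ultimately show ?thesis
    by (intro bijective_open_imp_homeomorphic_map) (simp_all only: ts img inj)
qed

text \<open>
  The open star of the smallest face containing a point is evenly covered: its preimage is the disjoint
  union of the open stars of the residues above, and residues of clique type map bijectively.
\<close>

theorem covering_cover_proj:
  assumes "m0 \<in> M"
  shows "covering_map Z (U_space I Ed E) \<pi>"
  unfolding covering_map_def U_space_eq[OF finite_I graph]
proof (intro conjI ballI continuous_cover_proj)
  show "\<pi> ` topspace Z = topspace base.Z"
  proof
    show "\<pi> ` topspace Z \<subseteq> topspace base.Z" using continuous_cover_proj by (auto simp: continuous_map_def)
    show "topspace base.Z \<subseteq> \<pi> ` topspace Z"
    proof
      fix w assume "w \<in> topspace base.Z"
      then obtain D x where w: "w = base.cl D x" "D \<in> product_building I E" "x \<in> K"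
        by (auto simp: base.topspace_cover)
      obtain n where "n \<in> M" "p n = D" using proj_surj[OF assms w(2)] by blast
      then have "w = \<pi> (cl n x)" "cl n x \<in> topspace Z" using w by (auto simp: cover_proj_base_cell topspace_cover)
      then show "w \<in> \<pi> ` topspace Z" by blast
    qed
  qed
  fix y assume "y \<in> topspace base.Z"
  then obtain C x where y: "y = base.cl C x" "C \<in> product_building I E" "x \<in> K"
    by (auto simp: base.topspace_cover)
  let ?S = "mirrors I Ed x"
  have S: "?S \<in> spherical_subsets I Ed" "x ?S > 0" using mirrors_in_support[OF finite_I graph y(3)] .
  note SI = spherical_I[OF S(1)]
  let ?\<V> = "{star ?S m | m. m \<in> M \<and> p m = C}"
  have "\<Union>?\<V> = {z \<in> topspace Z. \<pi> z \<in> base.star ?S C}"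
  proof
    show "\<Union>?\<V> \<subseteq> {z \<in> topspace Z. \<pi> z \<in> base.star ?S C}"
    proof clarify
      fix w m assume m: "m \<in> M" "w \<in> star ?S m" "C = p m"
      have "w \<in> topspace Z" using openin_subset[OF openin_star[OF SI m(1)]] m(2) by blast
      moreover have "\<pi> w \<in> base.star ?S (p m)"
        using homeomorphic_imp_surjective_map[OF star_homeomorphic[OF S(1) m(1)]] m(2) calculation
        by auto
      ultimately show "w \<in> topspace Z \<and> \<pi> w \<in> base.star ?S (p m)" by simp
    qed
    show "{z \<in> topspace Z. \<pi> z \<in> base.star ?S C} \<subseteq> \<Union>?\<V>"
    proof clarify
      fix z assume z: "z \<in> topspace Z" "\<pi> z \<in> base.star ?S C"
      then obtain n u where n: "z = cl n u" "n \<in> M" "u \<in> K" by (auto simp: topspace_cover)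
      then have "p n \<in> base.res ?S C" "u ?S > 0"
        using z(2) base.cell_in_star_iff[OF SI y(2) proj_in[OF n(2)]] by (auto simp: cover_proj_base_cell)
      then have "C \<in> base.res ?S (p n)" using base.residue_sym y(2) SI by blast
      then obtain m where m: "m \<in> res ?S n" "p m = C"
        unfolding residue_base[OF SI n(2)] by blast
      have "m \<in> M" "n \<in> res ?S m" using residue_in residue_sym m(1) n(2) SI by blast+
      then have "z \<in> star ?S m" using n \<open>u ?S > 0\<close> by (auto simp: star_def)
      then show "z \<in> \<Union>?\<V>" using \<open>m \<in> M\<close> m(2) by blast
    qed
  qed
  moreover have "\<forall>U\<in>?\<V>. openin Z U" using openin_star[OF SI] by blast
  moreover have "pairwise disjnt ?\<V>" using stars_disjoint[OF SI] by (auto simp: pairwise_def)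
  moreover have "\<forall>U\<in>?\<V>. homeomorphic_map (subtopology Z U) (subtopology base.Z (base.star ?S C)) \<pi>"
    using star_homeomorphic[OF S(1)] by blast
  moreover have "openin base.Z (base.star ?S C)" using base.openin_star[OF SI y(2)] .
  moreover have "y \<in> base.star ?S C" using y S(2) by (auto simp: base.star_def intro: residue.intros)
  ultimately show "\<exists>V. openin base.Z V \<and> y \<in> V \<and> (\<exists>\<V>. \<Union>\<V> = {z \<in> topspace Z. \<pi> z \<in> V} \<and>
      (\<forall>U\<in>\<V>. openin Z U) \<and> pairwise disjnt \<V> \<and>
      (\<forall>U\<in>\<V>. homeomorphic_map (subtopology Z U) (subtopology base.Z V) \<pi>))"
    by (intro exI[of _ "base.star ?S C"] exI[of _ ?\<V>] conjI)
qed

end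

section \<open>The chambers of the universal cover\<close>

lemma continuous_on_segment: "continuous_on A (segment x y)"
  unfolding segment_def by (intro continuous_on_coordinatewise_then_product continuous_intros)

lemma pathin_segment:
  assumes "\<And>t. t \<in> {0..1} \<Longrightarrow> segment x y t \<in> A"
  shows "pathin (top_of_set A) (segment x y)"
  using assms by (auto simp: pathin_def continuous_map_in_subtopology continuous_on_segment)

lemma continuous_map_cone:
  assumes "\<And>x t. x \<in> A \<Longrightarrow> t \<in> {0..1} \<Longrightarrow> segment v x t \<in> A"
  shows "continuous_map (prod_topology (top_of_set A) (top_of_set {0..1})) (top_of_set A) (\<lambda>(x, t). segment v x t)"
proof -
  have "continuous_on (A \<times> {0..1}) (\<lambda>z. segment v (fst z) (snd z))"
    unfolding segment_def
    by (intro continuous_on_coordinatewise_then_product continuous_intros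
        continuous_on_product_then_coordinatewise[OF continuous_on_fst[OF continuous_on_id]])
  then show ?thesis using assms by (auto simp: continuous_map_in_subtopology split_beta)
qed

locale universal_cover_of_U =
  fixes I :: "'i set" and Ed :: "'i set set" and E :: "'i \<Rightarrow> 'c set"
    and X :: "'x topology" and q :: "'x \<Rightarrow> (('i \<Rightarrow> 'c) \<times> ('i set \<Rightarrow> real)) set"
  assumes finite_I: "finite I" and graph: "simplicial_graph I Ed"
    and univ: "universal_cover X (U_space I Ed E) q"
begin

abbreviation "K \<equiv> davis_chamber I Ed"
abbreviation "PB \<equiv> product_building I E"
abbreviation "Y \<equiv> U_space I Ed E"
abbreviation "pt \<equiv> U_point I Ed E"
abbreviation "chambers \<equiv> graph_product_building I Ed E X q"
abbreviation "v0 \<equiv> vertex {} :: 'i set \<Rightarrow> real"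
abbreviation "is_lift \<equiv> chamber_lift I Ed E X q"
abbreviation "pr \<equiv> building_proj I Ed E X q"

interpretation base: chamber_cover I Ed E "product_building I E" "\<lambda>C. C" "\<lambda>i c C. C(i := c)"
  by (rule product_building_cover[OF finite_I graph])

lemma covering: "covering_map X Y q" and simply_connected: "simply_connected_space X"
  using univ by (simp_all add: universal_cover_def)

lemma path_connected: "path_connected_space X"
  using simply_connected by (simp add: simply_connected_space_def)

lemma continuous_q: "continuous_map X Y q" and q_surj: "q ` topspace X = topspace Y"
  using covering by (simp_all add: covering_map_def)

lemma pt_eq_iff:
  assumes "C \<in> PB" "D \<in> PB" "x \<in> K" "y \<in> K"
  shows "pt C x = pt D y \<longleftrightarrow> x = y \<and> (\<forall>j. j \<notin> mirrors I Ed x \<longrightarrow> D j = C j)"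
  using base.cell_eq_iff[OF assms(1), of x D y] base.proj_residue[OF base.mirrors_I assms(1), of x] assms
  by (simp add: base_cell[OF finite_I graph])

lemma pt_in: "C \<in> PB \<Longrightarrow> x \<in> K \<Longrightarrow> pt C x \<in> topspace Y"
  using base_cell[OF finite_I graph, of C E x]
  by (auto simp: U_space_eq[OF finite_I graph] base.topspace_cover)

lemma continuous_pt:
  assumes "C \<in> PB"
  shows "continuous_map (top_of_set K) Y (pt C)"
  unfolding U_space_eq[OF finite_I graph]
  by (rule continuous_map_eq[OF base.continuous_cell[OF assms]])
    (simp add: base_cell[OF finite_I graph assms])

lemma vertex_K: "T \<in> spherical_subsets I Ed \<Longrightarrow> vertex T \<in> K"
  by (rule vertex_in_chamber[OF finite_I graph])

lemma v0_K: "v0 \<in> K" using vertex_K spherical_small(1)[OF graph] by blast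

lemma mirrors_v0: "mirrors I Ed v0 = {}"
  using mirrors_vertex[OF finite_I graph spherical_small(1)[OF graph]] .

lemma vi_K: "i \<in> I \<Longrightarrow> vertex {i} \<in> K" using vertex_K spherical_small(2)[OF graph] by blast

lemma vi_mirror: "i \<in> I \<Longrightarrow> vertex {i} \<in> mirror I Ed i"
  using vertex_in_mirror[OF finite_I graph] spherical_small(2)[OF graph] by blast

lemma mirrors_vi: "i \<in> I \<Longrightarrow> mirrors I Ed (vertex {i}) = {i}"
  using mirrors_vertex[OF finite_I graph] spherical_small(2)[OF graph] by blast

lemma mirror_K: "x \<in> mirror I Ed i \<Longrightarrow> x \<in> K"
  by (simp add: mirror_iff[OF finite_I graph])

lemma in_mirrors: "i \<in> I \<Longrightarrow> x \<in> mirror I Ed i \<Longrightarrow> i \<in> mirrors I Ed x"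
  by (simp add: mirrors_def[OF finite_I graph])

lemma segment_K: "x \<in> K \<Longrightarrow> t \<in> {0..1} \<Longrightarrow> segment v0 x t \<in> K"
  by (rule segment_in_chamber[OF finite_I graph])

text \<open>
  Along a segment inside \<open>K\<close>, agreement spreads by uniqueness of path lifts.
\<close>

lemma agree_along_segment:
  assumes fg: "continuous_map (top_of_set K) X f" "continuous_map (top_of_set K) X g"
    and seg: "\<And>t. t \<in> {0..1} \<Longrightarrow> segment x y t \<in> K \<and> q (f (segment x y t)) = q (g (segment x y t))"
  shows "f x = g x \<longleftrightarrow> f y = g y"
proof -
  have s: "pathin (top_of_set K) (segment x y)" using seg by (intro pathin_segment) blast
  have P: "pathin X (\<lambda>t. f (segment x y t))" "pathin X (\<lambda>t. g (segment x y t))"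
    using pathin_compose[OF s fg(1)] pathin_compose[OF s fg(2)] by (simp_all add: o_def)
  have *: "f (segment x y b) = g (segment x y b)" if "f (segment x y a) = g (segment x y a)" "a \<in> {0..1}" "b \<in> {0..1}" for a b
    using path_lift_unique[OF covering P, of a b] seg that by simp
  show ?thesis using *[of 0 1] *[of 1 0] by auto
qed

lemma is_liftD:
  assumes "is_lift C f"
  shows "C \<in> PB" "continuous_map (top_of_set K) X f" "x \<in> K \<Longrightarrow> q (f x) = pt C x"
  using assms by (simp_all add: chamber_lift_def)

lemma is_lift_unique:
  assumes f: "is_lift C f" and g: "is_lift C g" and x: "x \<in> K" "f x = g x" and y: "y \<in> K"
  shows "f y = g y"
proof -
  have *: "f v0 = g v0 \<longleftrightarrow> f z = g z" if "z \<in> K" for z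
    using that by (intro agree_along_segment is_liftD(2)[OF f] is_liftD(2)[OF g])
      (simp add: segment_K is_liftD(3)[OF f] is_liftD(3)[OF g])
  show ?thesis using *[OF x(1)] *[OF y] x(2) by simp
qed

text \<open>
  The Davis chamber is a cone with apex the vertex \<open>{}\<close>, so the homotopy lifting property,
  applied to the contraction, lifts a chamber from a lift of its apex.
\<close>

lemma is_lift_exists_apex:
  assumes C: "C \<in> PB" and a: "a \<in> topspace X" "q a = pt C v0"
  shows "\<exists>f. is_lift C f \<and> f v0 = a"
proof -
  let ?h = "pt C \<circ> (\<lambda>(x, t). segment v0 x t)"
  have "continuous_map (prod_topology (top_of_set K) (top_of_set {0..1})) Y ?h"
    by (rule continuous_map_compose[OF continuous_map_cone continuous_pt[OF C]]) (rule segment_K)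
  moreover have "continuous_map (top_of_set K) X (\<lambda>_. a)" using a by simp
  moreover have "q a = ?h (x, 0)" for x using a by simp
  ultimately have "\<exists>g. continuous_map (prod_topology (top_of_set K) (top_of_set {0..1})) X g \<and>
      (\<forall>x\<in>topspace (top_of_set K). g (x, 0) = a) \<and>
      (\<forall>x\<in>topspace (top_of_set K). \<forall>s\<in>{0..1}. q (g (x, s)) = ?h (x, s))"
    by (intro covering_homotopy_lifting[OF covering])
  then obtain g where g: "continuous_map (prod_topology (top_of_set K) (top_of_set {0..1})) X g"
      "\<forall>x\<in>topspace (top_of_set K). g (x, 0) = a"
      "\<forall>x\<in>topspace (top_of_set K). \<forall>s\<in>{0..1}. q (g (x, s)) = ?h (x, s)"
    by (elim exE conjE)
  have "continuous_map (top_of_set K) (prod_topology (top_of_set K) (top_of_set {0..1})) (\<lambda>x. (x, 1::real))"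
    by (simp add: continuous_map_pairwise o_def continuous_map_id[unfolded id_def] continuous_on_id continuous_on_const continuous_on_Pair)
  from continuous_map_compose[OF this g(1)] have "continuous_map (top_of_set K) X (\<lambda>x. g (x, 1))"
    by (simp add: o_def)
  then have "is_lift C (\<lambda>x. g (x, 1))" using g(3) C by (simp add: chamber_lift_def)
  moreover have "g (v0, 1) = a"
  proof -
    have "continuous_map (top_of_set {0..1}) (prod_topology (top_of_set K) (top_of_set {0..1})) (\<lambda>t. (v0, t))"
      using v0_K by (auto simp: continuous_map_in_subtopology intro!: continuous_intros)
    from continuous_map_compose[OF this g(1)] have P: "pathin X (\<lambda>t. g (v0, t))"
      by (simp add: o_def pathin_def)
    have "segment v0 v0 t = v0" for t by (simp add: segment_def fun_eq_iff algebra_simps)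
    then show ?thesis
      using path_lift_unique[OF covering P, of "\<lambda>_. a" 0 1] g(2,3) a v0_K by simp
  qed
  ultimately show ?thesis by (intro exI[of _ "\<lambda>x. g (x, 1)"]) simp
qed

text \<open>
  To prescribe the lift at \<open>x\<close> instead of the apex, lift the segment from \<open>x\<close> to the apex first.
\<close>

lemma is_lift_exists:
  assumes C: "C \<in> PB" and x: "x \<in> K" and a: "a \<in> topspace X" "q a = pt C x"
  shows "\<exists>f. is_lift C f \<and> f x = a"
proof -
  have s: "pathin (top_of_set K) (segment v0 x)" using segment_K[OF x] by (intro pathin_segment)
  have "pathin Y (\<lambda>t. pt C (segment v0 x t))"
    using pathin_compose[OF s continuous_pt[OF C]] by (simp add: o_def)
  then have "pathin Y (\<lambda>t. pt C (segment v0 x (1 - t)))"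
    by (rule pathin_reparametrize) (auto intro!: continuous_intros)
  from covering_path_lifting[OF covering this a(1)] a(2)
  have "\<exists>\<Gamma>. pathin X \<Gamma> \<and> \<Gamma> 0 = a \<and> (\<forall>t\<in>{0..1}. q (\<Gamma> t) = pt C (segment v0 x (1 - t)))" by simp
  then obtain \<Gamma> where \<Gamma>: "pathin X \<Gamma>" "\<Gamma> 0 = a" "\<forall>t\<in>{0..1}. q (\<Gamma> t) = pt C (segment v0 x (1 - t))"
    by (elim exE conjE)
  have "\<exists>f. is_lift C f \<and> f v0 = \<Gamma> 1"
    using \<Gamma>(3) path_finish_in_topspace[OF \<Gamma>(1)] by (intro is_lift_exists_apex[OF C]) simp_all
  then obtain f where f: "is_lift C f" "f v0 = \<Gamma> 1" by (elim exE conjE)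
  have "pathin X (\<lambda>t. f (segment v0 x t))"
    using pathin_compose[OF s is_liftD(2)[OF f(1)]] by (simp add: o_def)
  moreover have "pathin X (\<lambda>t. \<Gamma> (1 - t))"
    by (rule pathin_reparametrize[OF \<Gamma>(1)]) (auto intro!: continuous_intros)
  moreover have "q (f (segment v0 x t)) = q (\<Gamma> (1 - t))" if "t \<in> {0..1}" for t
    using that \<Gamma>(3) is_liftD(3)[OF f(1) segment_K[OF x that]] by simp
  ultimately have "f (segment v0 x 1) = \<Gamma> (1 - 1)"
    using f(2) path_lift_unique[OF covering, of "\<lambda>t. f (segment v0 x t)" "\<lambda>t. \<Gamma> (1 - t)" 0 1] by simp
  then show ?thesis using f(1) \<Gamma>(2) by (intro exI[of _ f]) simp
qed

text \<open>
  The parametrization of a chamber by the Davis chamber; \<open>lift_of_image\<close> shows that it is unique on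
  \<open>K\<close>.
\<close>

definition lift_of :: "'x set \<Rightarrow> ('i set \<Rightarrow> real) \<Rightarrow> 'x" where
  "lift_of c = (SOME f. \<exists>C. is_lift C f \<and> c = f ` K)"

lemma proj_image:
  assumes f: "is_lift C f"
  shows "pr (f ` K) = C"
  unfolding building_proj_def
proof (rule the_equality)
  show "C \<in> PB \<and> q ` f ` K = pt C ` K"
    using is_liftD[OF f] by (simp add: image_image)
  fix D assume D: "D \<in> PB \<and> q ` f ` K = pt D ` K"
  have "q (f v0) \<in> pt D ` K" using D v0_K by blast
  then obtain x where "x \<in> K" "pt C v0 = pt D x" using is_liftD(3)[OF f v0_K] by auto
  then show "D = C" using pt_eq_iff[OF is_liftD(1)[OF f] conjunct1[OF D] v0_K] mirrors_v0 by auto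
qed

lemma lift_of_props:
  assumes "c \<in> chambers"
  shows "is_lift (pr c) (lift_of c)" "lift_of c ` K = c" "pr c \<in> PB"
proof -
  have "\<exists>f C. is_lift C f \<and> c = f ` K" using assms unfolding graph_product_building_def by blast
  then have "\<exists>C. is_lift C (lift_of c) \<and> c = lift_of c ` K" unfolding lift_of_def by (rule someI_ex)
  then obtain C where C: "is_lift C (lift_of c)" "c = lift_of c ` K" by blast
  then have "pr c = C" using proj_image by metis
  then show "is_lift (pr c) (lift_of c)" "pr c \<in> PB" using C is_liftD(1) by simp_all
  show "lift_of c ` K = c" using C(2) by simp
qed

lemma image_in_chambers: "is_lift C f \<Longrightarrow> f ` K \<in> chambers"
  unfolding graph_product_building_def by blast

lemma lift_of_image:
  assumes f: "is_lift C f" and x: "x \<in> K"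
  shows "lift_of (f ` K) x = f x"
proof -
  let ?g = "lift_of (f ` K)"
  have g: "is_lift C ?g" "?g ` K = f ` K"
    using lift_of_props[OF image_in_chambers[OF f]] proj_image[OF f] by simp_all
  obtain y where y: "y \<in> K" "f v0 = ?g y" using g(2) v0_K by blast
  have "pt C v0 = pt C y" using y is_liftD(3)[OF f v0_K] is_liftD(3)[OF g(1) y(1)] by simp
  then have "y = v0" using pt_eq_iff[OF is_liftD(1)[OF f] is_liftD(1)[OF f] v0_K y(1)] by simp
  then show ?thesis using is_lift_unique[OF g(1) f v0_K _ x] y by simp
qed

lemma chamber_eqI:
  assumes "c \<in> chambers" "d \<in> chambers" "pr c = pr d" "x \<in> K" "lift_of c x = lift_of d x"
  shows "c = d"
proof -
  have d: "is_lift (pr c) (lift_of d)" using lift_of_props(1)[OF assms(2)] assms(3) by simp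
  have "lift_of c y = lift_of d y" if "y \<in> K" for y
    by (rule is_lift_unique[OF lift_of_props(1)[OF assms(1)] d assms(4,5) that])
  then have "lift_of c ` K = lift_of d ` K" by simp
  then show ?thesis using lift_of_props(2) assms(1,2) by simp
qed

lemma lift_of_in: "c \<in> chambers \<Longrightarrow> x \<in> K \<Longrightarrow> lift_of c x \<in> topspace X"
  using is_liftD(2)[OF lift_of_props(1)] by (auto simp: continuous_map_def)

lemma q_lift_of: "c \<in> chambers \<Longrightarrow> x \<in> K \<Longrightarrow> q (lift_of c x) = pt (pr c) x"
  by (rule is_liftD(3)[OF lift_of_props(1)])

lemma chamber_through:
  assumes "C \<in> PB" "x \<in> K" "a \<in> topspace X" "q a = pt C x"
  shows "\<exists>c\<in>chambers. pr c = C \<and> lift_of c x = a"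
proof -
  obtain f where f: "is_lift C f" "f x = a" using is_lift_exists[OF assms] by (elim exE conjE)
  show ?thesis
    using f proj_image lift_of_image[OF f(1) assms(2)]
    by (intro bexI[of _ "f ` K"] image_in_chambers[OF f(1)]) simp
qed

text \<open>
  The vertex \<open>{i}\<close> is the apex of the \<open>i\<close>-mirror, so sharing it amounts to sharing the mirror.
\<close>

definition mvc :: "'i \<Rightarrow> 'c \<Rightarrow> 'x set \<Rightarrow> 'x set" where
  "mvc i a c = (SOME d. d \<in> chambers \<and> pr d = (pr c)(i := a) \<and> lift_of d (vertex {i}) = lift_of c (vertex {i}))"

lemma upd_in_PB: "C \<in> PB \<Longrightarrow> i \<in> I \<Longrightarrow> a \<in> E i \<Longrightarrow> C(i := a) \<in> PB"
  by (rule base.mv_in)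

lemma mvc_props:
  assumes c: "c \<in> chambers" and i: "i \<in> I" and a: "a \<in> E i"
  shows "mvc i a c \<in> chambers" "pr (mvc i a c) = (pr c)(i := a)"
    "x \<in> mirror I Ed i \<Longrightarrow> lift_of (mvc i a c) x = lift_of c x"
proof -
  let ?D = "(pr c)(i := a)"
  have D: "?D \<in> PB" using upd_in_PB lift_of_props(3)[OF c] i a by blast
  have eq: "pt (pr c) x = pt ?D x" if "x \<in> mirror I Ed i" for x
    using pt_eq_iff[OF lift_of_props(3)[OF c] D mirror_K[OF that] mirror_K[OF that]] in_mirrors[OF i that] by auto
  have "q (lift_of c (vertex {i})) = pt ?D (vertex {i})"
    using q_lift_of[OF c vi_K[OF i]] eq[OF vi_mirror[OF i]] by simp
  from chamber_through[OF D vi_K[OF i] lift_of_in[OF c vi_K[OF i]] this]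
  have "\<exists>d. d \<in> chambers \<and> pr d = ?D \<and> lift_of d (vertex {i}) = lift_of c (vertex {i})" by blast
  then have *: "mvc i a c \<in> chambers \<and> pr (mvc i a c) = ?D \<and> lift_of (mvc i a c) (vertex {i}) = lift_of c (vertex {i})"
    unfolding mvc_def by (rule someI_ex)
  then show "mvc i a c \<in> chambers" "pr (mvc i a c) = (pr c)(i := a)" by simp_all
  assume x: "x \<in> mirror I Ed i"
  have "lift_of (mvc i a c) (vertex {i}) = lift_of c (vertex {i}) \<longleftrightarrow> lift_of (mvc i a c) x = lift_of c x"
  proof (rule agree_along_segment)
    show "continuous_map (top_of_set K) X (lift_of (mvc i a c))" "continuous_map (top_of_set K) X (lift_of c)"
      using is_liftD(2)[OF lift_of_props(1)] c * by blast+
    fix t :: real assume "t \<in> {0..1}"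
    then have m: "segment (vertex {i}) x t \<in> mirror I Ed i"
      using segment_in_mirror[OF finite_I graph i x] by simp
    then show "segment (vertex {i}) x t \<in> K \<and>
        q (lift_of (mvc i a c) (segment (vertex {i}) x t)) = q (lift_of c (segment (vertex {i}) x t))"
      using * c eq[OF m] by (simp add: q_lift_of mirror_K)
  qed
  then show "lift_of (mvc i a c) x = lift_of c x" using * by simp
qed

text \<open>
  Chambers with the same projection and a common point are equal (\<open>chamber_eqI\<close>). Moves of type \<open>i\<close>
  keep the vertex \<open>{i}\<close>; two moves of adjacent types \<open>i, j\<close> both keep the vertex \<open>{i, j}\<close>, which
  exists because \<open>{i, j}\<close> is spherical. So each law is checked at one vertex.
\<close>

theorem chambers_cover: "chamber_cover I Ed E chambers pr mvc"
proof (unfold_locales)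
  fix c i j a b assume c: "c \<in> chambers"
  show "pr c \<in> PB" using lift_of_props(3)[OF c] .
  show "mvc i (pr c i) c = c" if i: "i \<in> I"
  proof -
    have a: "pr c i \<in> E i" using lift_of_props(3)[OF c] i by (fastforce simp: product_building_def PiE_iff)
    show ?thesis
      using mvc_props[OF c i a] vi_mirror[OF i] c
      by (intro chamber_eqI[OF _ c _ vi_K[OF i]]) simp_all
  qed
  show "mvc i a (mvc i b c) = mvc i a c" if i: "i \<in> I" and a: "a \<in> E i" and b: "b \<in> E i"
    using mvc_props[OF c i a] mvc_props[OF c i b] mvc_props[OF mvc_props(1)[OF c i b] i a] vi_mirror[OF i]
    by (intro chamber_eqI[OF _ _ _ vi_K[OF i]]) simp_all
  show "mvc i a (mvc j b c) = mvc j b (mvc i a c)" if ij: "{i, j} \<in> Ed" and a: "a \<in> E i" and b: "b \<in> E j"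
  proof -
    have I: "i \<in> I" "j \<in> I" "j \<noteq> i" using ij graph by (auto simp: simplicial_graph_def)
    have s: "{i, j} \<in> spherical_subsets I Ed" using spherical_small(3)[OF graph ij] .
    have m: "vertex {i, j} \<in> mirror I Ed i" "vertex {i, j} \<in> mirror I Ed j"
      using vertex_in_mirror[OF finite_I graph s] by simp_all
    note ci = mvc_props[OF c I(1) a] and cj = mvc_props[OF c I(2) b]
    show ?thesis
      using ci cj mvc_props[OF cj(1) I(1) a] mvc_props[OF ci(1) I(2) b] m I(3)
      by (intro chamber_eqI[OF _ _ _ vertex_K[OF s]]) (simp_all add: fun_upd_twist)
  qed
qed (use finite_I graph mvc_props in auto)

lemma adjacent_iff:
  assumes c: "c \<in> chambers" and d: "d \<in> chambers" and i: "i \<in> I"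
  shows "adjacent I Ed E X q i c d \<longleftrightarrow> c \<noteq> d \<and> d = mvc i (pr d i) c"
proof
  have a: "pr d i \<in> E i" using lift_of_props(3)[OF d] i by (fastforce simp: product_building_def PiE_iff)
  note mv = mvc_props[OF c i a]
  {
    assume "c \<noteq> d \<and> d = mvc i (pr d i) c"
    then have ne: "c \<noteq> d" and eq: "mvc i (pr d i) c = d" by simp_all
    have "lift_of c x = lift_of d x" if "x \<in> mirror I Ed i" for x using mv(3)[OF that] eq by simp
    then have "lift_of c ` mirror I Ed i = lift_of d ` mirror I Ed i" by (rule image_cong[OF refl])
    then show "adjacent I Ed E X q i c d"
      unfolding adjacent_def using ne lift_of_props(1,2)[OF c] lift_of_props(1,2)[OF d]
      by (intro conjI exI[of _ "lift_of c"] exI[of _ "lift_of d"] exI[of _ "pr c"] exI[of _ "pr d"]) simp_all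
  }
  assume "adjacent I Ed E X q i c d"
  then obtain f g C D where fg: "is_lift C f" "is_lift D g" "c = f ` K" "d = g ` K"
      "f ` mirror I Ed i = g ` mirror I Ed i" and ne: "c \<noteq> d"
    unfolding adjacent_def by (elim exE conjE)
  have CD: "pr c = C" "pr d = D" using fg proj_image by simp_all
  obtain y where y: "y \<in> mirror I Ed i" "f (vertex {i}) = g y" using fg(5) vi_mirror[OF i] by blast
  have "pt C (vertex {i}) = pt D y"
    using y is_liftD(3)[OF fg(1) vi_K[OF i]] is_liftD(3)[OF fg(2) mirror_K[OF y(1)]] by simp
  then have "y = vertex {i}" and D: "\<forall>j. j \<noteq> i \<longrightarrow> D j = C j"
    using pt_eq_iff[OF is_liftD(1)[OF fg(1)] is_liftD(1)[OF fg(2)] vi_K[OF i] mirror_K[OF y(1)]] mirrors_vi[OF i]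
    by auto
  then have "f (vertex {i}) = g (vertex {i})" using y by simp
  then have "lift_of c (vertex {i}) = lift_of d (vertex {i})"
    using lift_of_image[OF fg(1) vi_K[OF i]] lift_of_image[OF fg(2) vi_K[OF i]] fg(3,4) by simp
  moreover have "pr d = (pr c)(i := pr d i)" using D CD by (auto simp: fun_eq_iff)
  ultimately have "d = mvc i (pr d i) c"
    using mv vi_mirror[OF i] by (intro chamber_eqI[OF d _ _ vi_K[OF i]]) simp_all
  then show "c \<noteq> d \<and> d = mvc i (pr d i) c" using ne by simp
qed

end

section \<open>Universality of the chamber system\<close>

lemma residue_empty: "residue E mv {} m = {m}"
proof -
  have "n = m" if "n \<in> residue E mv {} m" for n using that by (induction rule: residue.induct) auto
  then show ?thesis by (auto intro: residue.intros)
qed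

definition cover_map :: "'i set \<Rightarrow> ('i \<Rightarrow> 'c set) \<Rightarrow> 'm set \<Rightarrow> ('m \<Rightarrow> 'i \<Rightarrow> 'c) \<Rightarrow> ('i \<Rightarrow> 'c \<Rightarrow> 'm \<Rightarrow> 'm)
    \<Rightarrow> 'n set \<Rightarrow> ('n \<Rightarrow> 'i \<Rightarrow> 'c) \<Rightarrow> ('i \<Rightarrow> 'c \<Rightarrow> 'n \<Rightarrow> 'n) \<Rightarrow> ('m \<Rightarrow> 'n) \<Rightarrow> bool" where
  "cover_map I E M p mv M' p' mv' \<theta> \<longleftrightarrow> (\<forall>m\<in>M. \<theta> m \<in> M' \<and> p' (\<theta> m) = p m \<and>
     (\<forall>i\<in>I. \<forall>a\<in>E i. \<theta> (mv i a m) = mv' i a (\<theta> m)))"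

context universal_cover_of_U
begin

text \<open>
  The chamber system of the universal cover is initial among the pointed combinatorial coverings. A chamber is
  joined to \<open>c0\<close> by a path between apexes, whose projection lifts to the realization of \<open>M\<close>; as \<open>X\<close>
  is simply connected, the end of the lift depends on the chamber only.
\<close>

theorem chambers_universal:
  fixes M :: "'m set"
  assumes M: "chamber_cover I Ed E M p mv" and m0: "m0 \<in> M" and c0: "c0 \<in> chambers" and eq: "p m0 = pr c0"
  shows "\<exists>\<theta>. cover_map I E chambers pr mvc M p mv \<theta> \<and> \<theta> c0 = m0"
proof -
  interpret M: chamber_cover I Ed E M p mv by (rule M)
  interpret Ch: chamber_cover I Ed E chambers pr mvc by (rule chambers_cover)
  let ?x0 = "lift_of c0 v0"
  have x0: "?x0 \<in> topspace X" using lift_of_in[OF c0 v0_K] .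
  have z0: "M.cl m0 v0 \<in> topspace M.Z" using m0 v0_K by (auto simp: M.topspace_cover)
  have "M.\<pi> (M.cl m0 v0) = q ?x0"
    using M.cover_proj_cell[OF m0 v0_K] q_lift_of[OF c0 v0_K] eq by simp
  from simply_connected_lift[OF simply_connected continuous_q M.covering_cover_proj[OF m0] x0 z0 this]
  obtain \<Theta> where \<Theta>0: "\<Theta> ?x0 = M.cl m0 v0"
    and \<Theta>p: "\<forall>x\<in>topspace X. \<Theta> x \<in> topspace M.Z \<and> M.\<pi> (\<Theta> x) = q x"
    and \<Theta>path: "\<forall>\<gamma> \<Gamma>. pathin X \<gamma> \<longrightarrow> pathin M.Z \<Gamma> \<longrightarrow> (\<forall>t\<in>{0..1}. M.\<pi> (\<Gamma> t) = q (\<gamma> t)) \<longrightarrow>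
       \<Gamma> 0 = \<Theta> (\<gamma> 0) \<longrightarrow> \<Gamma> 1 = \<Theta> (\<gamma> 1)"
    by (elim exE conjE)
  have cl_inj: "m = n" if "m \<in> M" "M.cl m v0 = M.cl n v0" for m n
    using that M.cell_eq_iff[OF that(1), of v0 n v0] by (simp add: mirrors_v0 residue_empty)
  define \<theta> where "\<theta> c = (SOME m. m \<in> M \<and> p m = pr c \<and> \<Theta> (lift_of c v0) = M.cl m v0)" for c
  have \<theta>: "\<theta> c \<in> M \<and> p (\<theta> c) = pr c \<and> \<Theta> (lift_of c v0) = M.cl (\<theta> c) v0" if c: "c \<in> chambers" for c
  proof -
    have x: "lift_of c v0 \<in> topspace X" using lift_of_in[OF c v0_K] .
    then obtain m y where m: "m \<in> M" "y \<in> K" "\<Theta> (lift_of c v0) = M.cl m y"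
      using \<Theta>p by (auto simp: M.topspace_cover)
    have "pt (p m) y = pt (pr c) v0"
      using bspec[OF \<Theta>p x] m M.cover_proj_cell[OF m(1,2)] q_lift_of[OF c v0_K] by simp
    then have "y = v0" "p m = pr c"
      using pt_eq_iff[OF M.proj_in[OF m(1)] lift_of_props(3)[OF c] m(2) v0_K] mirrors_v0 by auto
    then have "m \<in> M \<and> p m = pr c \<and> \<Theta> (lift_of c v0) = M.cl m v0" using m by simp
    then show ?thesis unfolding \<theta>_def by (rule someI)
  qed
  have move: "\<theta> (mvc i a c) = mv i a (\<theta> c)" if c: "c \<in> chambers" and i: "i \<in> I" and a: "a \<in> E i" for i a c
  proof -
    let ?d = "mvc i a c" and ?vi = "vertex {i} :: 'i set \<Rightarrow> real"
    let ?m = "\<theta> c" let ?n = "mv i a ?m"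
    note m = \<theta>[OF c]
    have n: "?n \<in> M" "p ?n = (pr c)(i := a)" using m M.mv_in[of ?m i a] M.proj_mv[of ?m i a] i a by simp_all
    note d = mvc_props[OF c i a]
    have s: "pathin (top_of_set K) (segment v0 ?vi)"
      by (rule pathin_segment[OF segment_K[OF vi_K[OF i]]])
    have s': "pathin (top_of_set K) (\<lambda>t. segment v0 ?vi (1 - t))"
      by (rule pathin_reparametrize[OF s]) (auto intro!: continuous_intros)
    have P: "pathin X (\<lambda>t. lift_of e (\<sigma> t))" if "e \<in> chambers" "pathin (top_of_set K) \<sigma>" for e \<sigma>
      using pathin_compose[OF that(2) is_liftD(2)[OF lift_of_props(1)[OF that(1)]]] by (simp add: o_def)
    have Q: "pathin M.Z (\<lambda>t. M.cl k (\<sigma> t))" if "k \<in> M" "pathin (top_of_set K) \<sigma>" for k \<sigma>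
      using pathin_compose[OF that(2) M.continuous_cell[OF that(1)]] by (simp add: o_def)
    have proj: "M.\<pi> (M.cl k x) = q (lift_of e x)" if "k \<in> M" "e \<in> chambers" "p k = pr e" "x \<in> K" for k e x
      using M.cover_proj_cell[OF that(1,4)] q_lift_of[OF that(2,4)] that(3) by simp
    have "M.cl ?m (segment v0 ?vi 1) = \<Theta> (lift_of c (segment v0 ?vi 1))"
      by (rule \<Theta>path[rule_format, OF P[OF c s] Q[OF _ s]])
        (use m proj[OF _ c] segment_K[OF vi_K[OF i]] in simp_all)
    moreover have "M.cl ?m ?vi = M.cl ?n ?vi"
      using m M.cell_eq_iff[of ?m ?vi ?n ?vi] mirrors_vi[OF i] i a
      by (auto intro: residue.intros)
    ultimately have "M.cl ?n ?vi = \<Theta> (lift_of ?d ?vi)"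
      using d(3)[OF vi_mirror[OF i]] by simp
    then have "M.cl ?n (segment v0 ?vi (1 - 1)) = \<Theta> (lift_of ?d (segment v0 ?vi (1 - 1)))"
      by (intro \<Theta>path[rule_format, OF P[OF d(1) s'] Q[OF n(1) s']])
        (use proj[OF n(1) d(1)] n(2) d(2) segment_K[OF vi_K[OF i]] in simp_all)
    then have "M.cl (\<theta> ?d) v0 = M.cl ?n v0" using \<theta>[OF d(1)] by simp
    then show ?thesis using cl_inj \<theta>[OF d(1)] by blast
  qed
  have "\<theta> c0 = m0" using \<theta>[OF c0] \<Theta>0 cl_inj by auto
  then show ?thesis using \<theta> move by (intro exI[of _ \<theta>]) (simp add: cover_map_def)
qed

text \<open>
  The gallery component \<open>M\<close> of a chamber is itself a combinatorial covering, whose realization maps to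
  \<open>X\<close>. So a path in \<open>X\<close>, which is the unique lift of its projection, stays in the chambers of \<open>M\<close>.
\<close>

theorem chambers_connected:
  assumes c0: "c0 \<in> chambers" and c: "c \<in> chambers"
  shows "c \<in> residue E mvc I c0"
proof -
  interpret Ch: chamber_cover I Ed E chambers pr mvc by (rule chambers_cover)
  let ?M = "Ch.res I c0"
  have MC: "?M \<subseteq> chambers" using Ch.residue_in[OF _ c0 subset_refl] by blast
  interpret M: chamber_cover I Ed E ?M pr mvc
  proof (unfold_locales)
    fix m i j a b assume m: "m \<in> ?M"
    then have mc: "m \<in> chambers" using MC by blast
    show "pr m \<in> PB" by (rule Ch.proj_in[OF mc])
    show "mvc i a m \<in> ?M" if "i \<in> I" "a \<in> E i" using m that by (rule residue.residue_step)
    show "pr (mvc i a m) = (pr m)(i := a)" if "i \<in> I" "a \<in> E i" by (rule Ch.proj_mv[OF mc that])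
    show "mvc i a (mvc i b m) = mvc i a m" if "i \<in> I" "a \<in> E i" "b \<in> E i" by (rule Ch.mv_mv[OF mc that])
    show "mvc i (pr m i) m = m" if "i \<in> I" by (rule Ch.mv_self[OF mc that])
    show "mvc i a (mvc j b m) = mvc j b (mvc i a m)" if "{i, j} \<in> Ed" "a \<in> E i" "b \<in> E j"
      by (rule Ch.mv_commute[OF mc that])
  qed (rule finite_I graph)+
  have c0M: "c0 \<in> ?M" by (rule residue.intros)
  \<comment> \<open>The map of realizations \<open>[m, x] \<mapsto> lift_of m x\<close>; the choice of representative does not matter.\<close>
  define F where "F w = (let s = SOME s. s \<in> w in lift_of (fst s) (snd s))" for w :: "('x set \<times> ('i set \<Rightarrow> real)) set"
  have same: "lift_of n x = lift_of m x \<and> n \<in> chambers" if "n \<in> Ch.res (mirrors I Ed x) m" "m \<in> chambers" for n m x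
    using that
  proof (induction rule: residue.induct)
    case (residue_step n i a)
    then have "i \<in> I" "x \<in> mirror I Ed i" by (simp_all add: mirrors_def[OF finite_I graph])
    then show ?case using residue_step mvc_props[of n i a] by simp
  qed simp
  have F: "F (M.cl m x) = lift_of m x" if m: "m \<in> ?M" for m x
  proof -
    have "(m, x) \<in> M.cl m x" by (auto simp: cell_def intro: residue.intros)
    then have "(SOME s. s \<in> M.cl m x) \<in> M.cl m x" by (rule someI)
    then obtain n where "(SOME s. s \<in> M.cl m x) = (n, x)" "n \<in> Ch.res (mirrors I Ed x) m"
      by (auto simp: cell_def)
    then show ?thesis using same[of n x m] m MC by (auto simp: F_def)
  qed
  have cF: "continuous_map M.Z X F"
    unfolding continuous_map_def
  proof (intro conjI allI impI)
    show "F \<in> topspace M.Z \<rightarrow> topspace X"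
      using F MC lift_of_in by (fastforce simp: M.topspace_cover)
    fix U assume U: "openin X U"
    have "openin (top_of_set K) {x \<in> K. M.cl m x \<in> {z \<in> topspace M.Z. F z \<in> U}}" if m: "m \<in> ?M" for m
    proof -
      have "{x \<in> K. M.cl m x \<in> {z \<in> topspace M.Z. F z \<in> U}} = {x \<in> topspace (top_of_set K). lift_of m x \<in> U}"
        using m F[OF m] by (auto simp: M.topspace_cover)
      moreover have "continuous_map (top_of_set K) X (lift_of m)"
        using is_liftD(2)[OF lift_of_props(1)] m MC by blast
      ultimately show ?thesis using U by (simp add: continuous_map_def)
    qed
    then show "openin M.Z {z \<in> topspace M.Z. F z \<in> U}" unfolding M.openin_cover by blast
  qed
  have qF: "q (F z) = M.\<pi> z" if "z \<in> topspace M.Z" for z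
  proof -
    obtain m x where m: "z = M.cl m x" "m \<in> ?M" "x \<in> K" using \<open>z \<in> topspace M.Z\<close> by (auto simp: M.topspace_cover)
    then show ?thesis using F M.cover_proj_cell q_lift_of MC by auto
  qed
  have "\<exists>\<gamma>. pathin X \<gamma> \<and> \<gamma> 0 = lift_of c0 v0 \<and> \<gamma> 1 = lift_of c v0"
    using path_connected lift_of_in[OF c0 v0_K] lift_of_in[OF c v0_K] by (simp add: path_connected_space_def)
  then obtain \<gamma> where \<gamma>: "pathin X \<gamma>" "\<gamma> 0 = lift_of c0 v0" "\<gamma> 1 = lift_of c v0" by (elim exE conjE)
  have "pathin Y (\<lambda>t. q (\<gamma> t))" using pathin_compose[OF \<gamma>(1) continuous_q] by (simp add: o_def)
  moreover have "M.cl c0 v0 \<in> topspace M.Z" using c0M v0_K by (auto simp: M.topspace_cover)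
  moreover have "M.\<pi> (M.cl c0 v0) = q (\<gamma> 0)"
    using M.cover_proj_cell[OF c0M v0_K] q_lift_of[OF c0 v0_K] \<gamma>(2) by simp
  ultimately have "\<exists>\<Gamma>. pathin M.Z \<Gamma> \<and> \<Gamma> 0 = M.cl c0 v0 \<and> (\<forall>t\<in>{0..1}. M.\<pi> (\<Gamma> t) = q (\<gamma> t))"
    by (rule covering_path_lifting[OF M.covering_cover_proj[OF c0M]])
  then obtain \<Gamma> where \<Gamma>: "pathin M.Z \<Gamma>" "\<Gamma> 0 = M.cl c0 v0" "\<forall>t\<in>{0..1}. M.\<pi> (\<Gamma> t) = q (\<gamma> t)"
    by (elim exE conjE)
  have in_Z: "\<Gamma> t \<in> topspace M.Z" if "t \<in> {0..1}" for t
    using path_image_subset_topspace[OF \<Gamma>(1)] that by blast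
  have P: "pathin X (\<lambda>t. F (\<Gamma> t))" using pathin_compose[OF \<Gamma>(1) cF] by (simp add: o_def)
  have "F (\<Gamma> 1) = \<gamma> 1"
    by (rule path_lift_unique[OF covering P \<gamma>(1), of 0 1])
      (use qF[OF in_Z] \<Gamma>(2,3) \<gamma>(2) F[OF c0M] in simp_all)
  moreover obtain m y where m: "\<Gamma> 1 = M.cl m y" "m \<in> ?M" "y \<in> K"
    using in_Z[of 1] by (auto simp: M.topspace_cover)
  ultimately have eq: "lift_of m y = lift_of c v0" using F \<gamma>(3) by simp
  have mC: "m \<in> chambers" using m MC by blast
  have "pt (pr m) y = pt (pr c) v0" using eq q_lift_of[OF mC m(3)] q_lift_of[OF c v0_K] by simp
  then have "y = v0" "pr m = pr c"
    using pt_eq_iff[OF lift_of_props(3)[OF mC] lift_of_props(3)[OF c] m(3) v0_K] mirrors_v0 by auto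
  then have "m = c" using chamber_eqI[OF mC c _ v0_K] eq by simp
  then show ?thesis using m(2) by simp
qed

lemma chamber_over:
  assumes "C \<in> PB"
  shows "\<exists>c\<in>chambers. pr c = C"
proof -
  have "pt C v0 \<in> q ` topspace X" using pt_in[OF assms v0_K] q_surj by simp
  then obtain a where "a \<in> topspace X" "q a = pt C v0" by auto
  then show ?thesis using chamber_through[OF assms v0_K] by blast
qed

end

section \<open>Lifts of the product action\<close>

locale lifted_action = universal_cover_of_U I Ed E X q
  for I :: "'i set" and Ed :: "'i set set" and E :: "'i \<Rightarrow> 'c set"
    and X :: "'x topology" and q :: "'x \<Rightarrow> (('i \<Rightarrow> 'c) \<times> ('i set \<Rightarrow> real)) set" +
  fixes G :: "'i \<Rightarrow> 'g monoid" and \<phi> :: "'i \<Rightarrow> 'g \<Rightarrow> 'c \<Rightarrow> 'c"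
  assumes trans: "i \<in> I \<Longrightarrow> transitive_action (G i) (E i) (\<phi> i)"
begin

abbreviation "P \<equiv> product_group I G"
abbreviation "act \<equiv> product_action I \<phi>"

lemma action: "i \<in> I \<Longrightarrow> group_action (G i) (E i) (\<phi> i)"
  using trans by (simp add: transitive_action_def)

lemma group_G: "i \<in> I \<Longrightarrow> group (G i)"
  using action by (simp add: group_action_def group_hom_def)

lemma group_P: "group P" using group_G by simp

lemma in_P_iff: "g \<in> carrier P \<longleftrightarrow> g \<in> extensional I \<and> (\<forall>i\<in>I. g i \<in> carrier (G i))"
  by (auto simp: PiE_iff)

lemma P_coord: "g \<in> carrier P \<Longrightarrow> i \<in> I \<Longrightarrow> g i \<in> carrier (G i)"
  by (auto simp: PiE_iff)

lemma P_mult_coord: "i \<in> I \<Longrightarrow> (g \<otimes>\<^bsub>P\<^esub> h) i = g i \<otimes>\<^bsub>G i\<^esub> h i"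
  by simp

lemma PB_iff: "D \<in> PB \<longleftrightarrow> D \<in> extensional I \<and> (\<forall>i\<in>I. D i \<in> E i)"
  by (auto simp: product_building_def PiE_iff)

lemma PB_coord: "D \<in> PB \<Longrightarrow> i \<in> I \<Longrightarrow> D i \<in> E i"
  by (simp add: PB_iff)

lemma PB_eqI: "D \<in> PB \<Longrightarrow> D' \<in> PB \<Longrightarrow> (\<And>i. i \<in> I \<Longrightarrow> D i = D' i) \<Longrightarrow> D = D'"
  by (auto simp: PB_iff intro: extensionalityI)

lemma act_coord [simp]: "i \<in> I \<Longrightarrow> act g D i = \<phi> i (g i) (D i)"
  by (simp add: product_action_def)

lemma coord_in: "i \<in> I \<Longrightarrow> g \<in> carrier (G i) \<Longrightarrow> a \<in> E i \<Longrightarrow> \<phi> i g a \<in> E i"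
  using group_action.element_image[OF action] by blast

lemma act_in: "g \<in> carrier P \<Longrightarrow> D \<in> PB \<Longrightarrow> act g D \<in> PB"
  by (auto simp: PB_iff P_coord coord_in) (simp add: product_action_def)

lemma coord_mult: "i \<in> I \<Longrightarrow> g \<in> carrier (G i) \<Longrightarrow> h \<in> carrier (G i) \<Longrightarrow> a \<in> E i \<Longrightarrow>
    \<phi> i (g \<otimes>\<^bsub>G i\<^esub> h) a = \<phi> i g (\<phi> i h a)"
  using group_action.composition_rule[OF action] by blast

lemma coord_one: "i \<in> I \<Longrightarrow> a \<in> E i \<Longrightarrow> \<phi> i \<one>\<^bsub>G i\<^esub> a = a"
  using group_action.id_eq_one[OF action, of i] by (metis restrict_apply')

lemma coord_inv: "i \<in> I \<Longrightarrow> g \<in> carrier (G i) \<Longrightarrow> a \<in> E i \<Longrightarrow> \<phi> i (inv\<^bsub>G i\<^esub> g) (\<phi> i g a) = a"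
  using group_action.orbit_sym_aux[OF action] by blast

lemma coord_inv': "i \<in> I \<Longrightarrow> g \<in> carrier (G i) \<Longrightarrow> a \<in> E i \<Longrightarrow> \<phi> i g (\<phi> i (inv\<^bsub>G i\<^esub> g) a) = a"
  using coord_inv[of i "inv\<^bsub>G i\<^esub> g" a] group.inv_closed[OF group_G] group.inv_inv[OF group_G] by simp

lemma act_mult: "g \<in> carrier P \<Longrightarrow> h \<in> carrier P \<Longrightarrow> D \<in> PB \<Longrightarrow> act (g \<otimes>\<^bsub>P\<^esub> h) D = act g (act h D)"
  by (rule PB_eqI)
    (auto simp: act_in group.is_monoid[OF group_P] monoid.m_closed P_coord PB_coord coord_mult
      simp del: mult_product_group carrier_product_group simp add: P_mult_coord)

lemma act_one: "D \<in> PB \<Longrightarrow> act \<one>\<^bsub>P\<^esub> D = D"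
  by (rule PB_eqI)
    (auto simp: act_in group.is_monoid[OF group_P] monoid.one_closed PB_coord coord_one
      simp del: one_product_group carrier_product_group simp add: one_product_group[THEN fun_cong])

lemma P_inv_coord: "g \<in> carrier P \<Longrightarrow> i \<in> I \<Longrightarrow> (inv\<^bsub>P\<^esub> g) i = inv\<^bsub>G i\<^esub> (g i)"
  using inv_product_group[of g I G] group_G by simp

lemma act_inv: "g \<in> carrier P \<Longrightarrow> D \<in> PB \<Longrightarrow> act (inv\<^bsub>P\<^esub> g) (act g D) = D"
  using act_mult[of "inv\<^bsub>P\<^esub> g" g D] group.inv_closed[OF group_P, of g] group.l_inv[OF group_P, of g] act_one
  by metis

lemma act_upd: "i \<in> I \<Longrightarrow> act g (D(i := a)) = (act g D)(i := \<phi> i (g i) a)"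
  by (auto simp: product_action_def fun_eq_iff)

text \<open>
  A map over \<open>g\<close> that commutes with moves. By \<open>carrier_lift_group\<close> these are the lifts of \<open>g\<close> in the sense
  of type preserving automorphisms.
\<close>

definition lies_over :: "('i \<Rightarrow> 'g) \<Rightarrow> ('x set \<Rightarrow> 'x set) \<Rightarrow> bool" where
  "lies_over g a \<longleftrightarrow> (\<forall>c\<in>chambers. a c \<in> chambers \<and> pr (a c) = act g (pr c) \<and>
     (\<forall>i\<in>I. \<forall>e\<in>E i. a (mvc i e c) = mvc i (\<phi> i (g i) e) (a c)))"

lemma lies_overD:
  assumes "lies_over g a" "c \<in> chambers"
  shows "a c \<in> chambers" "pr (a c) = act g (pr c)"
    "i \<in> I \<Longrightarrow> e \<in> E i \<Longrightarrow> a (mvc i e c) = mvc i (\<phi> i (g i) e) (a c)"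
  using assms by (simp_all add: lies_over_def)

text \<open>
  Twisting the covering \<open>pr\<close> by \<open>g\<close> gives another combinatorial covering, and a morphism into it is
  a lift of \<open>g\<close>.
\<close>

lemma lies_over_exists:
  assumes g: "g \<in> carrier P" and c: "c \<in> chambers" and d: "d \<in> chambers" and eq: "pr d = act g (pr c)"
  shows "\<exists>a. lies_over g a \<and> a c = d"
proof -
  interpret Ch: chamber_cover I Ed E chambers pr mvc by (rule chambers_cover)
  let ?p = "\<lambda>c. act (inv\<^bsub>P\<^esub> g) (pr c)" and ?mv = "\<lambda>i e. mvc i (\<phi> i (g i) e)"
  have ig: "inv\<^bsub>P\<^esub> g \<in> carrier P" by (rule group.inv_closed[OF group_P g])
  have gE: "\<phi> i (g i) e \<in> E i" if "i \<in> I" "e \<in> E i" for i e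
    using coord_in[OF that(1) P_coord[OF g that(1)] that(2)] .
  have twisted: "chamber_cover I Ed E chambers ?p ?mv"
  proof (unfold_locales)
    fix m i j a b assume m: "m \<in> chambers"
    show "?p m \<in> PB" by (rule act_in[OF ig Ch.proj_in[OF m]])
    show "?mv i a m \<in> chambers" if "i \<in> I" "a \<in> E i" by (rule Ch.mv_in[OF m that(1) gE[OF that]])
    show "?p (?mv i a m) = (?p m)(i := a)" if i: "i \<in> I" and a: "a \<in> E i"
      using Ch.proj_mv[OF m i gE[OF i a]] coord_inv[OF i P_coord[OF g i] a]
      by (simp only: act_upd[OF i] P_inv_coord[OF g i])
    show "?mv i a (?mv i b m) = ?mv i a m" if "i \<in> I" "a \<in> E i" "b \<in> E i"
      by (rule Ch.mv_mv[OF m that(1) gE[OF that(1,2)] gE[OF that(1,3)]])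
    show "?mv i (?p m i) m = m" if i: "i \<in> I"
      using Ch.mv_self[OF m i] coord_inv'[OF i P_coord[OF g i] PB_coord[OF Ch.proj_in[OF m] i]]
      by (simp only: act_coord[OF i] P_inv_coord[OF g i])
    show "?mv i a (?mv j b m) = ?mv j b (?mv i a m)" if "{i, j} \<in> Ed" "a \<in> E i" "b \<in> E j"
    proof -
      have "i \<in> I" "j \<in> I" using that graph by (auto simp: simplicial_graph_def)
      then show ?thesis using Ch.mv_commute[OF m that(1)] gE that by blast
    qed
  qed (rule finite_I graph)+
  have "?p d = pr c" using eq act_inv[OF g Ch.proj_in[OF c]] by simp
  from chambers_universal[OF twisted d c this] obtain \<theta>
    where \<theta>: "cover_map I E chambers pr mvc chambers ?p ?mv \<theta>" "\<theta> c = d" by (elim exE conjE)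
  have "lies_over g \<theta>"
    unfolding lies_over_def
  proof (intro ballI conjI)
    fix k assume k: "k \<in> chambers"
    show \<theta>k: "\<theta> k \<in> chambers" using \<theta>(1) k by (simp add: cover_map_def)
    have "pr k = act (inv\<^bsub>P\<^esub> g) (pr (\<theta> k))" using \<theta>(1) k by (simp add: cover_map_def)
    then have "act g (pr k) = act (inv\<^bsub>P\<^esub> (inv\<^bsub>P\<^esub> g)) (act (inv\<^bsub>P\<^esub> g) (pr (\<theta> k)))"
      using group.inv_inv[OF group_P g] by simp
    then show "pr (\<theta> k) = act g (pr k)" using act_inv[OF ig Ch.proj_in[OF \<theta>k]] by simp
    fix i e assume "i \<in> I" "e \<in> E i"
    then show "\<theta> (mvc i e k) = mvc i (\<phi> i (g i) e) (\<theta> k)" using \<theta>(1) k by (simp add: cover_map_def)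
  qed
  then show ?thesis using \<theta>(2) by (intro exI[of _ \<theta>] conjI)
qed

lemma lies_over_unique:
  assumes a: "lies_over g a" and b: "lies_over g b" and c: "c \<in> chambers" "a c = b c" and d: "d \<in> chambers"
  shows "a d = b d"
proof -
  interpret Ch: chamber_cover I Ed E chambers pr mvc by (rule chambers_cover)
  have "a d = b d \<and> d \<in> chambers" if "d \<in> Ch.res I c"
    using that
  proof (induction rule: residue.induct)
    case (residue_step n i e)
    then show ?case using lies_overD(3)[OF a] lies_overD(3)[OF b] Ch.mv_in by simp
  qed (simp add: c)
  then show ?thesis using chambers_connected[OF c(1) d] by simp
qed

lemma lies_over_residue:
  assumes a: "lies_over g a" and g: "g \<in> carrier P" and T: "T \<subseteq> I" and c: "c \<in> chambers"
    and d: "d \<in> residue E mvc T c"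
  shows "a d \<in> residue E mvc T (a c)"
proof -
  interpret Ch: chamber_cover I Ed E chambers pr mvc by (rule chambers_cover)
  show ?thesis
    using d
  proof (induction rule: residue.induct)
    case (residue_step n i e)
    then have "n \<in> chambers" "i \<in> I" using Ch.residue_in[OF _ c T] T by auto
    then show ?case
      using lies_overD(3)[OF a, of n i e] residue_step coord_in[OF \<open>i \<in> I\<close> P_coord[OF g \<open>i \<in> I\<close>]]
      by (auto intro: residue.intros)
  qed (rule residue.intros)
qed

lemma lies_over_compose:
  assumes a: "lies_over g a" and b: "lies_over h b" and g: "g \<in> carrier P" and h: "h \<in> carrier P"
  shows "lies_over (g \<otimes>\<^bsub>P\<^esub> h) (\<lambda>c. a (b c))"
  unfolding lies_over_def
proof (intro ballI conjI)
  fix c assume c: "c \<in> chambers"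
  note bc = lies_overD[OF b c] note abc = lies_overD[OF a bc(1)]
  show "a (b c) \<in> chambers" by (rule abc(1))
  show "pr (a (b c)) = act (g \<otimes>\<^bsub>P\<^esub> h) (pr c)"
    using bc(2) abc(2) act_mult[OF g h lift_of_props(3)[OF c]] by simp
  fix i e assume i: "i \<in> I" and e: "e \<in> E i"
  have "\<phi> i (h i) e \<in> E i" by (rule coord_in[OF i P_coord[OF h i] e])
  then show "a (b (mvc i e c)) = mvc i (\<phi> i ((g \<otimes>\<^bsub>P\<^esub> h) i) e) (a (b c))"
    using bc(3)[OF i e] abc(3)[OF i] coord_mult[OF i P_coord[OF g i] P_coord[OF h i] e]
    by (simp only: P_mult_coord[OF i])
qed

lemma lies_over_restrict: "lies_over g a \<Longrightarrow> lies_over g (restrict a chambers)"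
  using mvc_props(1) by (auto simp: lies_over_def)

lemma lies_over_id:
  assumes "\<And>i e. i \<in> I \<Longrightarrow> e \<in> E i \<Longrightarrow> \<phi> i (g i) e = e"
  shows "lies_over g (\<lambda>c. c)"
  unfolding lies_over_def
proof (intro ballI conjI)
  fix c assume c: "c \<in> chambers"
  show "pr c = act g (pr c)"
    using lift_of_props(3)[OF c] assms by (auto simp: PB_iff product_action_def intro: extensionalityI[of _ I])
qed (simp_all add: assms)

text \<open>
  A lift of \<open>inv g\<close> that undoes \<open>a\<close> at one chamber undoes it everywhere, since both composites are
  lifts of \<open>1\<close> with a fixed chamber.
\<close>

lemma lies_over_bij:
  assumes a: "lies_over g a" and g: "g \<in> carrier P"
  shows "bij_betw a chambers chambers"
proof -
  have ig: "inv\<^bsub>P\<^esub> g \<in> carrier P" by (rule group.inv_closed[OF group_P g])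
  have id1: "lies_over \<one>\<^bsub>P\<^esub> (\<lambda>c. c)"
    by (rule lies_over_id) (simp add: coord_one)
  show ?thesis
  proof (cases "chambers = {}")
    case False
    then obtain c where c: "c \<in> chambers" by auto
    note ac = lies_overD[OF a c]
    have "pr c = act (inv\<^bsub>P\<^esub> g) (pr (a c))" using ac(2) act_inv[OF g lift_of_props(3)[OF c]] by simp
    from lies_over_exists[OF ig ac(1) c this] obtain b where b: "lies_over (inv\<^bsub>P\<^esub> g) b" "b (a c) = c"
      by (elim exE conjE)
    have ba: "lies_over \<one>\<^bsub>P\<^esub> (\<lambda>c. b (a c))" and ab: "lies_over \<one>\<^bsub>P\<^esub> (\<lambda>c. a (b c))"
      using lies_over_compose[OF b(1) a ig g] lies_over_compose[OF a b(1) g ig]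
        group.l_inv[OF group_P g] group.r_inv[OF group_P g] by simp_all
    have "b (a d) = d" if "d \<in> chambers" for d
      using lies_over_unique[OF ba id1 c b(2) that] .
    moreover have "a (b d) = d" if "d \<in> chambers" for d
      by (rule lies_over_unique[OF ab id1 ac(1) _ that]) (simp add: b(2))
    ultimately show ?thesis
      using lies_overD(1)[OF a] lies_overD(1)[OF b(1)] by (intro bij_betw_byWitness[of _ b]) auto
  qed (simp add: bij_betw_def)
qed

abbreviation "L \<equiv> lift_group I Ed E G \<phi> X q"

text \<open>
  Adjacency is expressed through moves in \<open>adjacent_iff\<close>, so a bijection over \<open>g\<close> preserves
  adjacency exactly when it commutes with moves.
\<close>

lemma carrier_lift_group:
  "a \<in> carrier L \<longleftrightarrow> a \<in> extensional chambers \<and> (\<exists>g\<in>carrier P. lies_over g a)"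
proof
  interpret Ch: chamber_cover I Ed E chambers pr mvc by (rule chambers_cover)
  {
    assume "a \<in> carrier L"
    then have aut: "a \<in> building_aut I Ed E X q" and "\<exists>g\<in>carrier P. \<forall>c\<in>chambers. pr (a c) = act g (pr c)"
      by (simp_all add: lift_group_def del: carrier_product_group)
    then obtain g where g: "g \<in> carrier P" "\<And>c. c \<in> chambers \<Longrightarrow> pr (a c) = act g (pr c)" by blast
    have ext: "a \<in> extensional chambers" and bij: "bij_betw a chambers chambers"
      and adj: "\<And>i c d. i \<in> I \<Longrightarrow> c \<in> chambers \<Longrightarrow> d \<in> chambers \<Longrightarrow>
        adjacent I Ed E X q i (a c) (a d) \<longleftrightarrow> adjacent I Ed E X q i c d"
      using aut by (simp_all add: building_aut_def Bij_def)
    have "lies_over g a"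
      unfolding lies_over_def
    proof (intro ballI conjI)
      fix c assume c: "c \<in> chambers"
      show ac: "a c \<in> chambers" using bij c by (rule bij_betwE[THEN bspec])
      show "pr (a c) = act g (pr c)" by (rule g(2)[OF c])
      fix i e assume i: "i \<in> I" and e: "e \<in> E i"
      let ?d = "mvc i e c"
      have d: "?d \<in> chambers" "pr ?d i = e" using mvc_props(1,2)[OF c i e] by simp_all
      have ad: "a ?d \<in> chambers" using bij d(1) by (rule bij_betwE[THEN bspec])
      have pi: "pr (a ?d) i = \<phi> i (g i) e" using g(2)[OF d(1)] i d(2) by simp
      show "a ?d = mvc i (\<phi> i (g i) e) (a c)"
      proof (cases "?d = c")
        case True
        then show ?thesis using Ch.mv_self[OF ac i] pi by simp
      next
        case False
        then have "adjacent I Ed E X q i c ?d" using adjacent_iff[OF c d(1) i] d(2) by simp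
        then have "adjacent I Ed E X q i (a c) (a ?d)" using adj[OF i c d(1)] by simp
        then show ?thesis using adjacent_iff[OF ac ad i] pi by simp
      qed
    qed
    then show "a \<in> extensional chambers \<and> (\<exists>g\<in>carrier P. lies_over g a)" using ext g(1) by blast
  }
  assume "a \<in> extensional chambers \<and> (\<exists>g\<in>carrier P. lies_over g a)"
  then obtain g where ext: "a \<in> extensional chambers" and g: "g \<in> carrier P" and a: "lies_over g a" by blast
  have bij: "bij_betw a chambers chambers" by (rule lies_over_bij[OF a g])
  have inj: "a c = a d \<longleftrightarrow> c = d" if "c \<in> chambers" "d \<in> chambers" for c d
    using bij that by (auto simp: bij_betw_def inj_on_def)
  have "adjacent I Ed E X q i (a c) (a d) \<longleftrightarrow> adjacent I Ed E X q i c d"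
    if i: "i \<in> I" and c: "c \<in> chambers" and d: "d \<in> chambers" for i c d
  proof -
    have e: "pr d i \<in> E i" by (rule PB_coord[OF lift_of_props(3)[OF d] i])
    have "mvc i (pr (a d) i) (a c) = a (mvc i (pr d i) c)"
      using lies_overD(2)[OF a d] lies_overD(3)[OF a c i e] i by simp
    then show ?thesis
      using adjacent_iff[OF lies_overD(1)[OF a c] lies_overD(1)[OF a d] i] adjacent_iff[OF c d i]
        inj[OF c d] inj[OF d mvc_props(1)[OF c i e]] by simp
  qed
  then have "a \<in> building_aut I Ed E X q" using ext bij by (simp add: building_aut_def Bij_def)
  moreover have "\<exists>g\<in>carrier P. \<forall>c\<in>chambers. pr (a c) = act g (pr c)"
    using g lies_overD(2)[OF a] by blast
  ultimately show "a \<in> carrier L" by (simp add: lift_group_def del: carrier_product_group)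
qed

lemma lift_group_Bij: "a \<in> carrier L \<Longrightarrow> a \<in> Bij chambers"
  by (simp add: lift_group_def building_aut_def)

lemma one_L: "\<one>\<^bsub>L\<^esub> = (\<lambda>c\<in>chambers. c)"
  by (simp add: lift_group_def BijGroup_def)

lemma mult_L: "a \<in> carrier L \<Longrightarrow> b \<in> carrier L \<Longrightarrow> a \<otimes>\<^bsub>L\<^esub> b = restrict (\<lambda>c. a (b c)) chambers"
  using lift_group_Bij[of a] lift_group_Bij[of b] by (simp add: lift_group_def BijGroup_def compose_def)

lemma group_L: "group L"
proof -
  interpret B: group "BijGroup chambers" by (rule group_BijGroup)
  have "subgroup (carrier L) (BijGroup chambers)"
  proof (rule B.subgroupI)
    show "carrier L \<subseteq> carrier (BijGroup chambers)"
      using lift_group_Bij by (auto simp: BijGroup_def)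
    have "lies_over \<one>\<^bsub>P\<^esub> (\<lambda>c\<in>chambers. c)"
      by (rule lies_over_restrict[OF lies_over_id]) (simp add: coord_one)
    then have "(\<lambda>c\<in>chambers. c) \<in> carrier L"
      using carrier_lift_group monoid.one_closed[OF group.is_monoid[OF group_P]] by blast
    then show "carrier L \<noteq> {}" by blast
  next
    fix a b assume a: "a \<in> carrier L" and b: "b \<in> carrier L"
    obtain g h where "g \<in> carrier P" "lies_over g a" "h \<in> carrier P" "lies_over h b"
      using a b carrier_lift_group by blast
    then have "lies_over (g \<otimes>\<^bsub>P\<^esub> h) (restrict (\<lambda>c. a (b c)) chambers)" "g \<otimes>\<^bsub>P\<^esub> h \<in> carrier P"
      using lies_over_restrict[OF lies_over_compose] monoid.m_closed[OF group.is_monoid[OF group_P]] by blast+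
    moreover have "a \<otimes>\<^bsub>BijGroup chambers\<^esub> b = restrict (\<lambda>c. a (b c)) chambers"
      using lift_group_Bij[OF a] lift_group_Bij[OF b] by (simp add: BijGroup_def compose_def)
    ultimately show "a \<otimes>\<^bsub>BijGroup chambers\<^esub> b \<in> carrier L"
      unfolding carrier_lift_group by (metis restrict_extensional)
  next
    fix a assume a: "a \<in> carrier L"
    obtain g where g: "g \<in> carrier P" "lies_over g a" using a carrier_lift_group by blast
    have ig: "inv\<^bsub>P\<^esub> g \<in> carrier P" by (rule group.inv_closed[OF group_P g(1)])
    let ?b = "inv\<^bsub>BijGroup chambers\<^esub> a"
    have aB: "a \<in> carrier (BijGroup chambers)" using lift_group_Bij[OF a] by (simp add: BijGroup_def)
    then have bB: "?b \<in> Bij chambers" using B.inv_closed by (simp add: BijGroup_def)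
    have inv: "?b (a c) = c" "a (?b c) = c" if "c \<in> chambers" for c
    proof -
      have "?b \<otimes>\<^bsub>BijGroup chambers\<^esub> a = (\<lambda>c\<in>chambers. c)" "a \<otimes>\<^bsub>BijGroup chambers\<^esub> ?b = (\<lambda>c\<in>chambers. c)"
        using B.l_inv[OF aB] B.r_inv[OF aB] by (simp_all add: BijGroup_def)
      then have "compose chambers ?b a = (\<lambda>c\<in>chambers. c)" "compose chambers a ?b = (\<lambda>c\<in>chambers. c)"
        using lift_group_Bij[OF a] bB by (simp_all add: BijGroup_def)
      then show "?b (a c) = c" "a (?b c) = c" using that by (metis compose_eq restrict_apply')+
    qed
    have bin: "?b c \<in> chambers" if "c \<in> chambers" for c using Bij_imp_funcset[OF bB] that by blast
    have "lies_over (inv\<^bsub>P\<^esub> g) ?b"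
      unfolding lies_over_def
    proof (intro ballI conjI)
      fix c assume c: "c \<in> chambers"
      show bc: "?b c \<in> chambers" by (rule bin[OF c])
      show "pr (?b c) = act (inv\<^bsub>P\<^esub> g) (pr c)"
        using lies_overD(2)[OF g(2) bc] inv(2)[OF c] act_inv[OF g(1) lift_of_props(3)[OF bc]] by simp
      fix i e assume i: "i \<in> I" and e: "e \<in> E i"
      let ?e = "\<phi> i ((inv\<^bsub>P\<^esub> g) i) e"
      have e': "?e \<in> E i" by (rule coord_in[OF i P_coord[OF ig i] e])
      have "\<phi> i (g i) ?e = e" using coord_inv'[OF i P_coord[OF g(1) i] e] P_inv_coord[OF g(1) i] by simp
      then have "a (mvc i ?e (?b c)) = mvc i e c"
        using lies_overD(3)[OF g(2) bc i e'] inv(2)[OF c] by simp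
      then show "?b (mvc i e c) = mvc i ?e (?b c)" using inv(1)[OF mvc_props(1)[OF bc i e']] by simp
    qed
    then show "?b \<in> carrier L" using carrier_lift_group ig bB by (auto simp: Bij_def)
  qed
  then have "group ((BijGroup chambers)\<lparr>carrier := carrier L\<rparr>)"
    by (rule subgroup.subgroup_is_group) (rule group_BijGroup)
  moreover have "(BijGroup chambers)\<lparr>carrier := carrier L\<rparr> = L" by (simp add: lift_group_def)
  ultimately show ?thesis by simp
qed

end

section \<open>The generalized graph product acts by lifts\<close>

lemma group_colimit_induct_snoc:
  assumes x: "x \<in> carrier (group_colimit J H A)"
    and one: "Q \<one>\<^bsub>group_colimit J H A\<^esub>"
    and step: "\<And>y j h. y \<in> carrier (group_colimit J H A) \<Longrightarrow> Q y \<Longrightarrow> j \<in> J \<Longrightarrow> h \<in> carrier (H j) \<Longrightarrow>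
      Q (y \<otimes>\<^bsub>group_colimit J H A\<^esub> colimit_in J H A j h)"
  shows "Q x"
proof -
  let ?X = "colimit_gens J H" and ?R = "colimit_rels J H A"
  obtain w where w: "w \<in> lists ?X" "x = word_class ?X ?R w"
    using x unfolding group_colimit_def carrier_presented by blast
  have "Q (word_class ?X ?R w)"
    using w(1)
  proof (induction w rule: rev_induct)
    case Nil
    then show ?case using one by (simp add: group_colimit_def one_presented)
  next
    case (snoc l w)
    then have l: "w \<in> lists ?X" "fst l \<in> J" "snd l \<in> carrier (H (fst l))" "[l] \<in> lists ?X"
      by (auto simp: colimit_gens_def)
    have "word_class ?X ?R (w @ [l]) = word_class ?X ?R w \<otimes>\<^bsub>group_colimit J H A\<^esub> colimit_in J H A (fst l) (snd l)"
      using l by (simp only: group_colimit_def colimit_in_def presented_mult prod.collapse)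
    moreover have "word_class ?X ?R w \<in> carrier (group_colimit J H A)"
      unfolding group_colimit_def carrier_presented using l(1) by blast
    ultimately show ?case using step snoc l by simp
  qed
  then show ?thesis using w(2) by simp
qed

locale lifted_action_based = lifted_action I Ed E X q G \<phi>
  for I :: "'i set" and Ed :: "'i set set" and E :: "'i \<Rightarrow> 'c set"
    and X :: "'x topology" and q :: "'x \<Rightarrow> (('i \<Rightarrow> 'c) \<times> ('i set \<Rightarrow> real)) set"
    and G :: "'i \<Rightarrow> 'g monoid" and \<phi> :: "'i \<Rightarrow> 'g \<Rightarrow> 'c \<Rightarrow> 'c" +
  fixes C :: "'i \<Rightarrow> 'c"
  assumes C: "C \<in> product_building I E"
begin

interpretation Ch: chamber_cover I Ed E chambers pr mvc by (rule chambers_cover)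

abbreviation "H \<equiv> partial_product I G \<phi> C"
abbreviation "J \<equiv> ggp_index I Ed"
abbreviation "A \<equiv> ggp_arrows I Ed :: ('i set \<times> 'i set \<times> (('i \<Rightarrow> 'g) \<Rightarrow> 'i \<Rightarrow> 'g)) set"
abbreviation "Gb \<equiv> gen_graph_product I Ed G \<phi> C"
abbreviation "inn \<equiv> colimit_in J H A"

definition c0 :: "'x set" where "c0 = (SOME c. c \<in> chambers \<and> pr c = C)"

lemma c0: "c0 \<in> chambers" "pr c0 = C"
proof -
  have "\<exists>c. c \<in> chambers \<and> pr c = C" using chamber_over[OF C] by blast
  then have "c0 \<in> chambers \<and> pr c0 = C" unfolding c0_def by (rule someI_ex)
  then show "c0 \<in> chambers" "pr c0 = C" by simp_all
qed

lemma C_coord: "i \<in> I \<Longrightarrow> C i \<in> E i" by (rule PB_coord[OF C])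

lemma mult_H: "(\<otimes>\<^bsub>H T\<^esub>) = (\<otimes>\<^bsub>P\<^esub>)" and one_H: "\<one>\<^bsub>H T\<^esub> = \<one>\<^bsub>P\<^esub>"
  by (auto simp: partial_product_def fun_eq_iff)

lemma carrier_H: "h \<in> carrier (H T) \<longleftrightarrow> h \<in> carrier P \<and> (\<forall>k\<in>I. k \<notin> T \<longrightarrow> \<phi> k (h k) (C k) = C k)"
  by (auto simp: partial_product_def PiE_iff stabilizer_def split: if_splits)

lemma carrier_H_empty: "h \<in> carrier (H {}) \<longleftrightarrow> h \<in> carrier P \<and> act h C = C"
proof -
  have "act h C = C \<longleftrightarrow> (\<forall>k\<in>I. \<phi> k (h k) (C k) = C k)"
    using C by (auto simp: PB_iff product_action_def extensional_def fun_eq_iff)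
  then show ?thesis by (simp add: carrier_H del: carrier_product_group)
qed

lemma H_in_P: "h \<in> carrier (H T) \<Longrightarrow> h \<in> carrier P" by (simp only: carrier_H)

lemma H_mono: "S \<subseteq> T \<Longrightarrow> h \<in> carrier (H S) \<Longrightarrow> h \<in> carrier (H T)"
  unfolding carrier_H by blast

lemma group_H: "group (H T)"
  by (rule group_partial_product[OF action C])

lemma group_Gb: "group Gb"
  unfolding gen_graph_product_def by (intro group_group_colimit group_H)

lemma monoid_Gb: "monoid Gb" and monoid_P: "monoid P"
  using group_Gb group_P group.is_monoid by blast+

lemmas Gb_closed = monoid.m_closed[OF monoid_Gb] and Gb_one = monoid.one_closed[OF monoid_Gb]
  and Gb_assoc = monoid.m_assoc[OF monoid_Gb] and Gb_r_one = monoid.r_one[OF monoid_Gb]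

lemma index_I: "T \<in> J \<Longrightarrow> T \<subseteq> I"
  using graph by (auto simp: ggp_index_def simplicial_graph_def)

lemma index_clique: "T \<in> J \<Longrightarrow> Ch.clique T"
proof -
  assume T: "T \<in> J"
  consider "T = {}" | i where "i \<in> I" "T = {i}" | "T \<in> Ed" using T by (auto simp: ggp_index_def)
  then show ?thesis
  proof cases
    case 3
    then have "card T = 2" "T \<subseteq> I" using graph by (auto simp: simplicial_graph_def)
    then obtain i j where "T = {i, j}" by (auto simp: card_2_iff)
    then show ?thesis using 3 \<open>T \<subseteq> I\<close> by (auto simp: Ch.clique_def insert_commute)
  qed (auto simp: Ch.clique_def)
qed

lemma index_small: "{} \<in> J" "i \<in> I \<Longrightarrow> {i} \<in> J" "{i, j} \<in> Ed \<Longrightarrow> {i, j} \<in> J"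
  by (auto simp: ggp_index_def)

lemma arrow: "(S, T, f) \<in> A \<Longrightarrow> S \<in> J \<and> T \<in> J \<and> S \<subseteq> T \<and> f = (\<lambda>h. h)"
  using graph by (auto simp: ggp_arrows_def ggp_index_def simplicial_graph_def)

lemma inn_hom: "T \<in> J \<Longrightarrow> inn T \<in> hom (H T) Gb"
  unfolding gen_graph_product_def by (rule colimit_in_hom, assumption, rule group_H)

lemma inn_in: "T \<in> J \<Longrightarrow> h \<in> carrier (H T) \<Longrightarrow> inn T h \<in> carrier Gb"
  using inn_hom by (auto simp: hom_def)

lemma inn_mult: "T \<in> J \<Longrightarrow> h \<in> carrier (H T) \<Longrightarrow> k \<in> carrier (H T) \<Longrightarrow>
    inn T (h \<otimes>\<^bsub>P\<^esub> k) = inn T h \<otimes>\<^bsub>Gb\<^esub> inn T k"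
  using inn_hom[of T] unfolding hom_def mult_H by blast

lemma inn_one: "T \<in> J \<Longrightarrow> inn T \<one>\<^bsub>P\<^esub> = \<one>\<^bsub>Gb\<^esub>"
  using group_hom.hom_one[of "H T" Gb "inn T"] inn_hom[of T] group_H group_Gb
  by (simp only: group_hom_def group_hom_axioms_def one_H)

lemma H_mult: "h \<in> carrier (H T) \<Longrightarrow> k \<in> carrier (H T) \<Longrightarrow> h \<otimes>\<^bsub>P\<^esub> k \<in> carrier (H T)"
  using monoid.m_closed[OF group.is_monoid[OF group_H], of h T k] by (simp only: mult_H)

lemma inn_singleton:
  assumes T: "T \<in> J" "i \<in> T" and h: "h \<in> carrier (H {i})"
  shows "inn T h = inn {i} h"
proof (cases "T = {i}")
  case False
  have i: "i \<in> I" using index_I T by blast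
  have "T \<in> Ed" using T False by (auto simp: ggp_index_def)
  then have "({i}, T, \<lambda>h. h) \<in> A" using T(2) by (auto simp: ggp_arrows_def)
  then show ?thesis
    using colimit_in_compatible[of "{i}" T "\<lambda>h. h" A J h H] index_small(2)[OF i] T(1) h
      H_mono[of "{i}" T h] T(2) by simp
qed simp

lemma one_in_H: "\<one>\<^bsub>P\<^esub> \<in> carrier (H T)"
  using monoid.one_closed[OF group.is_monoid[OF group_H], of T] by (simp only: one_H)

lemma inn_stabilizer:
  assumes T: "T \<in> J" and h: "h \<in> carrier (H {})"
  shows "inn T h = inn {} h"
proof (cases "T = {}")
  case False
  then obtain i where i: "i \<in> T" by auto
  then have iI: "i \<in> I" using index_I T by blast
  have hi: "h \<in> carrier (H {i})" using H_mono[OF _ h] by simp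
  have "({}, {i}, \<lambda>h. h) \<in> A" using iI by (auto simp: ggp_arrows_def)
  then have "inn {i} h = inn {} h"
    using colimit_in_compatible[of "{}" "{i}" "\<lambda>h. h" A J h H] index_small(1) index_small(2)[OF iI] h hi
    by simp
  then show ?thesis using inn_singleton[OF T i hi] by simp
qed simp

text \<open>
  The lift of \<open>h\<close> that keeps \<open>c0\<close> in its residue of type \<open>T\<close>. It exists as \<open>h\<close> changes only the
  coordinates of \<open>C\<close> in \<open>T\<close>, and is unique as \<open>T\<close> is a clique.
\<close>

definition base_lift :: "'i set \<Rightarrow> ('i \<Rightarrow> 'g) \<Rightarrow> 'x set \<Rightarrow> 'x set" where
  "base_lift T h = (THE a. a \<in> extensional chambers \<and> lies_over h a \<and> a c0 \<in> Ch.res T c0)"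

lemma base_lift_unique:
  assumes T: "T \<in> J"
    and a: "a \<in> extensional chambers" "lies_over h a" "a c0 \<in> Ch.res T c0"
    and b: "b \<in> extensional chambers" "lies_over h b" "b c0 \<in> Ch.res T c0"
  shows "a = b"
proof (rule extensionalityI[OF a(1) b(1)])
  have "pr (a c0) = pr (b c0)" using lies_overD(2)[OF a(2) c0(1)] lies_overD(2)[OF b(2) c0(1)] by simp
  then have "a c0 = b c0" by (rule Ch.clique_residue_inj[OF index_clique[OF T] c0(1) a(3) b(3)])
  then show "a c = b c" if "c \<in> chambers" for c
    by (rule lies_over_unique[OF a(2) b(2) c0(1) _ that])
qed

lemma base_lift:
  assumes T: "T \<in> J" and h: "h \<in> carrier (H T)"
  shows "base_lift T h \<in> extensional chambers" "lies_over h (base_lift T h)" "base_lift T h c0 \<in> Ch.res T c0"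
proof -
  have hP: "h \<in> carrier P" by (rule H_in_P[OF h])
  have "act h C \<in> PB" by (rule act_in[OF hP C])
  moreover have "act h C j = C j" if "j \<notin> T" for j
    using h that C by (cases "j \<in> I") (auto simp: carrier_H PB_iff product_action_def extensional_def)
  ultimately obtain d where d: "d \<in> Ch.res T c0" "pr d = act h C"
    using Ch.residue_lift[OF index_I[OF T] c0(1)] c0(2) by metis
  have dc: "d \<in> chambers" by (rule Ch.residue_in[OF d(1) c0(1) index_I[OF T]])
  have "pr d = act h (pr c0)" using d(2) c0(2) by simp
  from lies_over_exists[OF hP c0(1) dc this] obtain a where a: "lies_over h a" "a c0 = d" by (elim exE conjE)
  have r: "restrict a chambers \<in> extensional chambers" "lies_over h (restrict a chambers)"
      "restrict a chambers c0 \<in> Ch.res T c0"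
    using lies_over_restrict[OF a(1)] a(2) d(1) c0(1) by simp_all
  have "\<exists>!a. a \<in> extensional chambers \<and> lies_over h a \<and> a c0 \<in> Ch.res T c0"
  proof (rule ex1I)
    show "restrict a chambers \<in> extensional chambers \<and> lies_over h (restrict a chambers) \<and>
        restrict a chambers c0 \<in> Ch.res T c0" using r by (intro conjI)
    fix b assume "b \<in> extensional chambers \<and> lies_over h b \<and> b c0 \<in> Ch.res T c0"
    then show "b = restrict a chambers" by (elim conjE) (rule base_lift_unique[OF T _ _ _ r])
  qed
  then have "base_lift T h \<in> extensional chambers \<and> lies_over h (base_lift T h) \<and> base_lift T h c0 \<in> Ch.res T c0"
    unfolding base_lift_def by (rule theI')
  then show "base_lift T h \<in> extensional chambers" "lies_over h (base_lift T h)" "base_lift T h c0 \<in> Ch.res T c0"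
    by simp_all
qed

lemma base_lift_eqI:
  assumes "T \<in> J" "h \<in> carrier (H T)" "a \<in> extensional chambers" "lies_over h a" "a c0 \<in> Ch.res T c0"
  shows "base_lift T h = a"
  by (rule base_lift_unique[OF assms(1) base_lift[OF assms(1,2)] assms(3-5)])

lemma base_lift_in_L: "T \<in> J \<Longrightarrow> h \<in> carrier (H T) \<Longrightarrow> base_lift T h \<in> carrier L"
  using carrier_lift_group base_lift H_in_P by blast

lemma base_lift_hom:
  assumes T: "T \<in> J"
  shows "base_lift T \<in> hom (H T) L"
proof (rule homI)
  fix h assume h: "h \<in> carrier (H T)"
  show "base_lift T h \<in> carrier L" by (rule base_lift_in_L[OF T h])
  fix k assume k: "k \<in> carrier (H T)"
  note lh = base_lift[OF T h] and lk = base_lift[OF T k]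
  have kc: "base_lift T k c0 \<in> chambers" by (rule lies_overD(1)[OF lk(2) c0(1)])
  have "base_lift T h (base_lift T k c0) \<in> Ch.res T (base_lift T h c0)"
    by (rule lies_over_residue[OF lh(2) H_in_P[OF h] index_I[OF T] c0(1) lk(3)])
  then have "base_lift T h (base_lift T k c0) \<in> Ch.res T c0" using Ch.residue_trans lh(3) by blast
  then have "base_lift T (h \<otimes>\<^bsub>P\<^esub> k) = restrict (\<lambda>c. base_lift T h (base_lift T k c)) chambers"
    using c0(1) lies_over_restrict[OF lies_over_compose[OF lh(2) lk(2) H_in_P[OF h] H_in_P[OF k]]]
    by (intro base_lift_eqI[OF T H_mult[OF h k]]) simp_all
  then show "base_lift T (h \<otimes>\<^bsub>H T\<^esub> k) = base_lift T h \<otimes>\<^bsub>L\<^esub> base_lift T k"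
    unfolding mult_H mult_L[OF base_lift_in_L[OF T h] base_lift_in_L[OF T k]] .
qed

lemma Psi_exists: "\<exists>\<Psi>. \<Psi> \<in> hom Gb L \<and> (\<forall>T\<in>J. \<forall>h\<in>carrier (H T). \<Psi> (inn T h) = base_lift T h)"
proof -
  have "\<exists>!\<Psi>. \<Psi> \<in> hom Gb L \<inter> extensional (carrier Gb) \<and>
      (\<forall>T\<in>J. \<forall>h\<in>carrier (H T). \<Psi> (inn T h) = base_lift T h)"
    unfolding gen_graph_product_def
  proof (rule group_colimit_universal[OF group_H _ group_L base_lift_hom])
    fix S T f assume "(S, T, f) \<in> A"
    then have ST: "S \<in> J" "T \<in> J" "S \<subseteq> T" and f: "f = (\<lambda>h. h)" using arrow by blast+
    have "(\<lambda>h. h) \<in> hom (H S) (H T)"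
      using H_mono[OF ST(3)] by (intro homI) (simp_all only: mult_H)
    then show "S \<in> J \<and> T \<in> J \<and> f \<in> hom (H S) (H T)" using ST f by simp
    fix h assume h: "h \<in> carrier (H S)"
    have "base_lift T h = base_lift S h"
      using base_lift[OF ST(1) h] Ch.residue_mono[OF _ ST(3)]
      by (intro base_lift_eqI[OF ST(2) H_mono[OF ST(3) h]]) blast+
    then show "base_lift T (f h) = base_lift S h" using f by simp
  qed
  then show ?thesis by (elim ex1E conjE IntE) (intro exI conjI)
qed

lemma pi_exists: "\<exists>\<pi>. \<pi> \<in> hom Gb P \<and> (\<forall>T\<in>J. \<forall>h\<in>carrier (H T). \<pi> (inn T h) = h)"
proof -
  have "\<exists>!\<pi>. \<pi> \<in> hom Gb P \<inter> extensional (carrier Gb) \<and>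
      (\<forall>T\<in>J. \<forall>h\<in>carrier (H T). \<pi> (inn T h) = h)"
    unfolding gen_graph_product_def
  proof (rule group_colimit_universal[OF group_H _ group_P])
    fix T
    show "(\<lambda>h. h) \<in> hom (H T) P" using H_in_P by (intro homI) (simp_all only: mult_H)
  next
    fix S T f assume "(S, T, f) \<in> A"
    then have ST: "S \<in> J" "T \<in> J" "S \<subseteq> T" and f: "f = (\<lambda>h. h)" using arrow by blast+
    have "(\<lambda>h. h) \<in> hom (H S) (H T)"
      using H_mono[OF ST(3)] by (intro homI) (simp_all only: mult_H)
    then show "S \<in> J \<and> T \<in> J \<and> f \<in> hom (H S) (H T)" using ST f by simp
    show "f h = h" for h using f by simp
  qed
  then show ?thesis by (elim ex1E conjE IntE) (intro exI conjI)
qed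

text \<open>
  The action of the generalized graph product, and its projection to \<open>\<Prod> G i\<close>.
\<close>

definition Psi where
  "Psi = (SOME \<Psi>. \<Psi> \<in> hom Gb L \<and> (\<forall>T\<in>J. \<forall>h\<in>carrier (H T). \<Psi> (inn T h) = base_lift T h))"

definition coords where
  "coords = (SOME \<pi>. \<pi> \<in> hom Gb P \<and> (\<forall>T\<in>J. \<forall>h\<in>carrier (H T). \<pi> (inn T h) = h))"

lemma Psi: "Psi \<in> hom Gb L" "T \<in> J \<Longrightarrow> h \<in> carrier (H T) \<Longrightarrow> Psi (inn T h) = base_lift T h"
  using someI_ex[OF Psi_exists] unfolding Psi_def[symmetric] by blast+

lemma coords: "coords \<in> hom Gb P" "T \<in> J \<Longrightarrow> h \<in> carrier (H T) \<Longrightarrow> coords (inn T h) = h"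
  using someI_ex[OF pi_exists] unfolding coords_def[symmetric] by blast+

lemma coords_in: "x \<in> carrier Gb \<Longrightarrow> coords x \<in> carrier P"
  using coords(1) unfolding hom_def by blast

lemma coords_mult: "x \<in> carrier Gb \<Longrightarrow> y \<in> carrier Gb \<Longrightarrow> coords (x \<otimes>\<^bsub>Gb\<^esub> y) = coords x \<otimes>\<^bsub>P\<^esub> coords y"
  using coords(1) unfolding hom_def by blast

lemma coords_one: "coords \<one>\<^bsub>Gb\<^esub> = \<one>\<^bsub>P\<^esub>"
  using coords(2)[OF index_small(1) one_in_H] inn_one[OF index_small(1)] by simp

lemma Psi_in: "x \<in> carrier Gb \<Longrightarrow> Psi x \<in> carrier L"
  using Psi(1) unfolding hom_def by blast

lemma Psi_snoc:
  assumes x: "x \<in> carrier Gb" and T: "T \<in> J" and h: "h \<in> carrier (H T)" and c: "c \<in> chambers"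
  shows "Psi (x \<otimes>\<^bsub>Gb\<^esub> inn T h) c = Psi x (base_lift T h c)"
proof -
  have "Psi (x \<otimes>\<^bsub>Gb\<^esub> inn T h) = Psi x \<otimes>\<^bsub>L\<^esub> base_lift T h"
    using Psi(1) x inn_in[OF T h] Psi(2)[OF T h] unfolding hom_def by simp
  then show ?thesis using mult_L[OF Psi_in[OF x] base_lift_in_L[OF T h]] c by simp
qed

text \<open>
  Elements of the colimit are built by appending letters on the right: then the gallery from \<open>c0\<close> to
  \<open>Psi y c0\<close> is extended at its end.
\<close>

lemma Gb_induct [consumes 1, case_names one snoc]:
  assumes "x \<in> carrier Gb" "Q \<one>\<^bsub>Gb\<^esub>"
    "\<And>y T h. y \<in> carrier Gb \<Longrightarrow> Q y \<Longrightarrow> T \<in> J \<Longrightarrow> h \<in> carrier (H T) \<Longrightarrow> Q (y \<otimes>\<^bsub>Gb\<^esub> inn T h)"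
  shows "Q x"
  using group_colimit_induct_snoc[of x J H A Q] assms unfolding gen_graph_product_def by blast

lemma Psi_over:
  assumes "x \<in> carrier Gb"
  shows "lies_over (coords x) (Psi x)"
  using assms
proof (induction x rule: Gb_induct)
  case one
  have "Psi \<one>\<^bsub>Gb\<^esub> = base_lift {} \<one>\<^bsub>P\<^esub>"
    using Psi(2)[OF index_small(1) one_in_H] inn_one[OF index_small(1)] by simp
  then show ?case using base_lift(2)[OF index_small(1) one_in_H] by (simp only: coords_one)
next
  case (snoc y T h)
  have "coords (y \<otimes>\<^bsub>Gb\<^esub> inn T h) = coords y \<otimes>\<^bsub>P\<^esub> h"
    using coords_mult[OF snoc.hyps(1) inn_in[OF snoc.hyps(2,3)]] coords(2)[OF snoc.hyps(2,3)] by simp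
  moreover have "Psi (y \<otimes>\<^bsub>Gb\<^esub> inn T h) = restrict (\<lambda>c. Psi y (base_lift T h c)) chambers"
    using Psi(1) snoc.hyps(1) inn_in[OF snoc.hyps(2,3)] Psi(2)[OF snoc.hyps(2,3)]
      mult_L[OF Psi_in[OF snoc.hyps(1)] base_lift_in_L[OF snoc.hyps(2,3)]] unfolding hom_def by simp
  ultimately show ?case
    using lies_over_restrict[OF lies_over_compose[OF snoc.IH base_lift(2)[OF snoc.hyps(2,3)]
          coords_in[OF snoc.hyps(1)] H_in_P[OF snoc.hyps(3)]]] by (simp only:)
qed

text \<open>
  The subgroups \<open>H {i}\<close> move \<open>c0\<close> to all its \<open>i\<close>-neighbours, and the chamber system is connected.
\<close>

lemma Psi_transitive:
  assumes "c \<in> chambers"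
  shows "\<exists>x\<in>carrier Gb. Psi x c0 = c"
proof -
  have "c \<in> Ch.res I c0" by (rule chambers_connected[OF c0(1) assms])
  then show ?thesis
  proof (induction rule: residue.induct)
    case residue_base
    have "base_lift {} \<one>\<^bsub>P\<^esub> c0 = c0" using base_lift(3)[OF index_small(1) one_in_H] by (simp add: residue_empty)
    then show ?case using Psi(2)[OF index_small(1) one_in_H] inn_in[OF index_small(1) one_in_H] by metis
  next
    case (residue_step n i e)
    then obtain x where x: "x \<in> carrier Gb" "Psi x c0 = n" by blast
    have i: "i \<in> I" and e: "e \<in> E i" using residue_step by simp_all
    have xi: "coords x i \<in> carrier (G i)" by (rule P_coord[OF coords_in[OF x(1)] i])
    \<comment> \<open>A letter acts before \<open>Psi x\<close>, so the target coordinate is pulled back by \<open>coords x\<close>.\<close>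
    define e' where "e' = \<phi> i (inv\<^bsub>G i\<^esub> (coords x i)) e"
    have e': "e' \<in> E i" "\<phi> i (coords x i) e' = e"
      unfolding e'_def using coord_in[OF i _ e] group.inv_closed[OF group_G[OF i] xi] coord_inv'[OF i xi e] by simp_all
    obtain t where t: "t \<in> carrier (G i)" "\<phi> i t (C i) = e'"
      using transitive_action.unique_orbit[OF trans[OF i] C_coord[OF i] e'(1)] by blast
    define h where "h = (\<lambda>k\<in>I. if k = i then t else \<one>\<^bsub>G k\<^esub>)"
    have hP: "h \<in> carrier P" unfolding in_P_iff h_def using t group_G by (auto simp: group.is_monoid)
    have h: "h \<in> carrier (H {i})" unfolding carrier_H using hP by (simp add: h_def coord_one C_coord del: carrier_product_group)
    note J = index_small(2)[OF i]
    have "act h C = C(i := e')"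
      using C t i by (auto simp: product_action_def h_def PB_iff fun_eq_iff coord_one extensional_def)
    then have "pr (base_lift {i} h c0) = pr (mvc i e' c0)"
      using lies_overD(2)[OF base_lift(2)[OF J h] c0(1)] c0(2) Ch.proj_mv[OF c0(1) i e'(1)] by simp
    moreover have "mvc i e' c0 \<in> Ch.res {i} c0" using e'(1) by (intro residue.intros) simp_all
    ultimately have eq: "base_lift {i} h c0 = mvc i e' c0"
      using Ch.clique_residue_inj[OF index_clique[OF J] c0(1) base_lift(3)[OF J h]] by blast
    have "Psi (x \<otimes>\<^bsub>Gb\<^esub> inn {i} h) c0 = mvc i e n"
      using Psi_snoc[OF x(1) J h c0(1)] eq lies_overD(3)[OF Psi_over[OF x(1)] c0(1) i e'(1)] x(2) e'(2) by simp
    then show ?case using Gb_closed[OF x(1) inn_in[OF J h]] by blast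
  qed
qed

text \<open>
  A transitive subgroup that contains the stabilizer of \<open>c0\<close>, here the image of \<open>H {}\<close>, is everything.
\<close>

lemma Psi_surj: "Psi ` carrier Gb = carrier L"
proof
  show "Psi ` carrier Gb \<subseteq> carrier L" using Psi_in by blast
  show "carrier L \<subseteq> Psi ` carrier Gb"
  proof
    fix a assume "a \<in> carrier L"
    then obtain g where ext: "a \<in> extensional chambers" and g: "g \<in> carrier P" and a: "lies_over g a"
      using carrier_lift_group by blast
    obtain x where x: "x \<in> carrier Gb" "Psi x c0 = a c0" using Psi_transitive[OF lies_overD(1)[OF a c0(1)]] by blast
    \<comment> \<open>The two lifts \<open>a\<close> and \<open>Psi x\<close> agree at \<open>c0\<close>; \<open>u\<close> corrects \<open>x\<close> by an element of the stabilizer of \<open>C\<close>.\<close>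
    define u where "u = inv\<^bsub>P\<^esub> (coords x) \<otimes>\<^bsub>P\<^esub> g"
    note xP = coords_in[OF x(1)]
    have ix: "inv\<^bsub>P\<^esub> (coords x) \<in> carrier P" by (rule group.inv_closed[OF group_P xP])
    have uP: "u \<in> carrier P" unfolding u_def by (rule monoid.m_closed[OF monoid_P ix g])
    have "act g C = act (coords x) C"
      using lies_overD(2)[OF a c0(1)] lies_overD(2)[OF Psi_over[OF x(1)] c0(1)] x(2) c0(2) by simp
    then have "act u C = C" unfolding u_def using act_mult[OF ix g C] act_inv[OF xP C] by simp
    then have u: "u \<in> carrier (H {})" using uP by (simp only: carrier_H_empty)
    note J = index_small(1)
    let ?y = "x \<otimes>\<^bsub>Gb\<^esub> inn {} u"
    have y: "?y \<in> carrier Gb" by (rule Gb_closed[OF x(1) inn_in[OF J u]])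
    have "coords ?y = coords x \<otimes>\<^bsub>P\<^esub> u"
      using coords_mult[OF x(1) inn_in[OF J u]] coords(2)[OF J u] by simp
    also have "\<dots> = g"
      unfolding u_def using monoid.m_assoc[OF monoid_P xP ix g] group.r_inv[OF group_P xP] monoid.l_one[OF monoid_P g]
      by metis
    finally have "lies_over g (Psi ?y)" using Psi_over[OF y] by simp
    moreover have "base_lift {} u c0 = c0" using base_lift(3)[OF J u] by (simp add: residue_empty)
    then have "Psi ?y c0 = a c0" using Psi_snoc[OF x(1) J u c0(1)] x(2) by simp
    ultimately have "Psi ?y c = a c" if "c \<in> chambers" for c
      using lies_over_unique[OF _ a c0(1) _ that] by blast
    moreover have "Psi ?y \<in> extensional chambers" using Psi_in[OF y] carrier_lift_group by blast
    ultimately have "Psi ?y = a" using ext by (intro extensionalityI[of _ chambers])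
    then show "a \<in> Psi ` carrier Gb" using y by blast
  qed
qed

end

section \<open>The kernel of the action\<close>

context lifted_action_based
begin

interpretation Ch: chamber_cover I Ed E chambers pr mvc by (rule chambers_cover)

definition transversal :: "'i \<Rightarrow> 'c \<Rightarrow> 'g" where
  "transversal i e = (SOME t. t \<in> carrier (G i) \<and> \<phi> i t (C i) = e)"

text \<open>
  For \<open>g\<close> in \<open>G i\<close>, right multiplication by \<open>correction i e g\<close> moves \<open>g\<close> to an element that maps
  \<open>C i\<close> to \<open>e\<close>. The factor \<open>inv (transversal i (\<phi> i g (C i))) \<otimes> g\<close> of \<open>g\<close> is unchanged, which makes
  these moves compatible with each other.
\<close>

definition correction :: "'i \<Rightarrow> 'c \<Rightarrow> 'g \<Rightarrow> 'g" where
  "correction i e g = inv\<^bsub>G i\<^esub> g \<otimes>\<^bsub>G i\<^esub> (transversal i e \<otimes>\<^bsub>G i\<^esub>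
     (inv\<^bsub>G i\<^esub> (transversal i (\<phi> i g (C i))) \<otimes>\<^bsub>G i\<^esub> g))"

lemma transversal:
  assumes "i \<in> I" "e \<in> E i"
  shows "transversal i e \<in> carrier (G i)" "\<phi> i (transversal i e) (C i) = e"
proof -
  have "\<exists>t. t \<in> carrier (G i) \<and> \<phi> i t (C i) = e"
    using transitive_action.unique_orbit[OF trans[OF assms(1)] C_coord[OF assms(1)] assms(2)] by blast
  then have "transversal i e \<in> carrier (G i) \<and> \<phi> i (transversal i e) (C i) = e"
    unfolding transversal_def by (rule someI_ex)
  then show "transversal i e \<in> carrier (G i)" "\<phi> i (transversal i e) (C i) = e" by simp_all
qed

lemma correction:
  assumes i: "i \<in> I" and e: "e \<in> E i" and d: "d \<in> E i" and g: "g \<in> carrier (G i)"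
  shows "correction i e g \<in> carrier (G i)"
    "\<phi> i (g \<otimes>\<^bsub>G i\<^esub> correction i e g) (C i) = e"
    "correction i d g \<otimes>\<^bsub>G i\<^esub> correction i e (g \<otimes>\<^bsub>G i\<^esub> correction i d g) = correction i e g"
    "correction i (\<phi> i g (C i)) g = \<one>\<^bsub>G i\<^esub>"
proof -
  interpret Gi: group "G i" by (rule group_G[OF i])
  let ?b = "transversal i (\<phi> i g (C i))"
  have gC: "\<phi> i g (C i) \<in> E i" by (rule coord_in[OF i g C_coord[OF i]])
  note b = transversal[OF i gC] and te = transversal[OF i e] and td = transversal[OF i d]
  have cancel: "inv\<^bsub>G i\<^esub> x \<otimes>\<^bsub>G i\<^esub> (x \<otimes>\<^bsub>G i\<^esub> y) = y" "x \<otimes>\<^bsub>G i\<^esub> (inv\<^bsub>G i\<^esub> x \<otimes>\<^bsub>G i\<^esub> y) = y"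
    if "x \<in> carrier (G i)" "y \<in> carrier (G i)" for x y
    using that by (simp_all add: Gi.m_assoc[symmetric])
  show in_G: "correction i e g \<in> carrier (G i)"
    unfolding correction_def using b(1) te(1) g by simp
  have shift: "g \<otimes>\<^bsub>G i\<^esub> correction i f g = transversal i f \<otimes>\<^bsub>G i\<^esub> (inv\<^bsub>G i\<^esub> ?b \<otimes>\<^bsub>G i\<^esub> g)" if "f \<in> E i" for f
    unfolding correction_def using b(1) transversal(1)[OF i that] g by (simp add: cancel)
  have corrected: "\<phi> i (g \<otimes>\<^bsub>G i\<^esub> correction i f g) (C i) = f" if f: "f \<in> E i" for f
  proof -
    have "\<phi> i (inv\<^bsub>G i\<^esub> ?b \<otimes>\<^bsub>G i\<^esub> g) (C i) = \<phi> i (inv\<^bsub>G i\<^esub> ?b) (\<phi> i ?b (C i))"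
      using coord_mult[OF i _ g C_coord[OF i], of "inv\<^bsub>G i\<^esub> ?b"] b by simp
    also have "\<dots> = C i" by (rule coord_inv[OF i b(1) C_coord[OF i]])
    finally show ?thesis
      unfolding shift[OF f]
      using coord_mult[OF i transversal(1)[OF i f] _ C_coord[OF i], of "inv\<^bsub>G i\<^esub> ?b \<otimes>\<^bsub>G i\<^esub> g"] b(1) g
        transversal(2)[OF i f] by simp
  qed
  show "\<phi> i (g \<otimes>\<^bsub>G i\<^esub> correction i e g) (C i) = e" by (rule corrected[OF e])
  show "correction i (\<phi> i g (C i)) g = \<one>\<^bsub>G i\<^esub>"
    unfolding correction_def using b(1) g by (simp add: cancel)
  have "correction i e (g \<otimes>\<^bsub>G i\<^esub> correction i d g) =
      inv\<^bsub>G i\<^esub> (transversal i d \<otimes>\<^bsub>G i\<^esub> (inv\<^bsub>G i\<^esub> ?b \<otimes>\<^bsub>G i\<^esub> g)) \<otimes>\<^bsub>G i\<^esub> (transversal i e \<otimes>\<^bsub>G i\<^esub>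
        (inv\<^bsub>G i\<^esub> (transversal i d) \<otimes>\<^bsub>G i\<^esub> (transversal i d \<otimes>\<^bsub>G i\<^esub> (inv\<^bsub>G i\<^esub> ?b \<otimes>\<^bsub>G i\<^esub> g))))"
    unfolding correction_def[of i e "g \<otimes>\<^bsub>G i\<^esub> correction i d g"] corrected[OF d] unfolding shift[OF d] ..
  then show "correction i d g \<otimes>\<^bsub>G i\<^esub> correction i e (g \<otimes>\<^bsub>G i\<^esub> correction i d g) = correction i e g"
    using b(1) te(1) td(1) g by (simp add: correction_def cancel Gi.m_assoc Gi.inv_mult_group)
qed

definition single :: "'i \<Rightarrow> 'g \<Rightarrow> 'i \<Rightarrow> 'g" where
  "single i t = (\<lambda>k\<in>I. if k = i then t else \<one>\<^bsub>G k\<^esub>)"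

text \<open>
  The image of \<open>G i\<close> in the generalized graph product.
\<close>

definition letter :: "'i \<Rightarrow> 'g \<Rightarrow> ('i set \<times> ('i \<Rightarrow> 'g)) list set" where
  "letter i t = inn {i} (single i t)"

lemma single_in:
  assumes "i \<in> I" "t \<in> carrier (G i)"
  shows "single i t \<in> carrier P" "single i t \<in> carrier (H {i})"
proof -
  show P: "single i t \<in> carrier P" unfolding in_P_iff single_def using assms group_G by (auto simp: group.is_monoid)
  show "single i t \<in> carrier (H {i})"
    unfolding carrier_H using P by (simp add: single_def coord_one C_coord del: carrier_product_group)
qed

lemma letter_in: "i \<in> I \<Longrightarrow> t \<in> carrier (G i) \<Longrightarrow> letter i t \<in> carrier Gb"
  unfolding letter_def by (rule inn_in[OF index_small(2) single_in(2)])

lemma coords_letter: "i \<in> I \<Longrightarrow> t \<in> carrier (G i) \<Longrightarrow> coords (letter i t) = single i t"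
  unfolding letter_def by (rule coords(2)[OF index_small(2) single_in(2)])

lemma letter_mult:
  assumes i: "i \<in> I" and t: "t \<in> carrier (G i)" and u: "u \<in> carrier (G i)"
  shows "letter i t \<otimes>\<^bsub>Gb\<^esub> letter i u = letter i (t \<otimes>\<^bsub>G i\<^esub> u)"
proof -
  have "single i t \<otimes>\<^bsub>P\<^esub> single i u = single i (t \<otimes>\<^bsub>G i\<^esub> u)"
    using group_G by (auto simp: single_def fun_eq_iff group.is_monoid)
  then show ?thesis
    unfolding letter_def using inn_mult[OF index_small(2)[OF i] single_in(2)[OF i t] single_in(2)[OF i u]] by simp
qed

lemma letter_one:
  assumes i: "i \<in> I"
  shows "letter i \<one>\<^bsub>G i\<^esub> = \<one>\<^bsub>Gb\<^esub>"
proof -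
  have "single i \<one>\<^bsub>G i\<^esub> = \<one>\<^bsub>P\<^esub>" by (auto simp: single_def fun_eq_iff)
  then show ?thesis unfolding letter_def using inn_one[OF index_small(2)[OF i]] by simp
qed

lemma letters_commute:
  assumes ij: "{i, j} \<in> Ed" and t: "t \<in> carrier (G i)" and u: "u \<in> carrier (G j)"
  shows "letter i t \<otimes>\<^bsub>Gb\<^esub> letter j u = letter j u \<otimes>\<^bsub>Gb\<^esub> letter i t"
proof -
  have I: "i \<in> I" "j \<in> I" "i \<noteq> j" using ij graph by (auto simp: simplicial_graph_def)
  note T = index_small(3)[OF ij]
  note s = single_in[OF I(1) t] single_in[OF I(2) u]
  have H: "single i t \<in> carrier (H {i, j})" "single j u \<in> carrier (H {i, j})"
    using H_mono[OF _ s(2)] H_mono[OF _ s(4)] by simp_all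
  have "single i t \<otimes>\<^bsub>P\<^esub> single j u = single j u \<otimes>\<^bsub>P\<^esub> single i t"
    using group_G I t u by (auto simp: single_def fun_eq_iff group.is_monoid)
  moreover have "letter i t = inn {i, j} (single i t)" "letter j u = inn {i, j} (single j u)"
    unfolding letter_def using inn_singleton[OF T _ s(2)] inn_singleton[OF T _ s(4)] by simp_all
  ultimately show ?thesis using inn_mult[OF T H] inn_mult[OF T H(2,1)] by simp
qed

text \<open>
  With these moves the group \<open>Gb\<close> itself is a combinatorial covering: the translates of \<open>C\<close> are its
  projection, and letters of adjacent types commute.
\<close>

definition gmv :: "'i \<Rightarrow> 'c \<Rightarrow> ('i set \<times> ('i \<Rightarrow> 'g)) list set \<Rightarrow> ('i set \<times> ('i \<Rightarrow> 'g)) list set" where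
  "gmv i e x = x \<otimes>\<^bsub>Gb\<^esub> letter i (correction i e (coords x i))"

lemma coords_append_letter:
  assumes x: "x \<in> carrier Gb" and i: "i \<in> I" and t: "t \<in> carrier (G i)" and k: "k \<in> I"
  shows "coords (x \<otimes>\<^bsub>Gb\<^esub> letter i t) k = (if k = i then coords x i \<otimes>\<^bsub>G i\<^esub> t else coords x k)"
proof -
  have "coords (x \<otimes>\<^bsub>Gb\<^esub> letter i t) = coords x \<otimes>\<^bsub>P\<^esub> single i t"
    using coords_mult[OF x letter_in[OF i t]] coords_letter[OF i t] by simp
  then show ?thesis
    using k monoid.r_one[OF group.is_monoid[OF group_G[OF k]] P_coord[OF coords_in[OF x] k]]
    by (auto simp: single_def P_mult_coord[OF k] simp del: mult_product_group)
qed

lemma graph_product_cover: "chamber_cover I Ed E (carrier Gb) (\<lambda>x. act (coords x) C) gmv"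
proof (unfold_locales)
  fix x i j e d assume x: "x \<in> carrier Gb"
  have xk: "coords x k \<in> carrier (G k)" if "k \<in> I" for k by (rule P_coord[OF coords_in[OF x] that])
  have corr_in: "correction k f (coords x k) \<in> carrier (G k)" if "k \<in> I" "f \<in> E k" for k f
    by (rule correction(1)[OF that that(2) xk[OF that(1)]])
  show "act (coords x) C \<in> PB" by (rule act_in[OF coords_in[OF x] C])
  show gmv_in: "gmv i e x \<in> carrier Gb" if "i \<in> I" "e \<in> E i"
    unfolding gmv_def using Gb_closed[OF x letter_in[OF that(1) corr_in[OF that]]] .
  show "act (coords (gmv i e x)) C = (act (coords x) C)(i := e)" if i: "i \<in> I" and e: "e \<in> E i"
    unfolding gmv_def
    using correction(2)[OF i e e xk[OF i]] coords_append_letter[OF x i corr_in[OF i e]] i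
    by (auto simp: product_action_def fun_eq_iff)
  show "gmv i e (gmv i d x) = gmv i e x" if i: "i \<in> I" and e: "e \<in> E i" and d: "d \<in> E i"
  proof -
    let ?t = "correction i d (coords x i)"
    let ?u = "correction i e (coords x i \<otimes>\<^bsub>G i\<^esub> ?t)"
    have t: "?t \<in> carrier (G i)" by (rule corr_in[OF i d])
    then have u: "?u \<in> carrier (G i)"
      using correction(1)[OF i e e monoid.m_closed[OF group.is_monoid[OF group_G[OF i]] xk[OF i] t]] by blast
    have "gmv i e (gmv i d x) = x \<otimes>\<^bsub>Gb\<^esub> letter i ?t \<otimes>\<^bsub>Gb\<^esub> letter i ?u"
      unfolding gmv_def using coords_append_letter[OF x i t i] by simp
    also have "\<dots> = x \<otimes>\<^bsub>Gb\<^esub> letter i (?t \<otimes>\<^bsub>G i\<^esub> ?u)"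
      using Gb_assoc[OF x letter_in[OF i t] letter_in[OF i u]] letter_mult[OF i t u] by simp
    also have "?t \<otimes>\<^bsub>G i\<^esub> ?u = correction i e (coords x i)" by (rule correction(3)[OF i e d xk[OF i]])
    finally show ?thesis unfolding gmv_def .
  qed
  show "gmv i (act (coords x) C i) x = x" if i: "i \<in> I"
    unfolding gmv_def
    using correction(4)[OF i C_coord[OF i] C_coord[OF i] xk[OF i]] letter_one[OF i] Gb_r_one[OF x] i
    by simp
  show "gmv i e (gmv j d x) = gmv j d (gmv i e x)" if ij: "{i, j} \<in> Ed" and e: "e \<in> E i" and d: "d \<in> E j"
  proof -
    have I: "i \<in> I" "j \<in> I" "i \<noteq> j" using ij graph by (auto simp: simplicial_graph_def)
    let ?t = "correction i e (coords x i)" and ?u = "correction j d (coords x j)"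
    note t = corr_in[OF I(1) e] and u = corr_in[OF I(2) d]
    have "gmv i e (gmv j d x) = x \<otimes>\<^bsub>Gb\<^esub> letter j ?u \<otimes>\<^bsub>Gb\<^esub> letter i ?t"
      unfolding gmv_def using coords_append_letter[OF x I(2) u I(1)] I(3) by simp
    also have "\<dots> = x \<otimes>\<^bsub>Gb\<^esub> letter i ?t \<otimes>\<^bsub>Gb\<^esub> letter j ?u"
      using Gb_assoc[OF x letter_in[OF I(2) u] letter_in[OF I(1) t]]
        Gb_assoc[OF x letter_in[OF I(1) t] letter_in[OF I(2) u]] letters_commute[OF ij t u] by simp
    also have "\<dots> = gmv j d (gmv i e x)"
      unfolding gmv_def using coords_append_letter[OF x I(1) t I(2)] I(3) by simp
    finally show ?thesis .
  qed
qed (rule finite_I graph)+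

text \<open>
  A morphism from the chambers to this covering inverts \<open>x \<mapsto> Psi x c0\<close> up to right multiplication by
  the stabilizer \<open>H {}\<close>. So only elements of \<open>H {}\<close> can act trivially.
\<close>

lemma Psi_trivial_in_stabilizer:
  assumes x: "x \<in> carrier Gb" and fixed: "Psi x c0 = c0"
  shows "\<exists>b\<in>carrier (H {}). x = inn {} b"
proof -
  note J0 = index_small(1)
  have "act (coords \<one>\<^bsub>Gb\<^esub>) C = pr c0" using coords_one act_one[OF C] c0(2) by simp
  from chambers_universal[OF graph_product_cover Gb_one c0(1) this]
  obtain \<theta> where \<theta>: "cover_map I E chambers pr mvc (carrier Gb) (\<lambda>x. act (coords x) C) gmv \<theta>" "\<theta> c0 = \<one>\<^bsub>Gb\<^esub>"
    by (elim exE conjE)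
  have \<theta>in: "\<theta> c \<in> carrier Gb" and \<theta>pr: "act (coords (\<theta> c)) C = pr c" if "c \<in> chambers" for c
    using \<theta>(1) that by (simp_all add: cover_map_def)
  have \<theta>mv: "\<theta> (mvc i e c) = gmv i e (\<theta> c)" if "c \<in> chambers" "i \<in> I" "e \<in> E i" for i e c
    using \<theta>(1) that by (simp add: cover_map_def)
  have residue: "d \<in> chambers \<and> (\<exists>k\<in>carrier (H T). \<theta> d = \<theta> c \<otimes>\<^bsub>Gb\<^esub> inn T k)"
    if T: "T \<in> J" and c: "c \<in> chambers" and d: "d \<in> Ch.res T c" for T c d
    using d
  proof (induction rule: residue.induct)
    case residue_base
    show ?case using c one_in_H inn_one[OF T] Gb_r_one[OF \<theta>in[OF c]] by metis
  next
    case (residue_step n i e)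
    then obtain k where n: "n \<in> chambers" and k: "k \<in> carrier (H T)" "\<theta> n = \<theta> c \<otimes>\<^bsub>Gb\<^esub> inn T k" by blast
    have i: "i \<in> I" and e: "e \<in> E i" using residue_step index_I[OF T] by blast+
    let ?t = "correction i e (coords (\<theta> n) i)"
    have t: "?t \<in> carrier (G i)" by (rule correction(1)[OF i e e P_coord[OF coords_in[OF \<theta>in[OF n]] i]])
    have s: "single i ?t \<in> carrier (H T)" using H_mono[OF _ single_in(2)[OF i t]] residue_step(2) by simp
    have "\<theta> (mvc i e n) = \<theta> n \<otimes>\<^bsub>Gb\<^esub> letter i ?t" using \<theta>mv[OF n i e] by (simp add: gmv_def)
    also have "letter i ?t = inn T (single i ?t)"
      unfolding letter_def using inn_singleton[OF T residue_step(2) single_in(2)[OF i t]] by simp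
    also have "\<theta> n \<otimes>\<^bsub>Gb\<^esub> inn T (single i ?t) = \<theta> c \<otimes>\<^bsub>Gb\<^esub> inn T (k \<otimes>\<^bsub>P\<^esub> single i ?t)"
      using k(2) Gb_assoc[OF \<theta>in[OF c] inn_in[OF T k(1)] inn_in[OF T s]] inn_mult[OF T k(1) s] by simp
    finally show ?case using H_mult[OF k(1) s] mvc_props(1)[OF n i e] by blast
  qed
  have "\<exists>b\<in>carrier (H {}). \<theta> (Psi y c0) = y \<otimes>\<^bsub>Gb\<^esub> inn {} b" if "y \<in> carrier Gb" for y
    using that
  proof (induction y rule: Gb_induct)
    case one
    have "Psi \<one>\<^bsub>Gb\<^esub> c0 = base_lift {} \<one>\<^bsub>P\<^esub> c0"
      using Psi(2)[OF J0 one_in_H] inn_one[OF J0] by simp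
    also have "\<dots> = c0" using base_lift(3)[OF J0 one_in_H] by (simp add: residue_empty)
    finally have "\<theta> (Psi \<one>\<^bsub>Gb\<^esub> c0) = \<one>\<^bsub>Gb\<^esub> \<otimes>\<^bsub>Gb\<^esub> inn {} \<one>\<^bsub>P\<^esub>"
      using \<theta>(2) inn_one[OF J0] Gb_r_one[OF Gb_one] by simp
    then show ?case using one_in_H by blast
  next
    case (snoc y T h)
    note y = snoc.hyps(1) and T = snoc.hyps(2) and h = snoc.hyps(3)
    obtain b where b: "b \<in> carrier (H {})" "\<theta> (Psi y c0) = y \<otimes>\<^bsub>Gb\<^esub> inn {} b" using snoc.IH by blast
    have bT: "b \<in> carrier (H T)" using H_mono[OF _ b(1)] by simp
    let ?d = "Psi (y \<otimes>\<^bsub>Gb\<^esub> inn T h) c0"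
    have yh: "y \<otimes>\<^bsub>Gb\<^esub> inn T h \<in> carrier Gb" by (rule Gb_closed[OF y inn_in[OF T h]])
    have "?d = Psi y (base_lift T h c0)" by (rule Psi_snoc[OF y T h c0(1)])
    then have "?d \<in> Ch.res T (Psi y c0)"
      using lies_over_residue[OF Psi_over[OF y] coords_in[OF y] index_I[OF T] c0(1) base_lift(3)[OF T h]] by simp
    then obtain k where d: "?d \<in> chambers" and k: "k \<in> carrier (H T)" "\<theta> ?d = \<theta> (Psi y c0) \<otimes>\<^bsub>Gb\<^esub> inn T k"
      using residue[OF T lies_overD(1)[OF Psi_over[OF y] c0(1)]] by blast
    \<comment> \<open>\<open>l\<close> measures how far \<open>\<theta>\<close> of the new chamber is from \<open>y h\<close>; it fixes \<open>C\<close>.\<close>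
    define l where "l = inv\<^bsub>H T\<^esub> h \<otimes>\<^bsub>P\<^esub> (b \<otimes>\<^bsub>P\<^esub> k)"
    have bk: "b \<otimes>\<^bsub>P\<^esub> k \<in> carrier (H T)" by (rule H_mult[OF bT k(1)])
    have ih: "inv\<^bsub>H T\<^esub> h \<in> carrier (H T)" by (rule group.inv_closed[OF group_H h])
    have l: "l \<in> carrier (H T)" unfolding l_def by (rule H_mult[OF ih bk])
    have hl: "h \<otimes>\<^bsub>P\<^esub> l = b \<otimes>\<^bsub>P\<^esub> k"
      unfolding l_def mult_H[symmetric, of T]
      using monoid.m_assoc[OF group.is_monoid[OF group_H] h ih bk[unfolded mult_H[symmetric, of T]]]
        group.r_inv[OF group_H h] monoid.l_one[OF group.is_monoid[OF group_H] bk[unfolded mult_H[symmetric, of T]]]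
      by (simp only: mult_H)
    have "\<theta> ?d = y \<otimes>\<^bsub>Gb\<^esub> inn T b \<otimes>\<^bsub>Gb\<^esub> inn T k"
      using k(2) b(2) inn_stabilizer[OF T b(1)] by simp
    also have "\<dots> = y \<otimes>\<^bsub>Gb\<^esub> inn T (h \<otimes>\<^bsub>P\<^esub> l)"
      using Gb_assoc[OF y inn_in[OF T bT] inn_in[OF T k(1)]] inn_mult[OF T bT k(1)] hl by simp
    also have "\<dots> = y \<otimes>\<^bsub>Gb\<^esub> inn T h \<otimes>\<^bsub>Gb\<^esub> inn T l"
      using Gb_assoc[OF y inn_in[OF T h] inn_in[OF T l]] inn_mult[OF T h l] by simp
    finally have \<theta>d: "\<theta> ?d = y \<otimes>\<^bsub>Gb\<^esub> inn T h \<otimes>\<^bsub>Gb\<^esub> inn T l" .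
    let ?g = "coords (y \<otimes>\<^bsub>Gb\<^esub> inn T h)"
    note gP = coords_in[OF yh]
    have "act (?g \<otimes>\<^bsub>P\<^esub> l) C = act ?g C"
      using \<theta>pr[OF d] \<theta>d coords_mult[OF yh inn_in[OF T l]] coords(2)[OF T l]
        lies_overD(2)[OF Psi_over[OF yh] c0(1)] c0(2) by simp
    then have "act ?g (act l C) = act ?g C" using act_mult[OF gP H_in_P[OF l] C] by simp
    then have "act l C = C"
      using act_inv[OF gP act_in[OF H_in_P[OF l] C]] act_inv[OF gP C] by simp
    then have "l \<in> carrier (H {})" using H_in_P[OF l] by (simp only: carrier_H_empty)
    then show ?case using \<theta>d inn_stabilizer[OF T] by auto
  qed
  then obtain b where b: "b \<in> carrier (H {})" "\<theta> (Psi x c0) = x \<otimes>\<^bsub>Gb\<^esub> inn {} b" using x by blast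
  have ib: "inv\<^bsub>H {}\<^esub> b \<in> carrier (H {})" by (rule group.inv_closed[OF group_H b(1)])
  interpret h0: group_hom "H {}" Gb "inn {}"
    using inn_hom[OF J0] group_H group_Gb by (simp add: group_hom_def group_hom_axioms_def)
  have "x \<otimes>\<^bsub>Gb\<^esub> inn {} b = \<one>\<^bsub>Gb\<^esub>" using b(2) fixed \<theta>(2) by simp
  then have "x = inv\<^bsub>Gb\<^esub> (inn {} b)" using x inn_in[OF J0 b(1)] group.inv_equality[OF group_Gb] by metis
  then have "x = inn {} (inv\<^bsub>H {}\<^esub> b)" using h0.hom_inv[OF b(1)] by simp
  then show ?thesis using ib by blast
qed

lemma in_action_kernel_iff:
  assumes i: "i \<in> I"
  shows "g \<in> action_kernel (G i) (E i) (\<phi> i) \<longleftrightarrow> g \<in> carrier (G i) \<and> (\<forall>e\<in>E i. \<phi> i g e = e)"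
proof -
  have "\<phi> i g = (\<lambda>e\<in>E i. e) \<longleftrightarrow> (\<forall>e\<in>E i. \<phi> i g e = e)" if "g \<in> carrier (G i)"
    using Bij_imp_extensional[OF group_action.bij_prop0[OF action[OF i] that]]
    by (auto simp: fun_eq_iff extensional_def)
  then show ?thesis by (auto simp: action_kernel_def kernel_def BijGroup_def)
qed

lemma kernel_Psi: "kernel Gb L Psi = ggp_kernel I Ed E G \<phi> C"
proof -
  let ?N = "\<Pi>\<^sub>E i\<in>I. action_kernel (G i) (E i) (\<phi> i)"
  note J0 = index_small(1)
  have N_iff: "n \<in> ?N \<longleftrightarrow> n \<in> carrier P \<and> (\<forall>i\<in>I. \<forall>e\<in>E i. \<phi> i (n i) e = e)" for n
    by (auto simp: PiE_iff in_action_kernel_iff)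
  have NH: "n \<in> carrier (H {})" if "n \<in> ?N" for n
    using that C_coord unfolding N_iff carrier_H by blast
  show ?thesis
  proof
    show "ggp_kernel I Ed E G \<phi> C \<subseteq> kernel Gb L Psi"
    proof
      fix x assume "x \<in> ggp_kernel I Ed E G \<phi> C"
      then obtain n where n: "n \<in> ?N" "x = inn {} n" by (auto simp: ggp_kernel_def)
      have "base_lift {} n = (\<lambda>c\<in>chambers. c)"
      proof (rule base_lift_eqI[OF J0 NH[OF n(1)]])
        show "lies_over n (\<lambda>c\<in>chambers. c)"
          by (rule lies_over_restrict[OF lies_over_id]) (use n(1) N_iff in blast)
      qed (simp_all add: c0 residue_empty)
      then have "Psi x = \<one>\<^bsub>L\<^esub>" using Psi(2)[OF J0 NH[OF n(1)]] n(2) one_L by simp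
      then show "x \<in> kernel Gb L Psi" using inn_in[OF J0 NH[OF n(1)]] n(2) by (simp add: kernel_def)
    qed
    show "kernel Gb L Psi \<subseteq> ggp_kernel I Ed E G \<phi> C"
    proof
      fix x assume "x \<in> kernel Gb L Psi"
      then have x: "x \<in> carrier Gb" "Psi x = (\<lambda>c\<in>chambers. c)" by (simp_all add: kernel_def one_L)
      have "Psi x c0 = c0" using x(2) c0(1) by simp
      then obtain b where b: "b \<in> carrier (H {})" "x = inn {} b"
        using Psi_trivial_in_stabilizer[OF x(1)] by blast
      have over: "lies_over b (\<lambda>c\<in>chambers. c)"
        using base_lift(2)[OF J0 b(1)] Psi(2)[OF J0 b(1)] b(2) x(2) by simp
      have "\<phi> i (b i) e = e" if i: "i \<in> I" and e: "e \<in> E i" for i e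
      proof -
        obtain c where c: "c \<in> chambers" "pr c = C(i := e)" using chamber_over[OF upd_in_PB[OF C i e]] by blast
        have "act b (C(i := e)) = C(i := e)" using lies_overD(2)[OF over c(1)] c by simp
        then have "act b (C(i := e)) i = e" by simp
        then show ?thesis using i by simp
      qed
      then have "b \<in> ?N" using H_in_P[OF b(1)] N_iff by blast
      then show "x \<in> ggp_kernel I Ed E G \<phi> C" using b(2) by (auto simp: ggp_kernel_def)
    qed
  qed
qed

theorem lift_group_iso: "L \<cong> Gb Mod ggp_kernel I Ed E G \<phi> C"
proof -
  interpret Psi: group_hom Gb L Psi
    using Psi(1) group_Gb group_L by (simp add: group_hom_def group_hom_axioms_def)
  have "Gb Mod kernel Gb L Psi \<cong> L" by (rule Psi.FactGroup_iso[OF Psi_surj])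
  moreover have "group (Gb Mod kernel Gb L Psi)" by (rule normal.factorgroup_is_group[OF Psi.normal_kernel])
  ultimately show ?thesis unfolding kernel_Psi by (rule group.iso_sym[rotated])
qed

end

theorem lemma11p2:
  fixes I :: "'i set" and Ed :: "'i set set"
    and E :: "'i \<Rightarrow> 'c set"
    and G :: "'i \<Rightarrow> 'g monoid" and \<phi> :: "'i \<Rightarrow> 'g \<Rightarrow> 'c \<Rightarrow> 'c"
    and C :: "'i \<Rightarrow> 'c"
    and X :: "'x topology" and q :: "'x \<Rightarrow> (('i \<Rightarrow> 'c) \<times> ('i set \<Rightarrow> real)) set"
  assumes "finite I" and "simplicial_graph I Ed"
    and "\<And>i. i \<in> I \<Longrightarrow> rank_one_building (E i)"
    and "\<And>i. i \<in> I \<Longrightarrow> group (G i)"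
    and "\<And>i. i \<in> I \<Longrightarrow> transitive_action (G i) (E i) (\<phi> i)"
    and "C \<in> product_building I E"
    and "universal_cover X (U_space I Ed E) q"
  shows "lift_group I Ed E G \<phi> X q \<cong> gen_graph_product I Ed G \<phi> C Mod ggp_kernel I Ed E G \<phi> C"
proof -
  interpret lifted_action_based I Ed E X q G \<phi> C
    by (intro lifted_action_based.intro lifted_action.intro universal_cover_of_U.intro
        lifted_action_axioms.intro lifted_action_based_axioms.intro assms)
  show ?thesis by (rule lift_group_iso)
qed

end
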